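(* Let $k$ be an algebraically closed field and let $F\in A=k^{[2]}$ be a generally rational polynomial in $A$. Then $$t-1=\sum_{\lambda\in k}(n_\lambda-1),$$ where $t$ is the number of dicriticals of $F$ and $n_\lambda$ is the number of irreducible components of the closed subset $V(F-\lambda)$ of $\operatorname{Spec}A$ (the sum has only finitely many nonzero terms).
   Context: $k^{[2]}$ is a polynomial ring in two variables over $k$. $F$ is a generally rational polynomial in $A$ if, for all but finitely many $\lambda\in k$, $F-\lambda$ is irreducible in $A$ and $\operatorname{Frac}(A/(F-\lambda))$ is a purely transcendental extension of $k$ of transcendence degree $1$. For $F\in A\setminus k$, let $\mathcal A=S^{-1}A$ with $S=k[F]\setminus\{0\}$; the dicriticals of $F$ are the valuation rings $\mathcal O$ of $\operatorname{Frac}A$ with $k(F)\subseteq\mathcal O\ne\operatorname{Frac}A$ and $\mathcal A\not\subseteq\mathcal O$; their number $t$ is a positive integer. *)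

theory Defs
  imports "HOL-Computational_Algebra.Computational_Algebra"
begin

text \<open>The polynomial ring A = k[x,y] is modelled as ('k poly) poly = k[x][y];
  its fraction field Frac A is ('k poly poly) fract, and the rational function
  field k(t) in one variable is ('k poly) fract.\<close>

definition kconst :: "'k::field \<Rightarrow> 'k poly poly" where
  "kconst c = [:[:c:]:]"

definition subst_F :: "'k::field poly \<Rightarrow> 'k poly poly \<Rightarrow> 'k poly poly" where
  "subst_F a F = poly (map_poly kconst a) F"

text \<open>Frac(A/(P)) is k-isomorphic to k(t): equivalently there is a k-algebra
  homomorphism A \<rightarrow> k(t) with kernel exactly (P) whose image generates k(t) as a field.\<close>
definition frac_quotient_is_rational ::
    "'k::field poly poly \<Rightarrow> bool" where
  "frac_quotient_is_rational P \<longleftrightarrow>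
     (\<exists>\<phi> :: 'k poly poly \<Rightarrow> 'k poly fract.
        (\<forall>a b. \<phi> (a + b) = \<phi> a + \<phi> b) \<and>
        (\<forall>a b. \<phi> (a * b) = \<phi> a * \<phi> b) \<and>
        \<phi> 1 = 1 \<and>
        (\<forall>c. \<phi> (kconst c) = to_fract [:c:]) \<and>
        (\<forall>a. \<phi> a = 0 \<longleftrightarrow> P dvd a) \<and>
        (\<forall>z. \<exists>a b. \<phi> b \<noteq> 0 \<and> z = \<phi> a / \<phi> b))"

definition generally_rational :: "'k::field poly poly \<Rightarrow> bool" where
  "generally_rational F \<longleftrightarrow>
     finite {l. \<not> (irreducible (F - kconst l) \<and>
                      frac_quotient_is_rational (F - kconst l))}"

definition valuation_ring :: "'f::field set \<Rightarrow> bool" where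
  "valuation_ring R \<longleftrightarrow>
     0 \<in> R \<and> 1 \<in> R \<and>
     (\<forall>x\<in>R. \<forall>y\<in>R. x + y \<in> R \<and> x * y \<in> R) \<and>
     (\<forall>x\<in>R. - x \<in> R) \<and>
     (\<forall>z. z \<noteq> 0 \<longrightarrow> z \<in> R \<or> inverse z \<in> R)"

definition kF :: "'k::field poly poly \<Rightarrow> 'k poly poly fract set" where
  "kF F = {to_fract (subst_F a F) / to_fract (subst_F b F) | a b. subst_F b F \<noteq> 0}"

definition loc_A :: "'k::field poly poly \<Rightarrow> 'k poly poly fract set" where
  "loc_A F = {to_fract a / to_fract (subst_F s F) | a s. subst_F s F \<noteq> 0}"

definition dicriticals :: "'k::field poly poly \<Rightarrow> 'k poly poly fract set set" where
  "dicriticals F = {R. valuation_ring R \<and> kF F \<subseteq> R \<and> R \<noteq> UNIV \<and> \<not> loc_A F \<subseteq> R}"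

text \<open>Prime ideals of A; irreducible components of V(G) in Spec A correspond
  to minimal prime ideals containing G.\<close>
definition prime_ideal_A :: "'k::field poly poly set \<Rightarrow> bool" where
  "prime_ideal_A P \<longleftrightarrow>
     0 \<in> P \<and> (\<forall>x\<in>P. \<forall>y\<in>P. x + y \<in> P) \<and> (\<forall>a. \<forall>x\<in>P. a * x \<in> P) \<and>
     1 \<notin> P \<and> (\<forall>a b. a * b \<in> P \<longrightarrow> a \<in> P \<or> b \<in> P)"

definition minimal_primes_over :: "'k::field poly poly \<Rightarrow> 'k poly poly set set" where
  "minimal_primes_over G =
     {P. prime_ideal_A P \<and> G \<in> P \<and>
         (\<forall>Q. prime_ideal_A Q \<and> G \<in> Q \<and> Q \<subseteq> P \<longrightarrow> Q = P)}"

definition n_comp :: "'k::field poly poly \<Rightarrow> 'k \<Rightarrow> nat" where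
  "n_comp F l = card (minimal_primes_over (F - kconst l))"

end

theory Submission
  imports "HOL-Algebra.Algebraic_Closure_Type" "HOL-Library.Function_Algebras" Defs
begin

text \<open>
  Let \<open>K = k(F)\<close> and let \<open>C\<close> be the generic fibre of \<open>F\<close>, a curve over \<open>K\<close> whose coordinate ring is
  the localization of \<open>A\<close> and whose places at infinity are the \<open>t\<close> dicriticals. Since \<open>A\<close> is
  factorial, the units of the localization modulo \<open>K\<close> are generated by the irreducible factors of
  the \<open>F - l\<close>, the only relations being those given by the \<open>F - l\<close> themselves; so they have rank
  equal to the sum of the \<open>n_l - 1\<close>. A unit without poles at infinity is algebraic over \<open>K\<close>, hence
  constant on almost every fibre, hence in \<open>K\<close>; so the valuations at infinity embed this group,
  up to torsion, into a group of rank \<open>t - 1\<close>.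

  That the rank is \<open>t - 1\<close> is where rationality enters. Almost all fibres have parametrizations of
  bounded degree, so by specialization the generic fibre has a parametrization over the algebraic
  closure \<open>K'\<close> of \<open>K\<close>, which embeds \<open>Frac A\<close> into \<open>K'(s)\<close>. Given two dicriticals, take a function
  on the projective line with one zero above the first and one pole above the second: the constant
  coefficient of its minimal polynomial over \<open>Frac A\<close> is a unit which has a zero at the first, a pole at
  the second and neither at the other dicriticals. No separability is needed, so the argument works
  in every characteristic.
\<close>

(* Importing Defs last makes degree, irreducible etc. denote the constants of the polynomial
   library and not those of HOL-Algebra. *)
no_notation var (\<open>X\<index>\<close>)

section \<open>Linear systems, subrings and valuation rings\<close>

text \<open>Rationality of the single fibres gives no parametrization that varies algebraically with
  \<open>l\<close>. The degree bound turns its existence into the solvability of one finite system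
  of polynomial conditions, and this passes to the generic point. The resulting parametrization is
  not claimed to be birational; all that is extracted from it is an embedding of
  \<open>Frac A\<close> into a rational function field over \<open>K'\<close>. The same embedding
  makes the dicriticals discrete, although they are defined as arbitrary valuation rings: they
  extend to \<open>K'(s)\<close>, where every proper valuation ring containing \<open>K'\<close>
  belongs to a point of the projective line. Algebraic dependence is drawn from a single criterion:
  an element of all valuation rings above \<open>R\<close> is integral over \<open>R\<close>. Taking
  for \<open>R\<close> the trivial valuation ring \<open>UNIV\<close> replaces arguments with
  transcendence degrees. Ranks of groups are never formed. Each of the two inequalities is proved by
  contradiction: with more exponents than conditions an integer system has a nontrivial solution,
  and the product built from it is shown to have only zero exponents. The upper bound is proved for
  finite sets of dicriticals, so that the finiteness of \<open>t\<close> follows from it.\<close>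

lemma homogeneous_system_nontrivial:
  fixes A :: "'e \<Rightarrow> 'i \<Rightarrow> 'a::idom"
  assumes "finite E" "finite I" "card E < card I"
  shows "\<exists>c. (\<exists>i\<in>I. c i \<noteq> 0) \<and> (\<forall>e\<in>E. (\<Sum>i\<in>I. A e i * c i) = 0)"
  using assms
proof (induction E arbitrary: I A rule: finite_induct)
  case empty
  then obtain i where "i \<in> I" by fastforce
  then show ?case by (intro exI[of _ "\<lambda>_. 1"]) auto
next
  case (insert e E)
  show ?case
  proof (cases "\<forall>i\<in>I. A e i = 0")
    case True
    from insert.IH[of I A] insert.prems insert.hyps obtain c where
      "\<exists>i\<in>I. c i \<noteq> 0" "\<forall>e\<in>E. (\<Sum>i\<in>I. A e i * c i) = 0" by auto
    with True show ?thesis by (intro exI[of _ c]) auto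
  next
    case False
    then obtain k where k: "k \<in> I" "A e k \<noteq> 0" by blast
    define J where "J = I - {k}"
    have J: "finite J" "k \<notin> J" "I = insert k J" using insert.prems k by (auto simp: J_def)
    have "card E < card J" using insert.prems insert.hyps J by auto
    \<comment> \<open>The unknown \<open>k\<close> is eliminated by cross-multiplication with the
      pivot \<open>A e k\<close>, without division, so the solution stays in the domain. The final
      count needs integer exponents, the degree bound polynomial coefficients.\<close>
    from insert.IH[OF J(1) this, of "\<lambda>f i. A e k * A f i - A f k * A e i"]
    obtain c where c: "\<exists>i\<in>J. c i \<noteq> 0"
      "\<forall>f\<in>E. (\<Sum>i\<in>J. (A e k * A f i - A f k * A e i) * c i) = 0" by blast
    define d where "d i = (if i = k then - (\<Sum>i\<in>J. A e i * c i) else A e k * c i)" for i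
    have sum_d: "(\<Sum>i\<in>I. A f i * d i) =
        - A f k * (\<Sum>i\<in>J. A e i * c i) + A e k * (\<Sum>i\<in>J. A f i * c i)" for f
    proof -
      have "(\<Sum>i\<in>J. A f i * d i) = (\<Sum>i\<in>J. A e k * (A f i * c i))"
        using J(2) by (intro sum.cong) (auto simp: d_def algebra_simps)
      then show ?thesis using J by (simp add: d_def sum_distrib_left sum_negf)
    qed
    have "(\<Sum>i\<in>I. A f i * d i) = 0" if "f \<in> E" for f
    proof -
      have "0 = (\<Sum>i\<in>J. A e k * (A f i * c i) - A f k * (A e i * c i))"
        using c(2) that by (simp add: left_diff_distrib mult.assoc)
      also have "\<dots> = (\<Sum>i\<in>I. A f i * d i)"
        unfolding sum_d by (simp add: sum_subtractf sum_distrib_left sum_negf)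
      finally show ?thesis by simp
    qed
    moreover have "(\<Sum>i\<in>I. A e i * d i) = 0" unfolding sum_d by simp
    moreover have "\<exists>i\<in>I. d i \<noteq> 0" using c(1) J k by (auto simp: d_def)
    ultimately show ?thesis by (intro exI[of _ d]) auto
  qed
qed

section \<open>Subrings, polynomials over them, adjunction of one element\<close>

definition is_subring :: "'f::comm_ring_1 set \<Rightarrow> bool" where
  "is_subring B \<longleftrightarrow> 0 \<in> B \<and> 1 \<in> B \<and> (\<forall>x\<in>B. \<forall>y\<in>B. x + y \<in> B \<and> x * y \<in> B) \<and> (\<forall>x\<in>B. - x \<in> B)"

lemma is_subring_0: "is_subring B \<Longrightarrow> 0 \<in> B"
  and is_subring_1: "is_subring B \<Longrightarrow> 1 \<in> B"
  and is_subring_add: "is_subring B \<Longrightarrow> x \<in> B \<Longrightarrow> y \<in> B \<Longrightarrow> x + y \<in> B"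
  and is_subring_mult: "is_subring B \<Longrightarrow> x \<in> B \<Longrightarrow> y \<in> B \<Longrightarrow> x * y \<in> B"
  and is_subring_uminus: "is_subring B \<Longrightarrow> x \<in> B \<Longrightarrow> - x \<in> B"
  by (auto simp: is_subring_def)

lemma is_subring_diff: "is_subring B \<Longrightarrow> x \<in> B \<Longrightarrow> y \<in> B \<Longrightarrow> x - y \<in> B"
  using is_subring_add[of B x "- y"] is_subring_uminus[of B y] by simp

lemma is_subring_sum: "is_subring B \<Longrightarrow> (\<And>i. i \<in> I \<Longrightarrow> f i \<in> B) \<Longrightarrow> sum f I \<in> B"
  by (induction I rule: infinite_finite_induct) (auto intro: is_subring_0 is_subring_add)

lemma is_subring_power: "is_subring B \<Longrightarrow> x \<in> B \<Longrightarrow> x ^ n \<in> B"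
  by (induction n) (auto intro: is_subring_1 is_subring_mult)

lemmas is_subring_intros = is_subring_0 is_subring_1 is_subring_add is_subring_mult
  is_subring_uminus is_subring_diff is_subring_sum is_subring_power

definition polys_over :: "'f::comm_ring_1 set \<Rightarrow> 'f poly set" where
  "polys_over B = {p. \<forall>i. coeff p i \<in> B}"

lemma polys_overD: "p \<in> polys_over B \<Longrightarrow> coeff p i \<in> B"
  by (simp add: polys_over_def)

lemma is_subring_polys_over:
  assumes "is_subring B"
  shows "is_subring (polys_over B)"
proof -
  have "coeff 1 i \<in> B" for i
    using assms by (auto simp: coeff_1 intro: is_subring_0 is_subring_1)
  then show ?thesis
    using assms unfolding is_subring_def[of "polys_over B"] unfolding polys_over_def
    by (auto simp: coeff_mult intro!: is_subring_intros)
qed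

lemma polys_over_pCons:
  "is_subring B \<Longrightarrow> pCons a p \<in> polys_over B \<longleftrightarrow> a \<in> B \<and> p \<in> polys_over B"
  unfolding polys_over_def by (simp add: coeff_pCons split: nat.split) (metis nat.distinct(1) not0_implies_Suc)

lemma polys_over_monom: "is_subring B \<Longrightarrow> a \<in> B \<Longrightarrow> monom a n \<in> polys_over B"
  by (auto simp: polys_over_def intro: is_subring_0)

lemma polys_over_smult: "is_subring B \<Longrightarrow> a \<in> B \<Longrightarrow> p \<in> polys_over B \<Longrightarrow> smult a p \<in> polys_over B"
  by (auto simp: polys_over_def intro: is_subring_mult)

definition adjoin :: "'f::comm_ring_1 set \<Rightarrow> 'f \<Rightarrow> 'f set" where
  "adjoin B z = {poly p z | p. p \<in> polys_over B}"

lemma is_subring_adjoin: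
  assumes "is_subring B"
  shows "is_subring (adjoin B z)"
proof -
  note P = is_subring_polys_over[OF assms]
  show ?thesis unfolding is_subring_def adjoin_def
  proof (safe)
    show "\<exists>p. 0 = poly p z \<and> p \<in> polys_over B" using is_subring_0[OF P] by (intro exI[of _ 0]) auto
    show "\<exists>p. 1 = poly p z \<and> p \<in> polys_over B" using is_subring_1[OF P] by (intro exI[of _ 1]) auto
  next
    fix p q assume "p \<in> polys_over B" "q \<in> polys_over B"
    then show "\<exists>r. poly p z + poly q z = poly r z \<and> r \<in> polys_over B"
      "\<exists>r. poly p z * poly q z = poly r z \<and> r \<in> polys_over B"
      using is_subring_add[OF P, of p q] is_subring_mult[OF P, of p q]
      by (metis poly_add, metis poly_mult)
  next
    fix p assume "p \<in> polys_over B"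
    then show "\<exists>r. - poly p z = poly r z \<and> r \<in> polys_over B"
      using is_subring_uminus[OF P, of p] by (metis poly_minus)
  qed
qed

lemma adjoin_base: "is_subring B \<Longrightarrow> B \<subseteq> adjoin B z"
  unfolding adjoin_def
  by (auto intro!: exI[of _ "[:_:]"] simp: polys_over_pCons is_subring_0[OF is_subring_polys_over])

lemma adjoin_gen: "is_subring B \<Longrightarrow> z \<in> adjoin B z"
  unfolding adjoin_def
  by (auto intro!: exI[of _ "[:0, 1:]"] simp: polys_over_pCons is_subring_0[OF is_subring_polys_over]
      is_subring_0 is_subring_1)

lemma poly_polys_over: "is_subring B \<Longrightarrow> p \<in> polys_over B \<Longrightarrow> z \<in> B \<Longrightarrow> poly p z \<in> B"
  by (auto simp: poly_altdef intro!: is_subring_intros polys_overD)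

section \<open>Ideals generated inside a subring\<close>

inductive_set gen_ideal :: "'f::comm_ring_1 set \<Rightarrow> 'f set \<Rightarrow> 'f set" for J B where
  zero: "0 \<in> gen_ideal J B"
| step: "j \<in> J \<Longrightarrow> b \<in> B \<Longrightarrow> x \<in> gen_ideal J B \<Longrightarrow> j * b + x \<in> gen_ideal J B"

lemma gen_ideal_mono: 
  assumes "B \<subseteq> C" "J \<subseteq> J'" shows "gen_ideal J B \<subseteq> gen_ideal J' C"
proof
  fix x assume "x \<in> gen_ideal J B"
  then show "x \<in> gen_ideal J' C" by induction (use assms in \<open>auto intro: gen_ideal.intros\<close>)
qed

lemma gen_ideal_add: "x \<in> gen_ideal J B \<Longrightarrow> y \<in> gen_ideal J B \<Longrightarrow> x + y \<in> gen_ideal J B"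
  by (induction rule: gen_ideal.induct) (auto simp: add.assoc intro: gen_ideal.intros)

lemma gen_ideal_mult: "x \<in> gen_ideal J B \<Longrightarrow> is_subring B \<Longrightarrow> c \<in> B \<Longrightarrow> c * x \<in> gen_ideal J B"
proof (induction x rule: gen_ideal.induct)
  case (step j b x)
  have "c * (j * b + x) = j * (c * b) + c * x" by (simp add: algebra_simps)
  then show ?case using step gen_ideal.step[of j J "c * b" B "c * x"] by (auto intro: is_subring_mult)
qed (auto intro: gen_ideal.zero)

lemma gen_ideal_sum: "(\<And>i. i \<in> I \<Longrightarrow> f i \<in> gen_ideal J B) \<Longrightarrow> sum f I \<in> gen_ideal J B"
  by (induction I rule: infinite_finite_induct) (auto intro: gen_ideal.zero gen_ideal_add)

lemma gen_ideal_subset: "is_subring B \<Longrightarrow> J \<subseteq> B \<Longrightarrow> gen_ideal J B \<subseteq> B"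
proof
  fix x assume "x \<in> gen_ideal J B" "is_subring B" "J \<subseteq> B"
  then show "x \<in> B" by induction (auto intro: is_subring_intros)
qed

lemma gen_ideal_gen: "is_subring B \<Longrightarrow> j \<in> J \<Longrightarrow> j \<in> gen_ideal J B"
  using gen_ideal.step[OF _ is_subring_1 gen_ideal.zero] by fastforce

lemma gen_ideal_Union_chain:
  assumes "x \<in> gen_ideal J (\<Union>C)" "C \<noteq> {}" "\<And>A B. A \<in> C \<Longrightarrow> B \<in> C \<Longrightarrow> A \<subseteq> B \<or> B \<subseteq> A"
  shows "\<exists>B\<in>C. x \<in> gen_ideal J B"
  using assms(1)
proof induction
  case zero
  then show ?case using assms(2) gen_ideal.zero by blast
next
  case (step j b x)
  then obtain B1 B2 where B: "B1 \<in> C" "b \<in> B1" "B2 \<in> C" "x \<in> gen_ideal J B2" by blast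
  then consider "B1 \<subseteq> B2" | "B2 \<subseteq> B1" using assms(3) by blast
  then show ?case
  proof cases
    case 1
    then show ?thesis using B step gen_ideal.step by blast
  next
    case 2
    then show ?thesis using B step gen_ideal.step gen_ideal_mono[OF 2, of J J] by blast
  qed
qed

lemma gen_ideal_adjoin:
  assumes "is_subring B" "x \<in> gen_ideal J (adjoin B z)"
  shows "\<exists>p. (\<forall>i. coeff p i \<in> gen_ideal J B) \<and> x = poly p z"
  using assms(2)
proof induction
  case zero
  show ?case by (intro exI[of _ 0]) (auto intro: gen_ideal.zero)
next
  case (step j b x)
  then obtain p q where p: "\<forall>i. coeff p i \<in> gen_ideal J B" "x = poly p z"
    and q: "q \<in> polys_over B" "b = poly q z" by (auto simp: adjoin_def)
  have "coeff q i * j \<in> gen_ideal J B" for i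
    using gen_ideal_mult[OF gen_ideal_gen[OF assms(1) step(1)] assms(1)] polys_overD[OF q(1)] .
  then show ?case using p q
    by (intro exI[of _ "smult j q + p"]) (auto intro!: gen_ideal_add simp: mult.commute)
qed

text \<open>Descent on the sum of the degrees: the relation of smaller degree removes the leading
  term of the other one, until a relation is constant and puts 1 into the ideal. This is the core of
  Chevalley's theorem: \<open>J\<close> cannot generate the unit ideal both after adjoining
  \<open>z\<close> and after adjoining \<open>inverse z\<close>.\<close>

lemma gen_ideal_no_inverse_pair:
  fixes B :: "'f::field set"
  assumes "is_subring B" "1 \<notin> gen_ideal J B" "J \<subseteq> B" "z \<noteq> 0"
    "\<forall>i. coeff p i \<in> gen_ideal J B" "\<forall>i. coeff q i \<in> gen_ideal J B"
    "poly p z = 1" "poly q (inverse z) = 1"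
  shows False
  using assms
proof (induction "degree p + degree q" arbitrary: p q z rule: less_induct)
  case less
  let ?I = "gen_ideal J B"
  show False
  proof (cases "degree p = 0 \<or> degree q = 0")
    case True
    then have "1 \<in> ?I" using less.prems
      by (metis poly_0_coeff_0 degree_eq_zeroE poly_const_conv coeff_pCons_0)
    then show False using less.prems by simp
  next
    case False
    have red: "\<exists>p'. degree p' < degree p \<and> (\<forall>i. coeff p' i \<in> ?I) \<and> poly p' z = 1"
      if le: "degree q \<le> degree p" and pos: "degree q > 0" and z: "z \<noteq> 0" 
        and p: "\<forall>i. coeff p i \<in> ?I" and q: "\<forall>i. coeff q i \<in> ?I"
        and pz: "poly p z = 1" and qz: "poly q (inverse z) = 1" for p q :: "'f poly" and z
    proof -
      let ?n = "degree p" and ?m = "degree q"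
      let ?a = "coeff p" and ?b = "coeff q"
      define p1 where "p1 = (\<Sum>i<?n. monom (?a i) i)"
      define q1 where "q1 = (\<Sum>j\<in>{1..?m}. monom (?b j) (?n - j))"
      \<comment> \<open>The relation for \<open>p\<close> is multiplied by \<open>1 - ?b 0\<close>,
        and then \<open>(1 - ?b 0) * z ^ ?n\<close> is replaced by the value of \<open>q1\<close>,
        which has smaller degree. Adding \<open>?b 0\<close> restores the value 1. Nothing is
        divided by \<open>1 - ?b 0\<close>, so the step works in rings that are not local.\<close>
      define p' where "p' = [:?b 0:] + smult (1 - ?b 0) p1 + smult (?a ?n) q1"
      have d1: "degree p1 < ?n" unfolding p1_def using le pos
        by (intro degree_sum_less) (auto intro: le_less_trans[OF degree_monom_le])
      have d2: "degree q1 < ?n" unfolding q1_def using le pos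
        by (intro degree_sum_less) (auto intro: le_less_trans[OF degree_monom_le])
      have "degree p' < ?n" unfolding p'_def using d1 d2 le pos
        by (intro degree_add_less) (auto intro: le_less_trans[OF degree_smult_le])
      moreover have "coeff p' i \<in> ?I" for i
      proof -
        have I: "?I \<subseteq> B" using gen_ideal_subset assms by blast
        then have c: "1 - ?b 0 \<in> B" "?a ?n \<in> B" using p q assms(1) by (auto intro!: is_subring_intros)
        have "coeff p1 i \<in> ?I" using p
          by (auto simp: p1_def coeff_sum intro!: gen_ideal_sum gen_ideal.zero)
        moreover have "coeff q1 i \<in> ?I" using q
          by (auto simp: q1_def coeff_sum intro!: gen_ideal_sum gen_ideal.zero)
        moreover have "coeff [:?b 0:] i \<in> ?I" using q
          by (auto simp: coeff_pCons split: nat.splits intro: gen_ideal.zero)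
        ultimately show ?thesis unfolding p'_def using c
          by (auto intro!: gen_ideal_add gen_ideal_mult assms(1))
      qed
      moreover have "poly p' z = 1"
      proof -
        have "{..?n} = insert ?n {..<?n}" by auto
        then have e1: "poly p1 z + ?a ?n * z ^ ?n = 1" using pz
          by (simp add: poly_altdef[of p] p1_def poly_sum poly_monom add.commute)
        have "poly q1 z = (\<Sum>j\<in>{1..?m}. z ^ ?n * (?b j * inverse z ^ j))"
          unfolding q1_def using z le
          by (simp add: poly_sum poly_monom power_diff field_simps)
        also have "\<dots> = z ^ ?n * (1 - ?b 0)"
        proof -
          have "{..?m} = insert 0 {1..?m}" by auto
          then have "?b 0 + (\<Sum>j\<in>{1..?m}. ?b j * inverse z ^ j) = 1" using qz
            by (simp add: poly_altdef)
          then have "(\<Sum>j\<in>{1..?m}. ?b j * inverse z ^ j) = 1 - ?b 0" by (simp add: algebra_simps)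
          then show ?thesis by (simp add: sum_distrib_left[symmetric])
        qed
        finally have "poly q1 z = z ^ ?n * (1 - ?b 0)" .
        moreover have "poly p1 z = 1 - ?a ?n * z ^ ?n" using e1 by (simp add: algebra_simps)
        ultimately have "poly p' z = ?b 0 + (1 - ?b 0) * (1 - ?a ?n * z ^ ?n) + ?a ?n * (z ^ ?n * (1 - ?b 0))"
          by (simp add: p'_def)
        then show ?thesis by (simp add: algebra_simps)
      qed
      ultimately show ?thesis by blast
    qed
    show False
    proof (cases "degree q \<le> degree p")
      case True
      from red[OF True, of z] False less.prems obtain p' where
        "degree p' < degree p" "\<forall>i. coeff p' i \<in> ?I" "poly p' z = 1" by auto
      then show False using less.hyps[of p' q z] less.prems by auto
    next
      case F: False
      from red[of p q "inverse z"] F False less.prems obtain q' where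
        "degree q' < degree q" "\<forall>i. coeff q' i \<in> ?I" "poly q' (inverse z) = 1" by auto
      then show False using less.hyps[of p q' z] less.prems by auto
    qed
  qed
qed

text \<open>For a valuation ring this is the maximal ideal: \<open>inverse x \<notin> R\<close>
  already forces \<open>x \<in> R\<close>. Stated through inverses, it commutes with preimages under
  field embeddings.\<close>

definition vmax :: "'f::field set \<Rightarrow> 'f set" where
  "vmax R = {x. x = 0 \<or> inverse x \<notin> R}"

lemma valuation_ring_is_subring: "valuation_ring R \<Longrightarrow> is_subring R"
  by (auto simp: valuation_ring_def is_subring_def)

lemma valuation_ring_cases: "valuation_ring R \<Longrightarrow> x \<in> R \<or> inverse x \<in> R"
  by (cases "x = 0") (auto simp: valuation_ring_def)

text \<open>Chevalley's extension theorem; \<open>J \<subseteq> vmax R\<close> says that \<open>R\<close> dominates \<open>(B, J B)\<close>.\<close>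
theorem valuation_ring_existence:
  fixes B :: "'f::field set"
  assumes B: "is_subring B" "J \<subseteq> B" "1 \<notin> gen_ideal J B"
  shows "\<exists>R. valuation_ring R \<and> B \<subseteq> R \<and> J \<subseteq> vmax R"
proof -
  define \<A> where "\<A> = {C. is_subring C \<and> B \<subseteq> C \<and> 1 \<notin> gen_ideal J C}"
  have "\<Union>C \<in> \<A>" if ne: "C \<noteq> {}" and ch: "subset.chain \<A> C" for C
  proof -
    have c: "\<And>X Y. X \<in> C \<Longrightarrow> Y \<in> C \<Longrightarrow> X \<subseteq> Y \<or> Y \<subseteq> X" and sub: "C \<subseteq> \<A>"
      using ch unfolding subset.chain_def by auto
    have S: "\<And>X. X \<in> C \<Longrightarrow> is_subring X" using sub by (auto simp: \<A>_def)
    obtain X0 where X0: "X0 \<in> C" using ne by blast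
    have "x + y \<in> \<Union>C \<and> x * y \<in> \<Union>C" if xy: "x \<in> \<Union>C" "y \<in> \<Union>C" for x y
    proof -
      obtain X where "X \<in> C" "x \<in> X" "y \<in> X" using xy c by blast
      then show ?thesis using S by (blast intro: is_subring_intros)
    qed
    moreover have "0 \<in> \<Union>C" "1 \<in> \<Union>C" "\<forall>x\<in>\<Union>C. - x \<in> \<Union>C"
      using X0 S by (blast intro: is_subring_intros)+
    ultimately have "is_subring (\<Union>C)" unfolding is_subring_def by blast
    moreover have "1 \<notin> gen_ideal J (\<Union>C)"
      using gen_ideal_Union_chain[OF _ ne c] sub by (auto simp: \<A>_def)
    moreover have "B \<subseteq> \<Union>C" using X0 sub by (auto simp: \<A>_def)
    ultimately show ?thesis by (auto simp: \<A>_def)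
  qed
  moreover have "\<A> \<noteq> {}" using B by (auto simp: \<A>_def)
  ultimately obtain R where "R \<in> \<A>" and max: "\<And>X. X \<in> \<A> \<Longrightarrow> R \<subseteq> X \<Longrightarrow> X = R"
    using subset_Zorn_nonempty[of \<A>] by metis
  then have R: "is_subring R" "B \<subseteq> R" "1 \<notin> gen_ideal J R" by (auto simp: \<A>_def)
  \<comment> \<open>If \<open>z\<close> is outside the maximal ring \<open>R\<close>, then
    \<open>J\<close> generates the unit ideal of \<open>adjoin R z\<close>. By
    \<open>gen_ideal_no_inverse_pair\<close> this cannot happen for both \<open>z\<close> and
    \<open>inverse z\<close>.\<close>
  have adj: "z \<in> R \<or> (\<exists>p. (\<forall>i. coeff p i \<in> gen_ideal J R) \<and> poly p z = 1)" for z
  proof (cases "1 \<in> gen_ideal J (adjoin R z)")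
    case True
    then show ?thesis using gen_ideal_adjoin[OF R(1)] by metis
  next
    case False
    then have "adjoin R z \<in> \<A>"
      using R adjoin_base[OF R(1)] is_subring_adjoin[OF R(1)] by (auto simp: \<A>_def)
    then show ?thesis using max adjoin_base[OF R(1)] adjoin_gen[OF R(1)] by blast
  qed
  have "z \<in> R \<or> inverse z \<in> R" if "z \<noteq> 0" for z
    using adj[of z] adj[of "inverse z"] gen_ideal_no_inverse_pair[OF R(1,3) _ that] B R by blast
  then have "valuation_ring R" using R(1) by (auto simp: valuation_ring_def is_subring_def)
  moreover have "J \<subseteq> vmax R"
  proof
    fix j assume j: "j \<in> J"
    have "inverse j * j \<in> gen_ideal J R" if "inverse j \<in> R"
      using gen_ideal_mult[OF gen_ideal_gen[OF R(1) j] R(1) that] .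
    then show "j \<in> vmax R" using R by (auto simp: vmax_def)
  qed
  ultimately show ?thesis using R by blast
qed

lemma valuation_ring_integrally_closed:
  fixes R :: "'f::field set"
  assumes R: "valuation_ring R" and p: "p \<in> polys_over R" "lead_coeff p = 1" "poly p z = 0"
  shows "z \<in> R"
proof (rule ccontr)
  assume z: "z \<notin> R"
  note S = valuation_ring_is_subring[OF R]
  have w: "inverse z \<in> R" "z \<noteq> 0" using valuation_ring_cases[OF R] z S is_subring_0 by blast+
  let ?n = "degree p"
  have "?n \<noteq> 0" using p by (metis degree_eq_zeroE lead_coeff_pCons(2) poly_1 one_pCons zero_neq_one)
  then obtain m where m: "?n = Suc m" by (cases ?n) auto
  have "0 = inverse z ^ m * poly p z" using p by simp
  also have "\<dots> = inverse z ^ m * (\<Sum>i\<le>m. coeff p i * z ^ i) + z"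
    using p(2) w(2) by (simp add: poly_altdef m algebra_simps power_inverse)
  also have "inverse z ^ m * (\<Sum>i\<le>m. coeff p i * z ^ i) = (\<Sum>i\<le>m. coeff p i * inverse z ^ (m - i))"
    unfolding sum_distrib_left using w(2)
    by (intro sum.cong) (auto simp: power_diff field_simps)
  finally have "z = - (\<Sum>i\<le>m. coeff p i * inverse z ^ (m - i))" by (simp add: eq_neg_iff_add_eq_0 add.commute)
  also have "\<dots> \<in> R" using S w p(1) by (intro is_subring_intros) (auto intro: polys_overD)
  finally show False using z by simp
qed

text \<open>Domination of \<open>J\<close> is harmless here because \<open>J\<close> lies in the Jacobson radical of \<open>B\<close>.\<close>
lemma integral_if_in_all_valuation_rings:
  fixes B :: "'f::field set"
  assumes B: "is_subring B" "J \<subseteq> B" "\<And>x. x \<in> gen_ideal J B \<Longrightarrow> x \<noteq> 1 \<and> inverse (1 - x) \<in> B"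
    and f: "\<And>R. valuation_ring R \<Longrightarrow> B \<subseteq> R \<Longrightarrow> J \<subseteq> vmax R \<Longrightarrow> f \<in> R"
  shows "\<exists>p\<in>polys_over B. lead_coeff p = 1 \<and> poly p f = 0"
proof (cases "f = 0")
  case True
  then show ?thesis using B(1)
    by (intro bexI[of _ "[:0, 1:]"])
      (auto simp: polys_over_pCons is_subring_intros is_subring_0[OF is_subring_polys_over])
next
  case False
  define w where "w = inverse f"
  let ?B = "adjoin B w"
  have SB: "is_subring ?B" using is_subring_adjoin B by blast
  \<comment> \<open>Otherwise some valuation ring would dominate \<open>J\<close> and have
    \<open>w = inverse f\<close> in its maximal ideal, although by assumption it contains
    \<open>f\<close>.\<close>
  have "1 \<in> gen_ideal (insert w J) ?B"
  proof (rule ccontr)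
    assume "1 \<notin> gen_ideal (insert w J) ?B"
    moreover have "insert w J \<subseteq> ?B" using B adjoin_base adjoin_gen by blast
    ultimately obtain R where "valuation_ring R" "?B \<subseteq> R" "insert w J \<subseteq> vmax R"
      using valuation_ring_existence[OF SB] by blast
    then show False using f[of R] adjoin_base[OF B(1), of w] False
      by (auto simp: vmax_def w_def)
  qed
  \<comment> \<open>A summand with the generator \<open>w\<close> contributes nothing to the
    constant term, so the constant term stays in the ideal generated by \<open>J\<close> in
    \<open>B\<close>.\<close>
  moreover have "\<exists>p. coeff p 0 \<in> gen_ideal J B \<and> p \<in> polys_over B \<and> x = poly p w"
    if "x \<in> gen_ideal (insert w J) ?B" for x
    using that
  proof induction
    case zero
    show ?case by (intro exI[of _ 0])
        (auto simp: gen_ideal.zero is_subring_0[OF is_subring_polys_over] B)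
  next
    case (step j b x)
    then obtain p q where p: "coeff p 0 \<in> gen_ideal J B" "p \<in> polys_over B" "x = poly p w"
      and q: "q \<in> polys_over B" "b = poly q w" by (auto simp: adjoin_def)
    show ?case
    proof (cases "j \<in> J")
      case True
      have "coeff q 0 * j \<in> gen_ideal J B"
        using gen_ideal_mult[OF gen_ideal_gen[OF B(1) True] B(1)] polys_overD[OF q(1)] .
      moreover have "j \<in> B" using True B by blast
      ultimately show ?thesis using p q B
        by (intro exI[of _ "smult j q + p"])
          (auto intro!: gen_ideal_add is_subring_add[OF is_subring_polys_over] polys_over_smult simp: mult.commute)
    next
      case False
      then have "j = w" using step by simp
      then show ?thesis using p q B
        by (intro exI[of _ "pCons 0 q + p"])
          (auto intro!: is_subring_add[OF is_subring_polys_over] simp: polys_over_pCons is_subring_0)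
    qed
  qed
  ultimately obtain p where p: "coeff p 0 \<in> gen_ideal J B" "p \<in> polys_over B" "poly p w = 1" by metis
  \<comment> \<open>By the assumption on \<open>J\<close>, \<open>1 - coeff p 0\<close> is a unit of
    \<open>B\<close>. Multiplying \<open>1 - poly p w = 0\<close> by \<open>f ^ n\<close> gives an
    equation for \<open>f\<close> with this leading coefficient, and \<open>u\<close> makes it
    monic.\<close>
  define u where "u = inverse (1 - coeff p 0)"
  have u: "u \<in> B" "u * (1 - coeff p 0) = 1" using B(3)[OF p(1)] by (auto simp: u_def)
  define n where "n = degree p"
  define q where "q = smult u (monom 1 n - (\<Sum>i\<le>n. monom (coeff p i) (n - i)))"
  have q_coeff: "coeff q n = 1"
  proof -
    have "(\<Sum>i\<le>n. coeff (monom (coeff p i) (n - i)) n) = (\<Sum>i\<in>{0}. coeff p i)"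
      by (intro sum.mono_neutral_cong_right) auto
    then show ?thesis using u by (simp add: q_def coeff_sum)
  qed
  have "degree q \<le> n" unfolding q_def
    by (intro order.trans[OF degree_smult_le] degree_diff_le degree_sum_le)
      (auto intro: order.trans[OF degree_monom_le])
  then have "degree q = n" using q_coeff le_degree[of q n] by simp
  then have "lead_coeff q = 1" using q_coeff by simp
  moreover have "q \<in> polys_over B" unfolding q_def using p B u
    by (intro polys_over_smult is_subring_diff is_subring_polys_over polys_over_monom
        is_subring_sum[OF is_subring_polys_over]) (auto intro: polys_overD is_subring_1)
  moreover have "poly q f = 0"
  proof -
    have "(\<Sum>i\<le>n. coeff p i * f ^ (n - i)) = f ^ n * poly p w"
      unfolding poly_altdef n_def[symmetric] sum_distrib_left w_def using False
      by (intro sum.cong) (auto simp: power_diff field_simps)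
    then show ?thesis using p by (simp add: q_def poly_sum poly_monom)
  qed
  ultimately show ?thesis by blast
qed

section \<open>Extending valuation rings\<close>

locale type_ring_hom =
  fixes h :: "'a::comm_ring_1 \<Rightarrow> 'b::comm_ring_1"
  assumes hom_add: "h (x + y) = h x + h y"
    and hom_mult: "h (x * y) = h x * h y"
    and hom_1: "h 1 = 1"
begin

lemma hom_0: "h 0 = 0"
  using hom_add[of 0 0] by simp

lemma hom_uminus: "h (- x) = - h x"
  using hom_add[of x "- x"] by (simp add: hom_0 eq_neg_iff_add_eq_0 add.commute)

lemma hom_diff: "h (x - y) = h x - h y"
  using hom_add[of x "- y"] by (simp add: hom_uminus)

lemma hom_sum: "h (sum f I) = (\<Sum>i\<in>I. h (f i))"
  by (induction I rule: infinite_finite_induct) (auto simp: hom_0 hom_add)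

lemma hom_prod: "h (prod f I) = (\<Prod>i\<in>I. h (f i))"
  by (induction I rule: infinite_finite_induct) (auto simp: hom_1 hom_mult)

lemma hom_power: "h (x ^ n) = h x ^ n"
  by (induction n) (auto simp: hom_1 hom_mult)

lemmas hom_simps = hom_0 hom_1 hom_add hom_mult hom_uminus hom_diff hom_sum hom_prod hom_power

lemma coeff_map_poly_hom: "coeff (map_poly h p) i = h (coeff p i)"
  by (simp add: coeff_map_poly hom_0)

lemma map_poly_hom: "type_ring_hom (map_poly h)"
proof
  show "map_poly h (p + q) = map_poly h p + map_poly h q" for p q
    by (simp add: poly_eq_iff coeff_map_poly_hom hom_add)
  show "map_poly h (p * q) = map_poly h p * map_poly h q" for p q
    by (simp add: poly_eq_iff coeff_map_poly_hom coeff_mult hom_simps)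
  show "map_poly h 1 = 1"
    by (simp add: poly_eq_iff coeff_map_poly_hom hom_simps)
qed

lemma map_poly_hom_pCons: "map_poly h (pCons a p) = pCons (h a) (map_poly h p)"
  by (simp add: map_poly_pCons hom_0)

lemma poly_map_poly_hom: "poly (map_poly h p) (h x) = h (poly p x)"
  by (induction p) (auto simp: map_poly_hom_pCons hom_simps)

lemma type_ring_hom_poly: "type_ring_hom (\<lambda>p. poly (map_poly h p) z)"
proof -
  interpret P: type_ring_hom "map_poly h" by (rule map_poly_hom)
  show ?thesis by standard (auto simp: P.hom_simps)
qed

end

lemma type_ring_hom_comp: "type_ring_hom f \<Longrightarrow> type_ring_hom g \<Longrightarrow> type_ring_hom (\<lambda>x. g (f x))"
  by (auto simp: type_ring_hom_def)

locale field_embedding = type_ring_hom h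
  for h :: "'a::field \<Rightarrow> 'b::field"
begin

lemma hom_eq_0_iff [simp]: "h x = 0 \<longleftrightarrow> x = 0"
proof
  assume "h x = 0"
  then have "x \<noteq> 0 \<Longrightarrow> False" using hom_mult[of x "inverse x"] by (simp add: hom_1)
  then show "x = 0" by blast
qed (simp add: hom_0)

lemma hom_eq_iff: "h x = h y \<longleftrightarrow> x = y"
  using hom_eq_0_iff[of "x - y"] by (simp add: hom_diff)

lemma hom_inverse: "h (inverse x) = inverse (h x)"
proof (cases "x = 0")
  case False
  then have "h (inverse x) * h x = 1" by (simp add: hom_mult[symmetric] hom_1)
  then show ?thesis by (metis inverse_unique mult.commute)
qed (simp add: hom_0)

lemma hom_divide: "h (x / y) = h x / h y"
  by (simp add: divide_inverse hom_mult hom_inverse)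

lemma degree_map_poly_hom [simp]: "degree (map_poly h p) = degree p"
  by (simp add: degree_map_poly)

lemma map_poly_hom_eq_0_iff [simp]: "map_poly h p = 0 \<longleftrightarrow> p = 0"
  by (simp add: map_poly_eq_0_iff hom_0)

lemma valuation_ring_vimage: 
  assumes "valuation_ring R" shows "valuation_ring (h -` R)"
  using assms unfolding valuation_ring_def by (auto simp: hom_simps hom_inverse)

lemma vmax_vimage: "vmax (h -` R) = h -` vmax R"
  by (auto simp: vmax_def hom_inverse)

end

section \<open>The maximal ideal of a valuation ring and Gauss's lemma\<close>

context
  fixes R :: "'f::field set"
  assumes R: "valuation_ring R"
begin

private lemma subring_R: "is_subring R" using R by (rule valuation_ring_is_subring)

lemma vmax_subset: "vmax R \<subseteq> R"
  using valuation_ring_cases[OF R] subring_R by (auto simp: vmax_def intro: is_subring_0)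

lemma one_notin_vmax: "1 \<notin> vmax R"
  using subring_R by (auto simp: vmax_def intro: is_subring_1)

lemma vmax_mult: "x \<in> vmax R \<Longrightarrow> y \<in> R \<Longrightarrow> x * y \<in> vmax R"
proof -
  assume x: "x \<in> vmax R" and y: "y \<in> R"
  have "inverse x \<in> R" if "x \<noteq> 0" "y \<noteq> 0" "inverse (x * y) \<in> R"
    using is_subring_mult[OF subring_R that(3) y] that by (simp add: mult.assoc)
  then show ?thesis using x by (auto simp: vmax_def)
qed

lemma vmax_prime: "x * y \<in> vmax R \<Longrightarrow> x \<in> R \<Longrightarrow> y \<in> R \<Longrightarrow> x \<in> vmax R \<or> y \<in> vmax R"
  using is_subring_mult[OF subring_R, of "inverse x" "inverse y"] by (auto simp: vmax_def)

lemma vmax_add: "x \<in> vmax R \<Longrightarrow> y \<in> vmax R \<Longrightarrow> x + y \<in> vmax R"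
proof -
  have *: "x + y \<in> vmax R" if x: "x \<in> vmax R" and y: "y \<in> vmax R" "y \<noteq> 0" "x / y \<in> R" for x y :: 'f
  proof -
    have "y * (1 + x / y) \<in> vmax R" using vmax_mult[OF y(1)] subring_R y(3) by (blast intro: is_subring_intros)
    moreover have "y * (1 + x / y) = x + y" using y(2) by (simp add: field_simps)
    ultimately show ?thesis by simp
  qed
  assume xy: "x \<in> vmax R" "y \<in> vmax R"
  show ?thesis
  proof (cases "x = 0 \<or> y = 0")
    case False
    then show ?thesis using *[of x y] *[of y x] xy valuation_ring_cases[OF R, of "x / y"]
      by (auto simp: add.commute)
  qed (use xy in auto)
qed

lemma vmax_0: "0 \<in> vmax R" by (simp add: vmax_def)

lemma vmax_sum: "(\<And>i. i \<in> I \<Longrightarrow> f i \<in> vmax R) \<Longrightarrow> sum f I \<in> vmax R"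
  by (induction I rule: infinite_finite_induct) (auto intro: vmax_0 vmax_add)

lemma gen_ideal_vmax: "gen_ideal (vmax R) R \<subseteq> vmax R"
proof
  fix x assume "x \<in> gen_ideal (vmax R) R"
  then show "x \<in> vmax R" by induction (auto intro: vmax_0 vmax_add vmax_mult)
qed

lemma inverse_one_minus_vmax: "x \<in> vmax R \<Longrightarrow> x \<noteq> 1 \<and> inverse (1 - x) \<in> R"
proof -
  assume x: "x \<in> vmax R"
  have "1 - x \<notin> vmax R" using vmax_add[of "1 - x" x] x one_notin_vmax by auto
  then show ?thesis using x one_notin_vmax by (auto simp: vmax_def)
qed

text \<open>Any two nonzero elements are comparable under divisibility in \<open>R\<close>, so a
  finite set has a member that divides all the others.\<close>

lemma valuation_ring_least_value:
  assumes "finite X" "X \<noteq> {}" "0 \<notin> X"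
  shows "\<exists>c\<in>X. \<forall>x\<in>X. x / c \<in> R"
  using assms
proof (induction X rule: finite_ne_induct)
  case (singleton x)
  then show ?case using subring_R by (auto intro: is_subring_1)
next
  case (insert x X)
  then obtain c where c: "c \<in> X" "\<And>y. y \<in> X \<Longrightarrow> y / c \<in> R" by auto
  have nz: "x \<noteq> 0" "c \<noteq> 0" using insert.prems c by auto
  show ?case
  proof (cases "x / c \<in> R")
    case True
    then show ?thesis using c by auto
  next
    case False
    then have cx: "c / x \<in> R" using valuation_ring_cases[OF R, of "x / c"] by simp
    have "y / x \<in> R" if "y \<in> X" for y
      using is_subring_mult[OF subring_R c(2)[OF that] cx] nz by simp
    then show ?thesis using nz subring_R by (auto intro: is_subring_1)
  qed
qed

text \<open>A coefficient of least value serves as the content \<open>c\<close>: after scaling,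
  coefficient \<open>i\<close> is 1 and hence outside the maximal ideal.\<close>

lemma poly_primitive_scaling:
  assumes "p \<noteq> 0"
  shows "\<exists>c i. c \<noteq> 0 \<and> smult (inverse c) p \<in> polys_over R \<and> coeff p i = c"
proof -
  have "finite (set (coeffs p) - {0})" "lead_coeff p \<in> set (coeffs p) - {0}"
    using assms by (auto simp: coeff_in_coeffs)
  then obtain c where c: "c \<in> set (coeffs p)" "c \<noteq> 0" "\<forall>x\<in>set (coeffs p) - {0}. x / c \<in> R"
    using valuation_ring_least_value[of "set (coeffs p) - {0}"] by auto
  then obtain i where "coeff p i = c" by (auto simp: coeffs_def split: if_splits)
  moreover have "inverse c * coeff p j \<in> R" for j
  proof (cases "coeff p j = 0")
    case False
    then have "coeff p j \<in> set (coeffs p) - {0}" using assms by (auto simp: le_degree intro: coeff_in_coeffs)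
    then show ?thesis using c(3) by (metis divide_inverse mult.commute)
  qed (use subring_R in \<open>auto intro: is_subring_0\<close>)
  ultimately show ?thesis using c by (auto simp: polys_over_def)
qed

text \<open>The lowest coefficients outside the maximal ideal, in degrees \<open>a\<close> and
  \<open>b\<close>, decide: in degree \<open>a + b\<close> every other summand has a factor in
  \<open>vmax R\<close>, and \<open>vmax R\<close> is prime.\<close>

lemma coeff_mult_notin_vmax:
  assumes p: "p \<in> polys_over R" "coeff p i \<notin> vmax R"
    and q: "q \<in> polys_over R" "coeff q j \<notin> vmax R"
  shows "\<exists>k. coeff (p * q) k \<notin> vmax R"
proof -
  define a where "a = (LEAST i. coeff p i \<notin> vmax R)"
  define b where "b = (LEAST j. coeff q j \<notin> vmax R)"
  have a: "coeff p a \<notin> vmax R" "\<And>i. i < a \<Longrightarrow> coeff p i \<in> vmax R"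
    unfolding a_def using p(2) LeastI[of "\<lambda>i. coeff p i \<notin> vmax R"] not_less_Least by blast+
  have b: "coeff q b \<notin> vmax R" "\<And>i. i < b \<Longrightarrow> coeff q i \<in> vmax R"
    unfolding b_def using q(2) LeastI[of "\<lambda>i. coeff q i \<notin> vmax R"] not_less_Least by blast+
  have split: "coeff (p * q) (a + b) =
      coeff p a * coeff q b + (\<Sum>i\<in>{..a + b} - {a}. coeff p i * coeff q (a + b - i))"
    unfolding coeff_mult by (subst sum.remove[of _ a]) auto
  have "coeff p i * coeff q (a + b - i) \<in> vmax R" if "i \<in> {..a + b} - {a}" for i
  proof (cases "i < a")
    case True
    then show ?thesis using a(2) q vmax_mult by (auto intro: polys_overD)
  next
    case False
    then have "coeff q (a + b - i) * coeff p i \<in> vmax R"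
      using vmax_mult[OF b(2)[of "a + b - i"] polys_overD[OF p(1), of i]] that by force
    then show ?thesis by (simp add: mult.commute)
  qed
  then have "(\<Sum>i\<in>{..a + b} - {a}. coeff p i * coeff q (a + b - i)) * (- 1) \<in> vmax R"
    by (rule vmax_mult[OF vmax_sum is_subring_uminus[OF subring_R is_subring_1[OF subring_R]]])
  then have m: "- (\<Sum>i\<in>{..a + b} - {a}. coeff p i * coeff q (a + b - i)) \<in> vmax R" by simp
  have "coeff p a * coeff q b \<notin> vmax R"
    using vmax_prime a(1) b(1) p q by (blast dest: polys_overD)
  then have "coeff (p * q) (a + b) \<notin> vmax R"
    using vmax_add[OF _ m] unfolding split by fastforce
  then show ?thesis by blast
qed

text \<open>The contents satisfy \<open>c * d \<in> R\<close>, because the product of the scaled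
  factors has a coefficient outside the maximal ideal. As \<open>q\<close> is monic,
  \<open>inverse d\<close> is in \<open>R\<close>, and so is
  \<open>c = (c * d) * inverse d\<close>.\<close>

lemma valuation_ring_gauss:
  assumes pq: "p * q \<in> polys_over R" and lead: "lead_coeff p = 1" "lead_coeff q = 1"
  shows "p \<in> polys_over R"
proof -
  from lead have nz: "p \<noteq> 0" "q \<noteq> 0" by auto
  obtain c i where c: "c \<noteq> 0" "smult (inverse c) p \<in> polys_over R" "coeff p i = c"
    using poly_primitive_scaling[OF nz(1)] by blast
  obtain d j where d: "d \<noteq> 0" "smult (inverse d) q \<in> polys_over R" "coeff q j = d"
    using poly_primitive_scaling[OF nz(2)] by blast
  have "inverse d * lead_coeff q \<in> R" using polys_overD[OF d(2), of "degree q"] by simp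
  then have dR: "inverse d \<in> R" using lead by simp
  obtain k where k: "coeff (smult (inverse c) p * smult (inverse d) q) k \<notin> vmax R"
    using coeff_mult_notin_vmax[OF c(2) _ d(2), of i j] c d one_notin_vmax by auto
  have "c * d \<in> R"
  proof (rule ccontr)
    assume "c * d \<notin> R"
    then have "inverse (c * d) \<in> vmax R" by (auto simp: vmax_def)
    from vmax_mult[OF this polys_overD[OF pq, of k]] k show False
      by (simp add: mult_ac)
  qed
  from is_subring_mult[OF subring_R this dR] have "c \<in> R" using d(1) by (simp add: mult.assoc)
  from polys_over_smult[OF subring_R this c(2)] show ?thesis using c by simp
qed

end

section \<open>Extension of valuation rings along a field embedding, minimal polynomials\<close>

context field_embedding
begin

text \<open>Domination keeps the contraction from growing: for \<open>x\<close> outside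
  \<open>R\<close>, the element \<open>h (inverse x)\<close> is a nonunit of \<open>R'\<close>, so
  \<open>h x\<close> is not in \<open>R'\<close>.\<close>

lemma valuation_ring_extension:
  assumes R: "valuation_ring R" and B: "is_subring B" "h ` R \<subseteq> B" "J \<subseteq> B"
    "h ` vmax R \<subseteq> J" "1 \<notin> gen_ideal J B"
  shows "\<exists>R'. valuation_ring R' \<and> h -` R' = R \<and> B \<subseteq> R' \<and> J \<subseteq> vmax R'"
proof -
  obtain R' where R': "valuation_ring R'" "B \<subseteq> R'" "J \<subseteq> vmax R'"
    using valuation_ring_existence[OF B(1,3,5)] by blast
  have "x \<in> R" if "h x \<in> R'" for x
  proof (rule ccontr)
    assume "x \<notin> R"
    then have "inverse x \<in> vmax R" by (auto simp: vmax_def)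
    then have "h (inverse x) \<in> vmax R'" using B R' by blast
    moreover have "x \<noteq> 0" using \<open>x \<notin> R\<close> R by (auto simp: valuation_ring_def)
    ultimately show False using that by (auto simp: vmax_def hom_inverse)
  qed
  then have "h -` R' = R" using B(2) R'(2) by blast
  then show ?thesis using R' by blast
qed

lemma is_subring_image: "is_subring R \<Longrightarrow> is_subring (h ` R)"
  unfolding is_subring_def
proof (safe)
  assume "0 \<in> R" "1 \<in> R"
  then show "0 \<in> h ` R" "1 \<in> h ` R" using hom_0 hom_1 by (metis image_eqI)+
qed (simp_all flip: hom_add hom_mult hom_uminus)

lemma gen_ideal_image: "gen_ideal (h ` J) (h ` B) = h ` gen_ideal J B"
proof (intro equalityI subsetI)
  fix x assume "x \<in> gen_ideal (h ` J) (h ` B)"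
  then show "x \<in> h ` gen_ideal J B"
  proof induction
    case zero
    show ?case by (rule image_eqI[of _ _ 0]) (auto simp: hom_0 gen_ideal.zero)
  next
    case (step j b x)
    then obtain j' b' x' where "j' \<in> J" "b' \<in> B" "x' \<in> gen_ideal J B" "j = h j'" "b = h b'" "x = h x'" by blast
    then show ?case by (intro image_eqI[of _ _ "j' * b' + x'"]) (auto simp: hom_simps intro: gen_ideal.step)
  qed
next
  fix x assume "x \<in> h ` gen_ideal J B"
  then obtain y where "x = h y" "y \<in> gen_ideal J B" by blast
  from this(2) show "x \<in> gen_ideal (h ` J) (h ` B)" unfolding \<open>x = h y\<close>
    by induction (auto simp: hom_simps intro: gen_ideal.intros)
qed

lemma gen_ideal_vmax_image:
  assumes R: "valuation_ring R" "x \<in> gen_ideal (h ` vmax R) (h ` R)"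
  shows "x \<noteq> 1 \<and> inverse (1 - x) \<in> h ` R"
proof -
  obtain y where y: "x = h y" "y \<in> vmax R"
    using R gen_ideal_vmax[OF R(1)] unfolding gen_ideal_image by blast
  have "1 - x = h (1 - y)" by (simp add: y hom_simps)
  then show ?thesis using inverse_one_minus_vmax[OF R(1) y(2)]
    by (auto simp: y hom_inverse[symmetric] hom_eq_iff[of _ 1, unfolded hom_1])
qed

lemma valuation_ring_extension_exists:
  assumes R: "valuation_ring R"
  shows "\<exists>R'. valuation_ring R' \<and> h -` R' = R"
proof -
  have "1 \<notin> gen_ideal (h ` vmax R) (h ` R)" using gen_ideal_vmax_image[OF R] by blast
  then show ?thesis
    using valuation_ring_extension[OF R is_subring_image[OF valuation_ring_is_subring[OF R]], of "h ` vmax R"]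
      vmax_subset[OF R] by blast
qed

text \<open>\<open>R\<close> is local, so the image of its maximal ideal lies in the Jacobson
  radical of the image of \<open>R\<close>, and a valuation ring dominating this image contracts to
  \<open>R\<close>. Hence \<open>integral_if_in_all_valuation_rings\<close> applies, and its
  equation is pulled back along \<open>h\<close>.\<close>

lemma integral_if_in_all_extensions:
  assumes R: "valuation_ring R"
    and f: "\<And>R'. valuation_ring R' \<Longrightarrow> h -` R' = R \<Longrightarrow> f \<in> R'"
  shows "\<exists>p\<in>polys_over R. lead_coeff p = 1 \<and> poly (map_poly h p) f = 0"
proof -
  note S = is_subring_image[OF valuation_ring_is_subring[OF R]]
  have fR: "f \<in> R'" if "valuation_ring R'" "h ` R \<subseteq> R'" "h ` vmax R \<subseteq> vmax R'" for R'
  proof (rule f[OF that(1)])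
    show "h -` R' = R"
    proof (intro equalityI subsetI)
      fix x assume x: "x \<in> h -` R'"
      show "x \<in> R"
      proof (rule ccontr)
        assume n: "x \<notin> R"
        then have "inverse x \<in> vmax R" by (simp add: vmax_def)
        then have "h (inverse x) \<in> vmax R'" using that(3) by blast
        moreover have "x \<noteq> 0" using n R by (auto simp: valuation_ring_def)
        ultimately show False using x by (simp add: vmax_def hom_inverse)
      qed
    qed (use that in auto)
  qed
  have "h ` vmax R \<subseteq> h ` R" using vmax_subset[OF R] by blast
  from integral_if_in_all_valuation_rings[OF S this gen_ideal_vmax_image[OF R] fR]
  obtain q where q: "q \<in> polys_over (h ` R)" "lead_coeff q = 1" "poly q f = 0" by blast
  \<comment> \<open>A section of \<open>h\<close> on the coefficients. The values at 0 and 1 are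
    fixed because \<open>map_poly\<close> relies on \<open>g 0 = 0\<close> and the leading
    coefficient has to remain 1.\<close>
  define g where "g y = (if y = 0 then 0 else if y = 1 then 1 else SOME x. x \<in> R \<and> h x = y)" for y
  have g: "g y \<in> R \<and> h (g y) = y" if "y \<in> h ` R" for y
    using that someI_ex[of "\<lambda>x. x \<in> R \<and> h x = y"] R
    by (auto simp: g_def hom_0 hom_1 valuation_ring_def)
  define p where "p = map_poly g q"
  have cp: "coeff p i = g (coeff q i)" for i by (simp add: p_def coeff_map_poly g_def)
  have q_eq: "q = map_poly h p"
    by (simp add: poly_eq_iff coeff_map_poly_hom cp g polys_overD[OF q(1)])
  have "p \<in> polys_over R" using g polys_overD[OF q(1)] by (simp add: polys_over_def cp)
  moreover have "lead_coeff p = 1"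
  proof -
    have "degree p = degree q" using q_eq by simp
    then show ?thesis using q(2) by (simp add: cp g_def)
  qed
  ultimately show ?thesis using q q_eq by blast
qed

definition min_poly_of :: "'a poly \<Rightarrow> 'b \<Rightarrow> bool" where
  "min_poly_of p f \<longleftrightarrow> lead_coeff p = 1 \<and> poly (map_poly h p) f = 0 \<and>
     (\<forall>q. q \<noteq> 0 \<and> poly (map_poly h q) f = 0 \<longrightarrow> degree p \<le> degree q)"

lemma min_poly_of_exists:
  assumes "q \<noteq> 0" "poly (map_poly h q) f = 0"
  shows "\<exists>p. min_poly_of p f"
proof -
  interpret P: type_ring_hom "\<lambda>p. poly (map_poly h p) f" by (rule type_ring_hom_poly)
  define Q where "Q p \<longleftrightarrow> p \<noteq> 0 \<and> poly (map_poly h p) f = 0" for p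
  have "Q q" using assms by (simp add: Q_def)
  from ex_has_least_nat[of Q, OF this, of degree] obtain p where
    p: "Q p" "\<forall>q. Q q \<longrightarrow> degree p \<le> degree q" by blast
  have "poly (map_poly h (smult (inverse (lead_coeff p)) p)) f = 0"
    using P.hom_mult[of "[:inverse (lead_coeff p):]" p] p(1) by (simp add: Q_def)
  then show ?thesis using p unfolding Q_def
    by (intro exI[of _ "smult (inverse (lead_coeff p)) p"]) (auto simp: min_poly_of_def)
qed

lemma min_poly_of_dvd:
  assumes "min_poly_of p f" "poly (map_poly h q) f = 0"
  shows "p dvd q"
proof -
  interpret P: type_ring_hom "\<lambda>p. poly (map_poly h p) f" by (rule type_ring_hom_poly)
  have "p \<noteq> 0" using assms by (auto simp: min_poly_of_def)
  have "poly (map_poly h (q mod p)) f = 0"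
    using assms by (simp add: P.hom_simps min_poly_of_def flip: minus_div_mult_eq_mod)
  then have "q mod p = 0"
    using assms degree_mod_less[OF \<open>p \<noteq> 0\<close>, of q] unfolding min_poly_of_def
    by (metis leD)
  then show ?thesis by auto
qed

text \<open>Being in all extensions, \<open>f\<close> satisfies a monic equation over
  \<open>R\<close>. The minimal polynomial divides it and by Gauss's lemma has its coefficients in
  \<open>R\<close>. Its constant coefficient is a multiple of \<open>f\<close> in \<open>R'\<close>,
  so it inherits a zero of \<open>f\<close>.\<close>

lemma min_poly_of_const:
  assumes p: "min_poly_of p f" and f: "f \<noteq> 0" and R: "valuation_ring R"
    and int: "\<And>R'. valuation_ring R' \<Longrightarrow> h -` R' = R \<Longrightarrow> f \<in> R'"
  shows "coeff p 0 \<in> R"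
    and "valuation_ring R' \<Longrightarrow> h -` R' = R \<Longrightarrow> f \<in> vmax R' \<Longrightarrow> coeff p 0 \<in> vmax R"
proof -
  obtain q where q: "q \<in> polys_over R" "lead_coeff q = 1" "poly (map_poly h q) f = 0"
    using integral_if_in_all_extensions[OF R int] by blast
  then obtain r where r: "q = p * r" using min_poly_of_dvd[OF p] by (auto elim: dvdE)
  then have "lead_coeff r = 1" using q(2) p by (simp add: lead_coeff_mult min_poly_of_def)
  then have pR: "p \<in> polys_over R"
    using valuation_ring_gauss[OF R, of p r] q r p by (auto simp: min_poly_of_def)
  then show "coeff p 0 \<in> R" by (auto intro: polys_overD)
  assume R': "valuation_ring R'" "h -` R' = R" "f \<in> vmax R'"
  obtain a s where as: "p = pCons a s" by (cases p)
  have "s \<in> polys_over R" using pR polys_over_pCons valuation_ring_is_subring[OF R] as by blast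
  then have "map_poly h s \<in> polys_over R'"
    using R'(2) by (auto simp: polys_over_def coeff_map_poly_hom)
  moreover note S' = valuation_ring_is_subring[OF R'(1)]
  ultimately have "f * - poly (map_poly h s) f \<in> vmax R'"
    using vmax_mult[OF R'(1,3)] 
      is_subring_uminus[OF S' poly_polys_over[OF S' _ subsetD[OF vmax_subset[OF R'(1)] R'(3)]]] by blast
  moreover have "h a + f * poly (map_poly h s) f = 0"
    using p as by (simp add: min_poly_of_def map_poly_hom_pCons)
  then have "h a = f * - poly (map_poly h s) f" by (simp add: eq_neg_iff_add_eq_0)
  ultimately have "a \<in> h -` vmax R'" by simp
  then show "coeff p 0 \<in> vmax R" using as R'(2) vmax_vimage by auto
qed

lemma map_poly_reflect: "map_poly h (reflect_poly p) = reflect_poly (map_poly h p)"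
  by (simp add: poly_eq_iff coeff_map_poly_hom coeff_reflect_poly hom_0)

text \<open>The reversed polynomial annihilates \<open>inverse f\<close>, and reversal does not
  raise degrees. After normalization the constant coefficient is \<open>inverse (coeff p 0)\<close>,
  so statements about the zeros of the norm-like element carry over to its poles.\<close>

lemma min_poly_of_inverse:
  assumes p: "min_poly_of p f" and f: "f \<noteq> 0"
  shows "coeff p 0 \<noteq> 0" 
    and "min_poly_of (smult (inverse (coeff p 0)) (reflect_poly p)) (inverse f)"
proof -
  show nz: "coeff p 0 \<noteq> 0"
  proof
    assume "coeff p 0 = 0"
    then obtain s where s: "p = pCons 0 s" by (cases p) auto
    have "s \<noteq> 0" using s p by (auto simp: min_poly_of_def)
    moreover have "poly (map_poly h s) f = 0"
      using s p f unfolding min_poly_of_def by (simp only: map_poly_hom_pCons) (simp add: hom_0)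
    ultimately show False using p s by (auto simp: min_poly_of_def)
  qed
  show "min_poly_of (smult (inverse (coeff p 0)) (reflect_poly p)) (inverse f)"
    unfolding min_poly_of_def
  proof (intro conjI allI impI)
    have d: "degree (reflect_poly p) = degree p" using nz by simp
    show "lead_coeff (smult (inverse (coeff p 0)) (reflect_poly p)) = 1"
      using nz by (simp add: coeff_reflect_poly)
    have "poly (map_poly h (reflect_poly p)) (inverse f) = 0"
      using p f by (simp add: map_poly_reflect poly_reflect_poly_nz min_poly_of_def)
    then show "poly (map_poly h (smult (inverse (coeff p 0)) (reflect_poly p))) (inverse f) = 0"
      by (simp add: poly_altdef coeff_map_poly_hom hom_simps nz degree_map_poly_hom sum_distrib_left[symmetric] mult.assoc)
    fix q assume q: "q \<noteq> 0 \<and> poly (map_poly h q) (inverse f) = 0"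
    then have "poly (map_poly h (reflect_poly q)) f = 0"
      using f poly_reflect_poly_nz[of f "map_poly h q"] by (simp add: map_poly_reflect)
    then have "degree p \<le> degree (reflect_poly q)" using p q by (auto simp: min_poly_of_def)
    also have "\<dots> \<le> degree q" by (rule degree_reflect_poly_le)
    finally show "degree (smult (inverse (coeff p 0)) (reflect_poly p)) \<le> degree q" using nz by simp
  qed
qed

text \<open>The constant coefficient of the minimal polynomial plays the role of the norm.\<close>
theorem norm_like_element:
  assumes q: "q \<noteq> 0" "poly (map_poly h q) f = 0" and f: "f \<noteq> 0"
  obtains u where "u \<noteq> 0"
    "\<And>R. valuation_ring R \<Longrightarrow> (\<And>R'. valuation_ring R' \<Longrightarrow> h -` R' = R \<Longrightarrow> f \<in> R') \<Longrightarrow> u \<in> R"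
    "\<And>R'. (\<And>R''. valuation_ring R'' \<Longrightarrow> h -` R'' = h -` R' \<Longrightarrow> f \<in> R'') \<Longrightarrow>
       valuation_ring R' \<Longrightarrow> f \<in> vmax R' \<Longrightarrow> u \<in> vmax (h -` R')"
    "\<And>R. valuation_ring R \<Longrightarrow> (\<And>R'. valuation_ring R' \<Longrightarrow> h -` R' = R \<Longrightarrow> inverse f \<in> R') \<Longrightarrow> inverse u \<in> R"
    "\<And>R'. (\<And>R''. valuation_ring R'' \<Longrightarrow> h -` R'' = h -` R' \<Longrightarrow> inverse f \<in> R'') \<Longrightarrow>
       valuation_ring R' \<Longrightarrow> inverse f \<in> vmax R' \<Longrightarrow> inverse u \<in> vmax (h -` R')"
proof -
  obtain p where p: "min_poly_of p f" using min_poly_of_exists[OF q] by blast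
  note pi = min_poly_of_inverse[OF p f]
  have lead: "lead_coeff p = 1" using p by (simp add: min_poly_of_def)
  show ?thesis
  proof (rule that[OF pi(1)])
    have c: "coeff (smult (inverse (coeff p 0)) (reflect_poly p)) 0 = inverse (coeff p 0)"
      using lead by (simp add: coeff_0_reflect_poly)
    note 1 = min_poly_of_const[OF p f] and 2 = min_poly_of_const[OF pi(2), unfolded c]
    have fi: "inverse f \<noteq> 0" using f by simp
    show "coeff p 0 \<in> R" if "valuation_ring R" "\<And>R'. valuation_ring R' \<Longrightarrow> h -` R' = R \<Longrightarrow> f \<in> R'" for R
      by (rule 1(1)[OF that])
    show "inverse (coeff p 0) \<in> R"
      if "valuation_ring R" "\<And>R'. valuation_ring R' \<Longrightarrow> h -` R' = R \<Longrightarrow> inverse f \<in> R'" for R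
      by (rule 2(1)[OF fi that])
    show "coeff p 0 \<in> vmax (h -` R')"
      if "\<And>R''. valuation_ring R'' \<Longrightarrow> h -` R'' = h -` R' \<Longrightarrow> f \<in> R''" 
        "valuation_ring R'" "f \<in> vmax R'" for R'
      by (rule 1(2)[OF valuation_ring_vimage[OF that(2)] that(1) that(2) refl that(3)])
    show "inverse (coeff p 0) \<in> vmax (h -` R')"
      if "\<And>R''. valuation_ring R'' \<Longrightarrow> h -` R'' = h -` R' \<Longrightarrow> inverse f \<in> R''" 
        "valuation_ring R'" "inverse f \<in> vmax R'" for R'
      by (rule 2(2)[OF fi valuation_ring_vimage[OF that(2)] that(1) that(2) refl that(3)])
  qed
qed

end

section \<open>Places of a rational function field\<close>

definition fconst :: "'c::field \<Rightarrow> 'c poly fract" where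
  "fconst c = to_fract [:c:]"

interpretation fconst: field_embedding fconst
proof
  have "fconst 1 = to_fract (1 :: 'a poly)" by (simp only: fconst_def one_pCons)
  then show "fconst 1 = (1 :: 'a poly fract)" by simp
qed (simp_all add: fconst_def flip: to_fract_add to_fract_mult)

lemma to_fract_eq_poly: "to_fract p = poly (map_poly fconst p) (to_fract [:0, 1:])"
proof (induction p)
  case (pCons a p)
  have "pCons a p = [:a:] + [:0, 1:] * p" by simp
  then have "to_fract (pCons a p) = fconst a + to_fract [:0, 1:] * to_fract p"
    unfolding fconst_def by (simp only: to_fract_add to_fract_mult)
  then show ?case by (simp add: fconst.map_poly_hom_pCons pCons)
qed auto

lemma poly_root_factor:
  fixes p :: "'a::idom poly"
  assumes "poly p a = 0"
  shows "\<exists>q. p = [:-a, 1:] * q"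
  using assms by (simp only: poly_eq_0_iff_dvd dvd_def)

text \<open>Over algebraically closed constants \<open>p\<close> splits into linear factors, and one
  of the factors \<open>z - fconst a\<close> has to vanish.\<close>

lemma algebraic_over_constants:
  fixes z :: "'c::alg_closed_field poly fract"
  assumes "p \<noteq> 0" "poly (map_poly fconst p) z = 0"
  shows "z \<in> range fconst"
  using assms
proof (induction "degree p" arbitrary: p rule: less_induct)
  case less
  interpret P: type_ring_hom "\<lambda>p. poly (map_poly fconst p) z" by (rule fconst.type_ring_hom_poly)
  show ?case
  proof (cases "degree p = 0")
    case True
    then show ?thesis using less.prems by (auto elim!: degree_eq_zeroE simp: fconst.map_poly_hom_pCons)
  next
    case False
    then obtain a where "poly p a = 0" using alg_closed_imp_poly_has_root by blast
    then obtain q where q: "p = [:-a, 1:] * q" using poly_root_factor by blast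
    have "(z - fconst a) * poly (map_poly fconst q) z = 0"
      using P.hom_mult[of "[:-a, 1:]" q] less.prems
      by (simp add: q fconst.map_poly_hom_pCons fconst.hom_simps)
    moreover have "q \<noteq> 0" using q less.prems by auto
    moreover from this have "degree q < degree p" unfolding q by (subst degree_mult_eq) auto
    ultimately show ?thesis using less.hyps[of q] by auto
  qed
qed

text \<open>\<open>None\<close> is the point at infinity of the projective line.\<close>
definition place_ord_poly :: "'c option \<Rightarrow> 'c::field poly \<Rightarrow> int" where
  "place_ord_poly P p = (case P of None \<Rightarrow> - int (degree p) | Some a \<Rightarrow> int (order a p))"

lemma place_ord_poly_mult:
  "p \<noteq> 0 \<Longrightarrow> q \<noteq> 0 \<Longrightarrow> place_ord_poly P (p * q) = place_ord_poly P p + place_ord_poly P q"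
  by (auto simp: place_ord_poly_def degree_mult_eq order_mult split: option.splits)

lemma fract_cases_nonzero:
  fixes z :: "'a::idom fract"
  assumes "z \<noteq> 0"
  obtains p q where "p \<noteq> 0" "q \<noteq> 0" "z = to_fract p / to_fract q"
  using assms by (cases z) (auto simp: Fract_conv_to_fract)

text \<open>One construction for the points of the projective line and for the prime elements of
  \<open>A\<close>. At 0 no representation is admissible and the value is arbitrary, which is why
  the rings defined from it list 0 separately.\<close>

definition fract_ord :: "('a::idom \<Rightarrow> int) \<Rightarrow> 'a fract \<Rightarrow> int" where
  "fract_ord v z = (SOME n. \<exists>p q. p \<noteq> 0 \<and> q \<noteq> 0 \<and> z = to_fract p / to_fract q \<and> n = v p - v q)"

locale additive_order =
  fixes v :: "'a::idom \<Rightarrow> int"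
  assumes ord_mult: "p \<noteq> 0 \<Longrightarrow> q \<noteq> 0 \<Longrightarrow> v (p * q) = v p + v q"
begin

lemma fract_ord_fract:
  assumes "p \<noteq> 0" "q \<noteq> 0"
  shows "fract_ord v (to_fract p / to_fract q) = v p - v q"
  unfolding fract_ord_def
proof (rule some_equality)
  show "\<exists>p' q'. p' \<noteq> 0 \<and> q' \<noteq> 0 \<and> to_fract p / to_fract q = to_fract p' / to_fract q' \<and>
    v p - v q = v p' - v q'"
    using assms by blast
next
  fix n assume "\<exists>p' q'. p' \<noteq> 0 \<and> q' \<noteq> 0 \<and> to_fract p / to_fract q = to_fract p' / to_fract q' \<and>
    n = v p' - v q'"
  then obtain p' q' where *: "p' \<noteq> 0" "q' \<noteq> 0" "to_fract p / to_fract q = to_fract p' / to_fract q'"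
    "n = v p' - v q'" by blast
  have "to_fract (p * q') = to_fract (p' * q)" using * assms by (simp add: field_simps)
  then have "p * q' = p' * q" by (simp only: to_fract_eq_iff)
  then have "v p + v q' = v p' + v q" using * assms by (metis ord_mult)
  then show "n = v p - v q" using * by simp
qed

lemma fract_ord_mult:
  assumes "x \<noteq> 0" "y \<noteq> 0"
  shows "fract_ord v (x * y) = fract_ord v x + fract_ord v y"
proof -
  obtain p q where x: "p \<noteq> 0" "q \<noteq> 0" "x = to_fract p / to_fract q"
    using fract_cases_nonzero[OF assms(1)] .
  obtain r s where y: "r \<noteq> 0" "s \<noteq> 0" "y = to_fract r / to_fract s"
    using fract_cases_nonzero[OF assms(2)] .
  have "x * y = to_fract (p * r) / to_fract (q * s)" by (simp add: x y)
  moreover have "fract_ord v (to_fract (p * r) / to_fract (q * s)) = v (p * r) - v (q * s)"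
    using x y by (intro fract_ord_fract) auto
  ultimately show ?thesis using x y by (simp add: fract_ord_fract ord_mult)
qed

lemma fract_ord_1: "fract_ord v 1 = 0"
  using fract_ord_mult[of 1 1] by simp

lemma fract_ord_to_fract: "p \<noteq> 0 \<Longrightarrow> fract_ord v (to_fract p) = v p"
  using fract_ord_fract[of p 1] ord_mult[of 1 1] by simp

lemma fract_ord_inverse: "x \<noteq> 0 \<Longrightarrow> fract_ord v (inverse x) = - fract_ord v x"
  using fract_ord_mult[of x "inverse x"] by (simp add: fract_ord_1)

end

abbreviation place_ord :: "'c option \<Rightarrow> 'c::field poly fract \<Rightarrow> int" where
  "place_ord P \<equiv> fract_ord (place_ord_poly P)"

interpretation place: additive_order "place_ord_poly P"
  by standard (rule place_ord_poly_mult)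

lemmas place_ord_fract = place.fract_ord_fract
lemmas place_ord_mult = place.fract_ord_mult
lemmas place_ord_inverse = place.fract_ord_inverse

definition place_ring :: "'c option \<Rightarrow> 'c::field poly fract set" where
  "place_ring P = {z. z = 0 \<or> place_ord P z \<ge> 0}"

lemma vmax_place_ring: "vmax (place_ring P) = {z. z = 0 \<or> place_ord P z > 0}"
  by (auto simp: vmax_def place_ring_def place_ord_inverse)

text \<open>\<open>x - a\<close> has a simple zero at \<open>a\<close> and a simple pole at
  infinity. With 1 for the point at infinity, \<open>place_elem P / place_elem Q\<close> has the
  divisor \<open>P - Q\<close> in all cases.\<close>

definition place_elem :: "'c option \<Rightarrow> 'c::field poly fract" where
  "place_elem P = (case P of None \<Rightarrow> 1 | Some a \<Rightarrow> to_fract [:-a, 1:])"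

lemma place_elem_nonzero: "place_elem P \<noteq> 0"
  by (auto simp: place_elem_def split: option.splits)

lemma order_linear: "order a [:-b, 1:] = (if a = b then 1 else 0)" for a :: "'c::field"
  using order_power_n_n[of a 1] by (auto intro: order_0I)

lemma place_ord_elem:
  assumes "P \<noteq> Q"
  shows "place_ord P (place_elem P / place_elem Q) > 0"
    "place_ord Q (place_elem P / place_elem Q) < 0"
    "R \<noteq> P \<Longrightarrow> R \<noteq> Q \<Longrightarrow> place_ord R (place_elem P / place_elem Q) = 0"
proof -
  have f: "\<exists>p. p \<noteq> 0 \<and> place_elem P = to_fract p \<and> (\<forall>R. place_ord_poly R p =
      (if P = None then 0 else if R = None then -1 else if R = P then 1 else 0))" for P :: "'a option"
    by (cases P) (auto simp: place_elem_def place_ord_poly_def order_linear order_1_eq_0 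
        intro!: exI[of _ "[:- the P, 1:]"] exI[of _ 1] split: option.splits)
  obtain p q where p: "p \<noteq> 0" "place_elem P = to_fract p" "\<And>R. place_ord_poly R p =
      (if P = None then 0 else if R = None then -1 else if R = P then 1 else 0)"
    and q: "q \<noteq> 0" "place_elem Q = to_fract q" "\<And>R. place_ord_poly R q =
      (if Q = None then 0 else if R = None then -1 else if R = Q then 1 else 0)" 
    using f[of P] f[of Q] by (elim exE conjE) simp
  have "place_ord R (place_elem P / place_elem Q) = place_ord_poly R p - place_ord_poly R q" for R
    using p q place_ord_fract by metis
  then show "place_ord P (place_elem P / place_elem Q) > 0"
    "place_ord Q (place_elem P / place_elem Q) < 0"
    "R \<noteq> P \<Longrightarrow> R \<noteq> Q \<Longrightarrow> place_ord R (place_elem P / place_elem Q) = 0"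
    using assms by (auto simp: p(3) q(3) split: if_splits; cases P; cases Q; auto)+
qed

section \<open>Classification of the proper valuation rings over the constants\<close>

context
  fixes R :: "'c::alg_closed_field poly fract set"
  assumes R: "valuation_ring R" and const: "range fconst \<subseteq> R" and proper: "R \<noteq> UNIV"
begin

private lemma subring_R': "is_subring R" using R by (rule valuation_ring_is_subring)

private lemma fconst_notin_vmax: "c \<noteq> 0 \<Longrightarrow> fconst c \<notin> vmax R"
  using const by (auto simp: vmax_def simp flip: fconst.hom_inverse)

private lemma map_poly_fconst: "map_poly fconst p \<in> polys_over R"
  using const by (auto simp: polys_over_def fconst.coeff_map_poly_hom)

text \<open>If \<open>x\<close> is in \<open>R\<close>, some linear polynomial is a nonunit and
  serves as \<open>t\<close>; otherwise \<open>t = inverse x\<close> does. The cofactor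
  \<open>u\<close> is required to be congruent to a nonzero constant, and not merely a unit, so that
  the residue field is obtained as well.\<close>

lemma valuation_ring_local_parameter:
  "\<exists>P t. t \<noteq> 0 \<and> t \<in> vmax R \<and> (\<forall>p. p \<noteq> 0 \<longrightarrow> (\<exists>u c. c \<noteq> 0 \<and> u - fconst c \<in> vmax R \<and>
      to_fract p = t powi place_ord_poly P p * u))"
proof (cases "to_fract [:0, 1:] \<in> R")
  case True
  have polyR: "to_fract p \<in> R" for p
    using poly_polys_over[OF subring_R' map_poly_fconst True] by (subst to_fract_eq_poly)
  \<comment> \<open>If all nonzero polynomials were units of \<open>R\<close>, then \<open>R\<close>
    would contain all fractions.\<close>
  have "\<exists>p. p \<noteq> 0 \<and> to_fract p \<in> vmax R"
  proof (rule ccontr)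
    assume "\<nexists>p. p \<noteq> 0 \<and> to_fract p \<in> vmax R"
    then have inv: "inverse (to_fract p) \<in> R" if "p \<noteq> 0" for p using that by (auto simp: vmax_def)
    have "z \<in> R" for z
    proof (cases "z = 0")
      case False
      obtain p q where "p \<noteq> 0" "q \<noteq> 0" "z = to_fract p / to_fract q" using fract_cases_nonzero[OF False] .
      then show ?thesis using is_subring_mult[OF subring_R' polyR inv] by (simp add: divide_inverse)
    qed (use subring_R' is_subring_0 in auto)
    then show False using proper by auto
  qed
  then obtain p where "p \<noteq> 0" "to_fract p \<in> vmax R" by blast
  then have "\<exists>a. to_fract [:-a, 1:] \<in> vmax R"
  proof (induction "degree p" arbitrary: p rule: less_induct)
    case less
    show ?case
    proof (cases "degree p = 0")
      case True
      then obtain c where "p = [:c:]" by (auto elim: degree_eq_zeroE)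
      then show ?thesis using less.prems fconst_notin_vmax[of c] by (auto simp: fconst_def)
    next
      case False
      then obtain a where "poly p a = 0" using alg_closed_imp_poly_has_root by blast
      then obtain q where q: "p = [:-a, 1:] * q" using poly_root_factor by blast
      then have "to_fract [:-a, 1:] * to_fract q \<in> vmax R" using less.prems by (simp only: to_fract_mult)
      then have "to_fract [:-a, 1:] \<in> vmax R \<or> to_fract q \<in> vmax R" using vmax_prime[OF R] polyR by blast
      moreover have "q \<noteq> 0" using q less.prems by auto
    moreover from this have "degree q < degree p" unfolding q by (subst degree_mult_eq) auto
      ultimately show ?thesis using less.hyps[of q] by auto
    qed
  qed
  then obtain a where a: "to_fract [:-a, 1:] \<in> vmax R" by blast
  show ?thesis
  proof (rule exI[of _ "Some a"], rule exI[of _ "to_fract [:-a, 1:]"], intro conjI allI impI)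
    fix p :: "'c poly" assume "p \<noteq> 0"
    then obtain q where q: "p = [:-a, 1:] ^ order a p * q" "\<not> [:-a, 1:] dvd q"
      using order_decomp by blast
    then have c: "poly q a \<noteq> 0" by (simp add: poly_eq_0_iff_dvd)
    have "poly (q - [:poly q a:]) a = 0" by simp
    then obtain r where r: "q - [:poly q a:] = [:-a, 1:] * r" using poly_root_factor by blast
    have "to_fract q - fconst (poly q a) = to_fract [:-a, 1:] * to_fract r"
      unfolding fconst_def by (simp only: to_fract_diff[symmetric] to_fract_mult[symmetric] r)
    then have "to_fract q - fconst (poly q a) \<in> vmax R" using vmax_mult[OF R a polyR] by simp
    moreover interpret T: type_ring_hom "to_fract :: 'c poly \<Rightarrow> _" by standard auto
    have "to_fract p = to_fract [:-a, 1:] powi place_ord_poly (Some a) p * to_fract q"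
      by (subst q(1)) (simp only: T.hom_mult T.hom_power place_ord_poly_def option.case power_int_of_nat)
    ultimately show "\<exists>u c. c \<noteq> 0 \<and> u - fconst c \<in> vmax R \<and>
      to_fract p = to_fract [:-a, 1:] powi place_ord_poly (Some a) p * u"
      using c by blast
  qed (use a in auto)
next
  case False
  define s where "s = to_fract [:0, 1 :: 'c:]"
  define t where "t = inverse s"
  have s: "s \<noteq> 0" by (simp add: s_def)
  have t: "t \<in> vmax R" using False by (simp add: t_def vmax_def s_def)
  show ?thesis
  proof (rule exI[of _ None], rule exI[of _ t], intro conjI allI impI)
    fix p :: "'c poly" assume p: "p \<noteq> 0"
    \<comment> \<open>The reversed polynomial at \<open>t = inverse x\<close> is the value of
      \<open>p\<close> at \<open>x\<close> divided by \<open>x ^ degree p\<close>, and its constant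
      term is the leading coefficient of \<open>p\<close>.\<close>
    obtain c r where cr: "reflect_poly p = pCons c r" by (cases "reflect_poly p")
    then have c: "c = lead_coeff p" by (metis coeff_0_reflect_poly coeff_pCons_0)
    define u where "u = poly (map_poly fconst (reflect_poly p)) t"
    have "u - fconst c = t * poly (map_poly fconst r) t" by (simp add: u_def cr fconst.map_poly_hom_pCons)
    moreover have "poly (map_poly fconst r) t \<in> R"
      using poly_polys_over[OF subring_R' map_poly_fconst] t vmax_subset[OF R] by blast
    ultimately have "u - fconst c \<in> vmax R" using vmax_mult[OF R t] by simp
    moreover have "to_fract p = t powi place_ord_poly None p * u"
    proof -
      have t0: "t \<noteq> 0" using s by (simp add: t_def)
      have "u = t ^ degree p * poly (map_poly fconst p) (inverse t)"
        unfolding u_def fconst.map_poly_reflect by (subst poly_reflect_poly_nz[OF t0]) simp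
      also have "inverse t = to_fract [:0, 1:]" by (simp add: t_def s_def)
      also note to_fract_eq_poly[symmetric]
      finally have "u = t ^ degree p * to_fract p" .
      moreover have "t powi place_ord_poly None p = inverse (t ^ degree p)"
        by (simp add: place_ord_poly_def power_int_minus)
      ultimately show ?thesis using t0 by simp
    qed
    ultimately show "\<exists>u c. c \<noteq> 0 \<and> u - fconst c \<in> vmax R \<and> to_fract p = t powi place_ord_poly None p * u"
      using c p by (intro exI[of _ u] exI[of _ c]) simp
  qed (use s t in \<open>auto simp: t_def\<close>)
qed

lemma unit_if_congruent_const:
  assumes "u - fconst c \<in> vmax R" "c \<noteq> 0"
  shows "u \<in> R" "inverse u \<in> R" "u \<noteq> 0"
proof -
  have "(u - fconst c) + fconst c \<in> R"
    using assms vmax_subset[OF R] const by (intro is_subring_add[OF subring_R']) auto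
  then show "u \<in> R" by simp
  have "u \<notin> vmax R"
  proof
    assume u: "u \<in> vmax R"
    have "fconst c = u + (u - fconst c) * fconst (-1)" by (simp add: fconst.hom_simps)
    moreover have "\<dots> \<in> vmax R" using u assms const by (intro vmax_add[OF R] vmax_mult[OF R]) auto
    ultimately show False using fconst_notin_vmax[OF assms(2)] by simp
  qed
  then show "inverse u \<in> R" "u \<noteq> 0" by (auto simp: vmax_def)
qed

lemma vmax_power: "x \<in> vmax R \<Longrightarrow> n > 0 \<Longrightarrow> x ^ n \<in> vmax R"
  using vmax_mult[OF R, of x "x ^ (n - 1)"] is_subring_power[OF subring_R', of x "n - 1"] vmax_subset[OF R]
  by (cases n) auto

text \<open>Every nonzero element is a power of \<open>t\<close> times a unit with constant residue.
  The exponent is the order at \<open>P\<close>, so its sign decides membership; order 0 yields the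
  residue.\<close>

theorem valuation_ring_rational_function_field:
  "\<exists>P. R = place_ring P" and residue_field_constants: "z \<in> R \<Longrightarrow> \<exists>c. z - fconst c \<in> vmax R"
proof -
  obtain P t where t: "t \<noteq> 0" "t \<in> vmax R" and *: "\<forall>p. p \<noteq> 0 \<longrightarrow> (\<exists>u c. c \<noteq> 0 \<and> u - fconst c \<in> vmax R \<and>
      to_fract p = t powi place_ord_poly P p * u)"
    using valuation_ring_local_parameter by (elim exE conjE)
  have z: "\<exists>u c. c \<noteq> 0 \<and> u - fconst c \<in> vmax R \<and> z = t powi place_ord P z * u" if nz: "z \<noteq> 0" for z
  proof -
    obtain p q where pq: "p \<noteq> 0" "q \<noteq> 0" "z = to_fract p / to_fract q" using fract_cases_nonzero[OF nz] .
    obtain u c where u: "c \<noteq> 0" "u - fconst c \<in> vmax R" "to_fract p = t powi place_ord_poly P p * u"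
      using *[rule_format, OF pq(1)] by (elim exE conjE)
    obtain v d where v: "d \<noteq> 0" "v - fconst d \<in> vmax R" "to_fract q = t powi place_ord_poly P q * v"
      using *[rule_format, OF pq(2)] by (elim exE conjE)
    note uu = unit_if_congruent_const[OF u(2,1)] and vv = unit_if_congruent_const[OF v(2,1)]
    have "u / v - fconst (c / d) = 
        (u - fconst c) * inverse v + (v - fconst d) * (- inverse v * fconst (c / d))"
    proof -
      have "v \<noteq> 0" "fconst d \<noteq> 0" using vv(3) v(1) by auto
      then show ?thesis by (simp add: fconst.hom_divide field_simps)
    qed
    also have "\<dots> \<in> vmax R"
      by (rule vmax_add[OF R vmax_mult[OF R u(2) vv(2)] vmax_mult[OF R v(2) is_subring_mult[OF subring_R'
          is_subring_uminus[OF subring_R' vv(2)] subsetD[OF const rangeI]]]])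
    finally have "u / v - fconst (c / d) \<in> vmax R" .
    moreover have "z = t powi place_ord P z * (u / v)"
    proof -
      have "place_ord P z = place_ord_poly P p - place_ord_poly P q"
        unfolding pq(3) by (rule place_ord_fract[OF pq(1,2)])
      then show ?thesis unfolding pq(3) u(3) v(3) using t(1) by (simp add: power_int_diff)
    qed
    moreover have "c / d \<noteq> 0" using u(1) v(1) by simp
    ultimately show ?thesis by (intro exI[of _ "u / v"] exI[of _ "c / d"] conjI)
  qed
  have pos: "z \<in> vmax R" if nz: "z \<noteq> 0" "place_ord P z > 0" for z
  proof -
    obtain u c where u: "c \<noteq> 0" "u - fconst c \<in> vmax R" "z = t powi place_ord P z * u"
      using z[OF nz(1)] by (elim exE conjE)
    have "t powi place_ord P z = t ^ nat (place_ord P z)" using that by (simp add: power_int_def)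
    then have "t powi place_ord P z \<in> vmax R" using vmax_power[OF t(2)] that by simp
    from vmax_mult[OF R this unit_if_congruent_const(1)[OF u(2,1)]] show ?thesis
      by (simp flip: u(3))
  qed
  have zero: "\<exists>c. c \<noteq> 0 \<and> z - fconst c \<in> vmax R" if "z \<noteq> 0" "place_ord P z = 0" for z
    using z[OF that(1)] that by auto
  have mem: "z \<in> R \<longleftrightarrow> place_ord P z \<ge> 0" if "z \<noteq> 0" for z
  proof -
    consider "place_ord P z > 0" | "place_ord P z = 0" | "place_ord P z < 0" by linarith
    then show ?thesis
    proof cases
      case 1
      then show ?thesis using pos[OF that] vmax_subset[OF R] by auto
    next
      case 2
      then show ?thesis using zero[OF that] unit_if_congruent_const by auto
    next
      case 3
      then have "inverse z \<in> vmax R" using pos[of "inverse z"] that by (simp add: place_ord_inverse)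
      then show ?thesis using 3 that by (auto simp: vmax_def)
    qed
  qed
  have "z \<in> R \<longleftrightarrow> z \<in> place_ring P" for z
    using mem[of z] is_subring_0[OF subring_R'] by (cases "z = 0") (auto simp: place_ring_def)
  then have "R = place_ring P" by blast
  then show "\<exists>P. R = place_ring P" by blast
  show "\<exists>c. z - fconst c \<in> vmax R" if "z \<in> R"
  proof (cases "z \<in> vmax R")
    case True
    then show ?thesis by (intro exI[of _ 0]) (simp add: fconst.hom_0)
  next
    case False
    then have nz: "z \<noteq> 0" by (auto simp: vmax_def)
    then have "place_ord P z = 0" using that mem[of z] pos[of z] False by fastforce
    then show ?thesis using zero nz by blast
  qed
qed

end

section \<open>Bivariate polynomials\<close>

text \<open>The library proves that polynomial rings are factorial only over coefficient types with
  chosen greatest common divisors, which a plain field does not provide. This copy of a field does.\<close>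
typedef 'a fld = "UNIV :: 'a set" morphisms un_fld fld ..

lemma un_fld_fld [simp]: "un_fld (fld x) = x"
  by (simp add: fld_inverse)

lemma fld_un_fld [simp]: "fld (un_fld x) = x"
  by (simp add: un_fld_inverse)

lemma fld_eq_iff: "x = y \<longleftrightarrow> un_fld x = un_fld y"
  by (simp add: un_fld_inject)

instantiation fld :: (field) field
begin

definition "0 = fld 0"
definition "1 = fld 1"
definition "x + y = fld (un_fld x + un_fld y)"
definition "x - y = fld (un_fld x - un_fld y)"
definition "- x = fld (- un_fld x)"
definition "x * y = fld (un_fld x * un_fld y)"
definition "inverse x = fld (inverse (un_fld x))"
definition "x div y = fld (un_fld x / un_fld y)"

instance
  by standard (auto simp: fld_eq_iff zero_fld_def one_fld_def plus_fld_def minus_fld_def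
      uminus_fld_def times_fld_def inverse_fld_def divide_fld_def algebra_simps divide_inverse)

end

instantiation fld :: (field)
  "{unique_euclidean_ring, normalization_euclidean_semiring, normalization_semidom_multiplicative}"
begin

definition [simp]: "normalize_fld = (normalize_field :: 'a fld \<Rightarrow> _)"
definition [simp]: "unit_factor_fld = (unit_factor_field :: 'a fld \<Rightarrow> _)"
definition [simp]: "modulo_fld = (mod_field :: 'a fld \<Rightarrow> _)"
definition [simp]: "euclidean_size_fld = (euclidean_size_field :: 'a fld \<Rightarrow> _)"
definition [simp]: "division_segment (x :: 'a fld) = 1"

instance
  by standard (simp_all add: dvd_field_iff field_split_simps split: if_splits)

end

instantiation fld :: (field) euclidean_ring_gcd
begin

definition gcd_fld :: "'a fld \<Rightarrow> 'a fld \<Rightarrow> 'a fld" where "gcd_fld = Euclidean_Algorithm.gcd"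
definition lcm_fld :: "'a fld \<Rightarrow> 'a fld \<Rightarrow> 'a fld" where "lcm_fld = Euclidean_Algorithm.lcm"
definition Gcd_fld :: "'a fld set \<Rightarrow> 'a fld" where "Gcd_fld = Euclidean_Algorithm.Gcd"
definition Lcm_fld :: "'a fld set \<Rightarrow> 'a fld" where "Lcm_fld = Euclidean_Algorithm.Lcm"

instance
  by standard (simp_all add: gcd_fld_def lcm_fld_def Gcd_fld_def Lcm_fld_def)

end

instance fld :: (field) field_gcd ..

section \<open>Transfer of factoriality to bivariate polynomials\<close>

definition to_fld :: "'a::field poly poly \<Rightarrow> 'a fld poly poly" where
  "to_fld = map_poly (map_poly fld)"

definition of_fld :: "'a::field fld poly poly \<Rightarrow> 'a poly poly" where
  "of_fld = map_poly (map_poly un_fld)"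

lemma to_fld_of_fld [simp]: "to_fld (of_fld p) = p"
  by (simp add: to_fld_def of_fld_def poly_eq_iff coeff_map_poly zero_fld_def)

lemma of_fld_to_fld [simp]: "of_fld (to_fld p) = p"
  by (simp add: to_fld_def of_fld_def poly_eq_iff coeff_map_poly zero_fld_def)

interpretation to_fld: type_ring_hom to_fld
  unfolding to_fld_def
  by (intro type_ring_hom.map_poly_hom) (unfold_locales, simp_all add: plus_fld_def times_fld_def one_fld_def)

lemma to_fld_eq_iff: "to_fld p = to_fld q \<longleftrightarrow> p = q"
  by (metis of_fld_to_fld)

lemma to_fld_eq_0_iff [simp]: "to_fld p = 0 \<longleftrightarrow> p = 0"
  using to_fld_eq_iff[of p 0] by (simp add: to_fld.hom_0)

lemma to_fld_dvd_iff: "to_fld p dvd to_fld q \<longleftrightarrow> p dvd q"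
proof
  assume "to_fld p dvd to_fld q"
  then obtain r where "to_fld q = to_fld p * r" unfolding dvd_def by blast
  then have "to_fld q = to_fld (p * of_fld r)" by (simp add: to_fld.hom_mult)
  then show "p dvd q" unfolding to_fld_eq_iff by simp
next
  assume "p dvd q"
  then obtain r where "q = p * r" unfolding dvd_def by blast
  then show "to_fld p dvd to_fld q" by (simp add: to_fld.hom_mult)
qed

lemma to_fld_is_unit_iff: "is_unit (to_fld p) \<longleftrightarrow> is_unit p"
  using to_fld_dvd_iff[of p 1] by (simp add: to_fld.hom_1)

lemma to_fld_prime_elem_iff: "prime_elem (to_fld p) \<longleftrightarrow> prime_elem p"
proof
  assume p: "prime_elem (to_fld p)"
  have "p dvd a \<or> p dvd b" if "p dvd a * b" for a b
  proof -
    have "to_fld p dvd to_fld a * to_fld b" using that by (simp add: to_fld_dvd_iff flip: to_fld.hom_mult)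
    then show ?thesis using p by (simp add: to_fld_dvd_iff prime_elem_dvd_mult_iff)
  qed
  then show "prime_elem p" using p by (simp add: prime_elem_def to_fld_is_unit_iff)
next
  assume p: "prime_elem p"
  have "to_fld p dvd a \<or> to_fld p dvd b" if "to_fld p dvd a * b" for a b
  proof -
    have "to_fld p dvd to_fld (of_fld a * of_fld b)" using that by (simp add: to_fld.hom_mult)
    then have "p dvd of_fld a \<or> p dvd of_fld b" using p by (simp add: to_fld_dvd_iff prime_elem_dvd_mult_iff)
    then show ?thesis using to_fld_dvd_iff[of p "of_fld a"] to_fld_dvd_iff[of p "of_fld b"] by simp
  qed
  then show "prime_elem (to_fld p)" using p by (simp add: prime_elem_def to_fld_is_unit_iff)
qed

lemma to_fld_irreducible: 
  assumes "irreducible p" shows "irreducible (to_fld p)"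
proof (rule irreducibleI)
  show "to_fld p \<noteq> 0" "\<not> is_unit (to_fld p)" using assms by (auto simp: irreducible_def to_fld_is_unit_iff)
  fix a b assume "to_fld p = a * b"
  then have "to_fld p = to_fld (of_fld a * of_fld b)" by (simp add: to_fld.hom_mult)
  then have "p = of_fld a * of_fld b" by (simp only: to_fld_eq_iff)
  then have "is_unit (of_fld a) \<or> is_unit (of_fld b)" using assms by (simp add: irreducible_def)
  then show "is_unit a \<or> is_unit b"
    using to_fld_is_unit_iff[of "of_fld a"] to_fld_is_unit_iff[of "of_fld b"] by simp
qed

theorem bivariate_irreducible_imp_prime_elem:
  fixes p :: "'k::field poly poly"
  assumes "irreducible p"
  shows "prime_elem p"
  using irreducible_imp_prime_elem[OF to_fld_irreducible[OF assms]] by (simp add: to_fld_prime_elem_iff)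

lemma bivariate_prime_divisor_exists:
  fixes p :: "'k::field poly poly"
  assumes "p \<noteq> 0" "\<not> is_unit p"
  shows "\<exists>q. prime_elem q \<and> q dvd p"
proof -
  obtain r where "prime r" "r dvd to_fld p"
    using prime_divisor_exists[of "to_fld p"] assms by (auto simp: to_fld_is_unit_iff)
  then show ?thesis
    using to_fld_prime_elem_iff[of "of_fld r"] to_fld_dvd_iff[of "of_fld r" p]
    by (intro exI[of _ "of_fld r"]) (simp add: prime_def)
qed

text \<open>The degree sum of the lexicographically leading monomial: additive on products and zero
  only on constants, hence a measure for inductions over factorizations.\<close>

definition bidegree :: "'k::field poly poly \<Rightarrow> nat" where
  "bidegree p = degree p + degree (lead_coeff p)"

lemma bidegree_mult: "p \<noteq> 0 \<Longrightarrow> q \<noteq> 0 \<Longrightarrow> bidegree (p * q) = bidegree p + bidegree q"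
  unfolding bidegree_def lead_coeff_mult by (simp add: degree_mult_eq)

lemma bidegree_eq_0: "bidegree p = 0 \<Longrightarrow> p \<in> range kconst"
proof -
  assume *: "bidegree p = 0"
  then obtain a where a: "p = [:a:]" by (auto simp: bidegree_def elim: degree_eq_zeroE)
  then obtain c where "a = [:c:]" using * by (auto simp: bidegree_def elim: degree_eq_zeroE)
  then show ?thesis using a by (auto simp: kconst_def)
qed

lemma is_unit_kconst: "c \<noteq> 0 \<Longrightarrow> is_unit (kconst c)"
  by (simp add: kconst_def is_unit_const_poly_iff dvd_field_iff)

lemma bidegree_pos: "p \<noteq> 0 \<Longrightarrow> \<not> is_unit p \<Longrightarrow> bidegree p > 0"
  using bidegree_eq_0[of p] is_unit_kconst by (fastforce simp: kconst_def)

lemma bivariate_unit: "is_unit p \<Longrightarrow> \<exists>c. c \<noteq> 0 \<and> p = kconst c"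
  by (auto simp: kconst_def is_unit_poly_iff)

lemma bivariate_factor_induct [consumes 1, case_names const prime]:
  fixes p :: "'k::field poly poly"
  assumes "p \<noteq> 0"
    and const: "\<And>c. c \<noteq> 0 \<Longrightarrow> Q (kconst c)"
    and prime: "\<And>q p. prime_elem q \<Longrightarrow> p \<noteq> 0 \<Longrightarrow> Q p \<Longrightarrow> Q (q * p)"
  shows "Q p"
  using assms(1)
proof (induction "bidegree p" arbitrary: p rule: less_induct)
  case less
  show ?case
  proof (cases "is_unit p")
    case True
    then show ?thesis using bivariate_unit const by blast
  next
    case False
    then obtain q where q: "prime_elem q" "q dvd p" using bivariate_prime_divisor_exists less.prems by blast
    then obtain r where r: "p = q * r" by (auto elim: dvdE)
    have nz: "r \<noteq> 0" "q \<noteq> 0" using less.prems r by auto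
    have "bidegree q > 0" using q nz bidegree_pos by (auto simp: prime_elem_def)
    then have "bidegree r < bidegree p" using nz by (simp add: r bidegree_mult)
    then show ?thesis using less.hyps nz prime[OF q(1) nz(1)] r by blast
  qed
qed

definition bi_mult :: "'k::field poly poly \<Rightarrow> 'k poly poly \<Rightarrow> nat" where
  "bi_mult p x = multiplicity (to_fld p) (to_fld x)"

context
  fixes P :: "'k::field poly poly"
  assumes P: "prime_elem P"
begin

private lemma P': "to_fld P \<noteq> 0" "\<not> is_unit (to_fld P)" "prime_elem (to_fld P)"
  using P by (simp_all add: to_fld_is_unit_iff to_fld_prime_elem_iff prime_elem_not_zeroI prime_elem_not_unit)

lemma power_dvd_iff_bi_mult: "x \<noteq> 0 \<Longrightarrow> P ^ n dvd x \<longleftrightarrow> n \<le> bi_mult P x"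
  using power_dvd_iff_le_multiplicity[of "to_fld x" "to_fld P" n] P'
  by (simp add: bi_mult_def to_fld_dvd_iff flip: to_fld.hom_power)

lemma bi_mult_mult: "x \<noteq> 0 \<Longrightarrow> y \<noteq> 0 \<Longrightarrow> bi_mult P (x * y) = bi_mult P x + bi_mult P y"
  using P' by (simp add: bi_mult_def to_fld.hom_mult prime_elem_multiplicity_mult_distrib)

lemma bi_mult_pos_iff: "x \<noteq> 0 \<Longrightarrow> bi_mult P x > 0 \<longleftrightarrow> P dvd x"
  using power_dvd_iff_bi_mult[of x 1] by auto

lemma bi_mult_add: "x \<noteq> 0 \<Longrightarrow> y \<noteq> 0 \<Longrightarrow> x + y \<noteq> 0 \<Longrightarrow> min (bi_mult P x) (bi_mult P y) \<le> bi_mult P (x + y)"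
proof -
  assume nz: "x \<noteq> 0" "y \<noteq> 0" "x + y \<noteq> 0"
  let ?m = "min (bi_mult P x) (bi_mult P y)"
  have "P ^ ?m dvd x" "P ^ ?m dvd y"
    using power_dvd_iff_bi_mult[OF nz(1), of ?m] power_dvd_iff_bi_mult[OF nz(2), of ?m] by simp_all
  then have "P ^ ?m dvd x + y" by (rule dvd_add)
  then show "?m \<le> bi_mult P (x + y)" using power_dvd_iff_bi_mult[OF nz(3), of ?m] by blast
qed

end

section \<open>Valuations attached to prime elements\<close>

abbreviation padic_ord :: "'k::field poly poly \<Rightarrow> 'k poly poly fract \<Rightarrow> int" where
  "padic_ord P \<equiv> fract_ord (\<lambda>x. int (bi_mult P x))"

lemma additive_order_bi_mult: "prime_elem P \<Longrightarrow> additive_order (\<lambda>x. int (bi_mult P x))"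
  by standard (simp add: bi_mult_mult)

definition padic_ring :: "'k::field poly poly \<Rightarrow> 'k poly poly fract set" where
  "padic_ring P = {z. z = 0 \<or> padic_ord P z \<ge> 0}"

text \<open>The units constructed from two dicriticals are controlled at valuation rings over
  \<open>k(F)\<close> only. To read off their order along a curve, the curve must itself appear as
  such a ring.\<close>

lemma valuation_ring_padic:
  assumes P: "prime_elem P"
  shows "valuation_ring (padic_ring P)"
proof -
  interpret additive_order "\<lambda>x. int (bi_mult P x)" using additive_order_bi_mult[OF P] .
  have neg: "fract_ord (\<lambda>x. int (bi_mult P x)) (- z) = padic_ord P z" if "z \<noteq> 0" for z
  proof -
    have "bi_mult P (- 1) = 0"
      using bi_mult_mult[OF P, of "-1" "-1"] bi_mult_mult[OF P, of 1 1] by simp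
    then have "padic_ord P (to_fract (- 1)) = 0" by (subst fract_ord_to_fract) auto
    then show ?thesis using fract_ord_mult[of "-1" z] that by simp
  qed
  have add: "x + y \<in> padic_ring P" if xy: "x \<in> padic_ring P" "y \<in> padic_ring P" for x y
  proof (cases "x = 0 \<or> y = 0 \<or> x + y = 0")
    case False
    have nz0: "x \<noteq> 0" "y \<noteq> 0" using False by auto
    obtain a b where x: "a \<noteq> 0" "b \<noteq> 0" "x = to_fract a / to_fract b"
      using fract_cases_nonzero[OF nz0(1)] .
    obtain c d where y: "c \<noteq> 0" "d \<noteq> 0" "y = to_fract c / to_fract d"
      using fract_cases_nonzero[OF nz0(2)] .
    have eq: "x + y = to_fract (a * d + c * b) / to_fract (b * d)"
      using x(1,2) y(1,2) unfolding x(3) y(3) by (simp add: field_simps)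
    have nz: "a * d + c * b \<noteq> 0"
    proof
      assume "a * d + c * b = 0"
      then have "x + y = 0" unfolding eq by simp
      then show False using False by simp
    qed
    have "padic_ord P x \<ge> 0" "padic_ord P y \<ge> 0" using xy False by (auto simp: padic_ring_def)
    then have "bi_mult P a \<ge> bi_mult P b" "bi_mult P c \<ge> bi_mult P d"
      using x y by (simp_all add: fract_ord_fract)
    then have "min (bi_mult P (a * d)) (bi_mult P (c * b)) \<ge> bi_mult P (b * d)"
      using x y by (simp add: bi_mult_mult[OF P])
    then have "bi_mult P (a * d + c * b) \<ge> bi_mult P (b * d)"
      using bi_mult_add[OF P, of "a * d" "c * b"] nz x y by auto
    moreover have "padic_ord P (x + y) = int (bi_mult P (a * d + c * b)) - int (bi_mult P (b * d))"
      unfolding eq using nz x y by (intro fract_ord_fract) auto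
    ultimately show ?thesis by (simp add: padic_ring_def)
  qed (use xy in \<open>auto simp: padic_ring_def\<close>)
  show ?thesis unfolding valuation_ring_def
  proof (intro conjI ballI allI impI)
    show "0 \<in> padic_ring P" "1 \<in> padic_ring P" by (auto simp: padic_ring_def fract_ord_1)
    fix x assume x: "x \<in> padic_ring P"
    show "- x \<in> padic_ring P" using x neg[of x] by (cases "x = 0") (auto simp: padic_ring_def)
    fix y assume y: "y \<in> padic_ring P"
    show "x + y \<in> padic_ring P" using add x y .
    show "x * y \<in> padic_ring P"
      using x y fract_ord_mult[of x y] by (cases "x = 0 \<or> y = 0") (auto simp: padic_ring_def)
  next
    fix z :: "'a poly poly fract" assume "z \<noteq> 0"
    then show "z \<in> padic_ring P \<or> inverse z \<in> padic_ring P"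
      using fract_ord_inverse[of z] by (auto simp: padic_ring_def)
  qed
qed

section \<open>Principal prime ideals and irreducible components\<close>

definition gen_by :: "'k::field poly poly \<Rightarrow> 'k poly poly set" where
  "gen_by P = {a. P dvd a}"

lemma prime_ideal_gen_by: "prime_elem P \<Longrightarrow> prime_ideal_A (gen_by P)"
  unfolding prime_ideal_A_def gen_by_def
  by (auto simp: prime_elem_dvd_mult_iff prime_elem_not_unit)

lemma gen_by_subset_iff: "gen_by P \<subseteq> gen_by Q \<longleftrightarrow> Q dvd P"
proof
  assume "gen_by P \<subseteq> gen_by Q"
  moreover have "P \<in> gen_by P" by (simp add: gen_by_def)
  ultimately have "P \<in> gen_by Q" by blast
  then show "Q dvd P" by (simp add: gen_by_def)
next
  assume "Q dvd P"
  then show "gen_by P \<subseteq> gen_by Q" unfolding gen_by_def using dvd_trans[of Q P] by blast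
qed

lemma gen_by_subset_prime_ideal:
  assumes "prime_ideal_A I" "P \<in> I"
  shows "gen_by P \<subseteq> I"
proof
  fix a assume "a \<in> gen_by P"
  then obtain b where "a = b * P" unfolding gen_by_def dvd_def by (auto simp: mult.commute)
  then show "a \<in> I" using assms by (simp add: prime_ideal_A_def)
qed

lemma prime_elem_dvd_imp_gen_by_eq:
  assumes "prime_elem P" "prime_elem Q" "P dvd Q"
  shows "gen_by P = gen_by Q"
proof -
  obtain r where r: "Q = P * r" using assms by (auto elim: dvdE)
  have "is_unit r"
    using irreducibleD[OF prime_elem_imp_irreducible[OF assms(2)] r] assms(1) by simp
  then have "Q dvd P" unfolding r by simp
  then show ?thesis using assms(3) gen_by_subset_iff by blast
qed

lemma prime_ideal_contains_prime:
  assumes I: "prime_ideal_A I" and G: "G \<noteq> 0" "G \<in> I"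
  shows "\<exists>P. prime_elem P \<and> P dvd G \<and> P \<in> I"
  using G
proof (induction rule: bivariate_factor_induct)
  case (const c)
  have "kconst (inverse c) * kconst c = 1" using const by (simp add: kconst_def one_pCons)
  moreover have "kconst (inverse c) * kconst c \<in> I"
    using I const by (simp add: prime_ideal_A_def)
  ultimately show ?case using I by (simp add: prime_ideal_A_def)
next
  case (prime q p)
  then have "q \<in> I \<or> p \<in> I" using I by (auto simp: prime_ideal_A_def)
  then show ?case using prime by (auto intro: dvd_mult)
qed

text \<open>Since \<open>A\<close> is factorial, a prime ideal containing \<open>G\<close> contains
  a prime factor of \<open>G\<close>, and therefore the principal prime ideal generated by
  it.\<close>

theorem minimal_primes_over_eq:
  assumes G: "G \<noteq> 0"
  shows "minimal_primes_over G = gen_by ` {P. prime_elem P \<and> P dvd G}"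
proof (intro equalityI subsetI)
  fix I assume I: "I \<in> minimal_primes_over G"
  then obtain P where P: "prime_elem P" "P dvd G" "P \<in> I"
    using prime_ideal_contains_prime[of I G] G by (auto simp: minimal_primes_over_def)
  have "gen_by P \<subseteq> I"
    using gen_by_subset_prime_ideal[OF _ P(3)] I by (simp add: minimal_primes_over_def)
  moreover have "G \<in> gen_by P" using P by (simp add: gen_by_def)
  ultimately have "gen_by P = I"
    using I prime_ideal_gen_by[OF P(1)] by (auto simp: minimal_primes_over_def)
  then show "I \<in> gen_by ` {P. prime_elem P \<and> P dvd G}" using P by auto
next
  fix I assume "I \<in> gen_by ` {P. prime_elem P \<and> P dvd G}"
  then obtain P where P: "prime_elem P" "P dvd G" "I = gen_by P" by auto
  have "Q = I" if Q: "prime_ideal_A Q" "G \<in> Q" "Q \<subseteq> I" for Q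
  proof -
    obtain P' where P': "prime_elem P'" "P' \<in> Q" using prime_ideal_contains_prime[OF Q(1) G Q(2)] by blast
    then have "P dvd P'" using Q P by (auto simp: gen_by_def)
    then have "gen_by P = gen_by P'" using prime_elem_dvd_imp_gen_by_eq P P' by blast
    moreover have "gen_by P' \<subseteq> Q"
      using gen_by_subset_prime_ideal P'(2) Q(1) by blast
    ultimately show ?thesis using Q P by blast
  qed
  then show "I \<in> minimal_primes_over G"
    using P prime_ideal_gen_by by (auto simp: minimal_primes_over_def gen_by_def)
qed

lemma finite_minimal_primes_over:
  assumes "G \<noteq> 0"
  shows "finite (minimal_primes_over G)"
proof -
  have "finite (gen_by ` {P. prime_elem P \<and> P dvd G})"
    using assms
  proof (induction rule: bivariate_factor_induct)
    case (const c)
    have "\<not> prime_elem P" if "P dvd kconst c" for P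
      using that is_unit_kconst[OF const] by (metis dvd_trans prime_elem_not_unit)
    then show ?case by (auto intro: finite_subset[of _ "{}"])
  next
    case (prime q p)
    have "gen_by P \<in> insert (gen_by q) (gen_by ` {P. prime_elem P \<and> P dvd p})"
      if "prime_elem P" "P dvd q * p" for P
    proof -
      have "P dvd q \<or> P dvd p" using that by (simp add: prime_elem_dvd_mult_iff)
      then show ?thesis using that(1) prime_elem_dvd_imp_gen_by_eq[OF that(1) prime(1)] by blast
    qed
    then have "gen_by ` {P. prime_elem P \<and> P dvd q * p} \<subseteq>
        insert (gen_by q) (gen_by ` {P. prime_elem P \<and> P dvd p})" by blast
    then show ?case using prime by (meson finite.insertI finite_subset)
  qed
  then show ?thesis using minimal_primes_over_eq[OF assms] by simp
qed

section \<open>Parametrizations of bounded degree\<close>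

lemma poly_eq_sum_le:
  fixes p :: "'a::comm_ring_1 poly"
  shows "degree p \<le> n \<Longrightarrow> poly p x = (\<Sum>i\<le>n. coeff p i * x ^ i)"
  unfolding poly_altdef by (intro sum.mono_neutral_left) (auto simp: coeff_eq_0)

text \<open>The inner variable \<open>[:[:0, 1:]:]\<close> plays the role of \<open>x\<close> and
  goes to \<open>\<xi>\<close>; the outer variable \<open>[:0, 1:]\<close> plays the role of
  \<open>y\<close> and goes to \<open>\<eta>\<close>.\<close>

definition eval2 :: "('k::field \<Rightarrow> 'r::comm_ring_1) \<Rightarrow> 'r \<Rightarrow> 'r \<Rightarrow> 'k poly poly \<Rightarrow> 'r" where
  "eval2 c \<xi> \<eta> G = poly (map_poly (\<lambda>g. poly (map_poly c g) \<xi>) G) \<eta>"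

lemma type_ring_hom_eval2: "type_ring_hom c \<Longrightarrow> type_ring_hom (eval2 c \<xi> \<eta>)"
  using type_ring_hom.type_ring_hom_poly[OF type_ring_hom.type_ring_hom_poly[of c \<xi>], of \<eta>]
  by (simp add: eval2_def[abs_def])

lemma eval2_const:
  assumes "type_ring_hom c" shows "eval2 c \<xi> \<eta> [:g:] = poly (map_poly c g) \<xi>"
proof -
  interpret c: type_ring_hom c by fact
  interpret cp: type_ring_hom "\<lambda>g. poly (map_poly c g) \<xi>" by (rule c.type_ring_hom_poly)
  show ?thesis by (simp add: eval2_def cp.map_poly_hom_pCons)
qed

lemma eval2_simps:
  assumes "type_ring_hom c"
  shows "eval2 c \<xi> \<eta> (kconst a) = c a" "eval2 c \<xi> \<eta> [:[:0, 1:]:] = \<xi>" "eval2 c \<xi> \<eta> [:0, 1:] = \<eta>"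
proof -
  interpret c: type_ring_hom c by fact
  interpret cp: type_ring_hom "\<lambda>g. poly (map_poly c g) \<xi>" by (rule c.type_ring_hom_poly)
  show "eval2 c \<xi> \<eta> (kconst a) = c a" "eval2 c \<xi> \<eta> [:[:0, 1:]:] = \<xi>"
    unfolding kconst_def eval2_const[OF assms] by (simp_all add: c.map_poly_hom_pCons c.hom_simps)
  show "eval2 c \<xi> \<eta> [:0, 1:] = \<eta>"
    unfolding eval2_def by (simp add: cp.map_poly_hom_pCons cp.hom_simps)
qed

lemma type_ring_hom_kconst: "type_ring_hom kconst"
  by standard (simp_all add: kconst_def one_pCons)

lemma hom_eq_eval2:
  assumes "type_ring_hom h"
  shows "h G = eval2 (\<lambda>a. h (kconst a)) (h [:[:0, 1:]:]) (h [:0, 1:]) G"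
proof -
  interpret h: type_ring_hom h by fact
  interpret k: type_ring_hom "\<lambda>a. h (kconst a)" by (rule type_ring_hom_comp[OF type_ring_hom_kconst assms])
  interpret kp: type_ring_hom "\<lambda>g. poly (map_poly (\<lambda>a. h (kconst a)) g) (h [:[:0, 1:]:])"
    by (rule k.type_ring_hom_poly)
  have g: "h [:g:] = poly (map_poly (\<lambda>a. h (kconst a)) g) (h [:[:0, 1:]:])" for g
  proof (induction g)
    case 0
    then show ?case by (simp add: h.hom_0)
  next
    case (pCons a g)
    have "[:pCons a g:] = kconst a + [:[:0, 1:]:] * [:g:]" by (simp add: kconst_def)
    then have "h [:pCons a g:] = h (kconst a) + h [:[:0, 1:]:] * h [:g:]"
      by (simp only: h.hom_add h.hom_mult)
    then show ?case by (simp add: k.map_poly_hom_pCons pCons.IH)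
  qed
  show ?thesis
  proof (induction G)
    case 0
    show ?case by (simp add: eval2_def h.hom_0)
  next
    case (pCons g G)
    have "pCons g G = [:g:] + [:0, 1:] * G" by simp
    then have "h (pCons g G) = h [:g:] + h [:0, 1:] * h G" by (simp only: h.hom_add h.hom_mult)
    then show ?case by (simp add: eval2_def kp.map_poly_hom_pCons g[of g] pCons.IH)
  qed
qed

text \<open>Clearing the denominators of \<open>x = p / r\<close> and \<open>y = u / v\<close> turns
  the equation of a parametrized curve into a polynomial identity. In this form it is a condition on
  coefficients and can be specialized.\<close>

lemma eval2_bihomogeneous:
  fixes c :: "'k::field \<Rightarrow> 'r::field"
  assumes c: "type_ring_hom c" and nz: "r \<noteq> 0" "v \<noteq> 0"
    and deg: "degree P \<le> d" "\<And>j. degree (coeff P j) \<le> e"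
  shows "(\<Sum>j\<le>d. \<Sum>i\<le>e. c (coeff (coeff P j) i) * (p ^ i * r ^ (e - i) * u ^ j * v ^ (d - j))) =
    r ^ e * v ^ d * eval2 c (p / r) (u / v) P"
proof -
  interpret c: type_ring_hom c by fact
  interpret cp: type_ring_hom "\<lambda>g. poly (map_poly c g) (p / r)" by (rule c.type_ring_hom_poly)
  have 1: "r ^ e * poly (map_poly c g) (p / r) = (\<Sum>i\<le>e. c (coeff g i) * (p ^ i * r ^ (e - i)))"
    if "degree g \<le> e" for g
  proof -
    have "degree (map_poly c g) \<le> e" using that map_poly_degree_leq order.trans by blast
    then have "r ^ e * poly (map_poly c g) (p / r) = (\<Sum>i\<le>e. r ^ e * (c (coeff g i) * (p / r) ^ i))"
      by (simp add: poly_eq_sum_le c.coeff_map_poly_hom sum_distrib_left)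
    also have "\<dots> = (\<Sum>i\<le>e. c (coeff g i) * (p ^ i * r ^ (e - i)))"
      using nz by (intro sum.cong) (auto simp: power_diff power_divide)
    finally show ?thesis .
  qed
  have "degree (map_poly (\<lambda>g. poly (map_poly c g) (p / r)) P) \<le> d"
    using deg(1) map_poly_degree_leq order.trans by blast
  then have "r ^ e * v ^ d * eval2 c (p / r) (u / v) P =
      (\<Sum>j\<le>d. r ^ e * v ^ d * (poly (map_poly c (coeff P j)) (p / r) * (u / v) ^ j))"
    unfolding eval2_def by (simp add: poly_eq_sum_le cp.coeff_map_poly_hom sum_distrib_left)
  also have "\<dots> = (\<Sum>j\<le>d. (r ^ e * poly (map_poly c (coeff P j)) (p / r)) * (u ^ j * v ^ (d - j)))"
    using nz by (intro sum.cong) (auto simp: power_diff power_divide)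
  also have "\<dots> = (\<Sum>j\<le>d. \<Sum>i\<le>e. c (coeff (coeff P j) i) * (p ^ i * r ^ (e - i) * u ^ j * v ^ (d - j)))"
    unfolding 1[OF deg(2)] sum_distrib_right by (intro sum.cong refl) (simp add: mult_ac)
  finally show ?thesis by simp
qed

text \<open>Over an algebraically closed field this is coprimality, put in the form in which linear
  factors are split off.\<close>

definition no_common_root :: "'k::field poly \<Rightarrow> 'k poly \<Rightarrow> bool" where
  "no_common_root p r \<longleftrightarrow> (\<forall>a. \<not> (poly p a = 0 \<and> poly r a = 0))"

lemma fract_no_common_root:
  fixes z :: "'k::field poly fract"
  obtains p r where "r \<noteq> 0" "z = to_fract p / to_fract r" "no_common_root p r"
proof -
  define Q where "Q n \<longleftrightarrow> (\<exists>p r. r \<noteq> 0 \<and> z = to_fract p / to_fract r \<and> degree r = n)" for n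
  obtain p0 r0 where "r0 \<noteq> 0" "z = to_fract p0 / to_fract r0"
    by (cases z) (auto simp: Fract_conv_to_fract)
  then have "Q (degree r0)" by (auto simp: Q_def)
  then have L: "Q (LEAST n. Q n)" by (rule LeastI)
  then obtain p r where pr: "r \<noteq> 0" "z = to_fract p / to_fract r" "degree r = (LEAST n. Q n)"
    by (auto simp: Q_def)
  have "\<not> (poly p a = 0 \<and> poly r a = 0)" for a
  proof
    assume "poly p a = 0 \<and> poly r a = 0"
    then obtain p' r' where e: "p = [:-a, 1:] * p'" "r = [:-a, 1:] * r'"
      using poly_root_factor[of p a] poly_root_factor[of r a] by blast
    have r': "r' \<noteq> 0" using e pr by auto
    have "z = to_fract p' / to_fract r'" unfolding pr(2) e to_fract_mult by simp
    then have "Q (degree r')" using r' by (auto simp: Q_def)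
    moreover have "degree r = Suc (degree r')" using r' unfolding e(2) by (subst degree_mult_eq) auto
    ultimately show False using not_less_Least[of "degree r'" Q] pr(3) by simp
  qed
  then show ?thesis using that pr by (simp add: no_common_root_def)
qed

lemma dvd_mult_no_common_root:
  fixes p :: "'k::alg_closed_field poly"
  assumes "no_common_root p r" "p dvd u * r" "p \<noteq> 0"
  shows "p dvd u"
  using assms
proof (induction "degree p" arbitrary: p u rule: less_induct)
  case less
  show ?case
  proof (cases "degree p = 0")
    case True
    then have "is_unit p" using less.prems(3) by (simp add: is_unit_iff_degree)
    then show ?thesis by (rule unit_imp_dvd)
  next
    case False
    then obtain a where a: "poly p a = 0" using alg_closed_imp_poly_has_root by blast
    then obtain p' where p': "p = [:-a, 1:] * p'" using poly_root_factor by blast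
    from less.prems(2) obtain w where w: "u * r = p * w" by (elim dvdE)
    have "poly (u * r) a = 0" unfolding w using a by simp
    moreover have "poly r a \<noteq> 0" using less.prems(1) a by (auto simp: no_common_root_def)
    ultimately have "poly u a = 0" by simp
    then obtain u' where u': "u = [:-a, 1:] * u'" using poly_root_factor by blast
    have "[:-a, 1:] * (u' * r) = [:-a, 1:] * (p' * w)" using w unfolding u' p' by (simp only: mult.assoc)
    then have "u' * r = p' * w" by (subst (asm) mult_left_cancel) auto
    then have "p' dvd u' * r" by simp
    moreover have nz: "p' \<noteq> 0" using less.prems(3) p' by auto
    moreover have "degree p' < degree p" using nz unfolding p' by (subst degree_mult_eq) auto
    moreover have "no_common_root p' r" using less.prems(1) unfolding p' by (auto simp: no_common_root_def)
    ultimately have "p' dvd u'" using less.hyps by blast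
    then show ?thesis unfolding p' u' by (rule mult_dvd_mono[OF dvd_refl])
  qed
qed

lemma dvd_mult_power_no_common_root:
  fixes p :: "'k::alg_closed_field poly"
  assumes "no_common_root p r" "p dvd u * r ^ n" "p \<noteq> 0"
  shows "p dvd u"
  using assms(2)
proof (induction n)
  case (Suc n)
  then have "p dvd (u * r ^ n) * r" by (simp add: mult_ac)
  then show ?case using dvd_mult_no_common_root[OF assms(1) _ assms(3)] Suc.IH by blast
qed simp

text \<open>Once the lower \<open>u j\<close> vanish, the relation divided by \<open>p ^ J\<close>
  shows that \<open>p\<close> divides \<open>u J * r ^ (m - J)\<close>, hence \<open>u J\<close>,
  whose degree is too small for that. It serves both for a field degree and as a rational root
  theorem.\<close>

lemma homogeneous_relation_trivial:
  fixes p :: "'k::alg_closed_field poly"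
  assumes rel: "(\<Sum>j\<le>m. p ^ j * r ^ (m - j) * u j) = 0" and cop: "no_common_root p r" "p \<noteq> 0"
    and deg: "\<And>j. j \<le> m \<Longrightarrow> u j \<noteq> 0 \<Longrightarrow> degree (u j) < degree p"
  shows "j \<le> m \<Longrightarrow> u j = 0"
proof (induction j rule: less_induct)
  case (less J)
  define G where "G j = p ^ j * r ^ (m - j) * u j" for j
  define W where "W = (\<Sum>j\<in>{J<..m}. p ^ (j - J - 1) * r ^ (m - j) * u j)"
  have "{..m} = {..<J} \<union> insert J {J<..m}" using less.prems by auto
  then have "sum G {..m} = sum G {..<J} + (G J + sum G {J<..m})"
    using sum.union_disjoint[of "{..<J}" "{J<..m}" G] 
    by (simp add: disjoint_iff add.left_commute)
  also have "sum G {..<J} = 0"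
  proof (rule sum.neutral, rule ballI)
    fix j assume "j \<in> {..<J}"
    then have "u j = 0" using less.IH[of j] less.prems by simp
    then show "G j = 0" by (simp add: G_def)
  qed
  also have "sum G {J<..m} = p ^ J * (p * W)"
    unfolding W_def sum_distrib_left
  proof (intro sum.cong refl)
    fix j assume "j \<in> {J<..m}"
    then have "p ^ j = p ^ (J + Suc (j - J - 1))" by simp
    also have "\<dots> = p ^ J * (p * p ^ (j - J - 1))" by (simp only: power_add power_Suc)
    finally show "G j = p ^ J * (p * (p ^ (j - J - 1) * r ^ (m - j) * u j))"
      by (simp only: G_def mult.assoc)
  qed
  finally have "sum G {..m} = G J + p ^ J * (p * W)" by simp
  also have "G J = p ^ J * (r ^ (m - J) * u J)" by (simp only: G_def mult.assoc)
  also have "\<dots> + p ^ J * (p * W) = p ^ J * (r ^ (m - J) * u J + p * W)" by (simp only: distrib_left)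
  finally have "p ^ J * (r ^ (m - J) * u J + p * W) = 0" using rel by (simp only: G_def)
  then have "r ^ (m - J) * u J + p * W = 0"
    using cop(2) by simp
  then have "u J * r ^ (m - J) = p * (- W)"
    by (simp add: eq_neg_iff_add_eq_0 mult.commute)
  then have "p dvd u J * r ^ (m - J)" by (simp only: dvd_triv_left)
  then have "p dvd u J" by (rule dvd_mult_power_no_common_root[OF cop(1) _ cop(2)])
  then show ?case using deg[OF less.prems] dvd_imp_degree_le[of p "u J"] by fastforce
qed

text \<open>Sorted by powers of \<open>p / r\<close> instead of powers of the variable, a relation
  has coefficients \<open>u j\<close> of degree below \<open>N\<close>, and
  \<open>homogeneous_relation_trivial\<close> applies. The result says that the degree of
  \<open>k(s)\<close> over \<open>k(p / r)\<close> is at least \<open>N\<close>.\<close>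

lemma powers_independent_over_subfield:
  fixes p r :: "'k::alg_closed_field poly" and C :: "nat \<Rightarrow> 'k poly"
  assumes cop: "no_common_root p r" "r \<noteq> 0" and N: "N = max (degree p) (degree r)"
    and rel: "(\<Sum>i<N. poly (map_poly fconst (C i)) (to_fract p / to_fract r) * to_fract [:0, 1:] ^ i) = 0"
    and i: "i < N"
  shows "C i = 0"
proof -
  interpret T: type_ring_hom "to_fract :: 'k poly \<Rightarrow> _" by standard auto
  define m where "m = Max ((\<lambda>i. degree (C i)) ` {..<N})"
  have m: "degree (C i) \<le> m" if "i < N" for i unfolding m_def using that by (intro Max_ge) auto
  define u where "u j = (\<Sum>i<N. monom (coeff (C i) j) i)" for j
  have coeff_u: "coeff (u j) i = coeff (C i) j" if "i < N" for i j
    using that by (simp add: u_def coeff_sum)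
  have deg_u: "degree (u j) < N" for j unfolding u_def using i
    by (intro degree_sum_less) (auto intro: le_less_trans[OF degree_monom_le])
  have to_u: "to_fract (u j) = (\<Sum>i<N. fconst (coeff (C i) j) * to_fract [:0, 1:] ^ i)" for j
    unfolding u_def to_fract_sum
  proof (intro sum.cong refl)
    fix i
    have "monom (coeff (C i) j) i = [:coeff (C i) j:] * [:0, 1:] ^ i" by (simp add: monom_altdef)
    then show "to_fract (monom (coeff (C i) j) i) = fconst (coeff (C i) j) * to_fract [:0, 1:] ^ i"
      unfolding fconst_def by (simp only: T.hom_mult T.hom_power)
  qed
  let ?f = "to_fract p / to_fract r"
  have r: "to_fract r \<noteq> 0" using cop by simp
  have "to_fract (\<Sum>j\<le>m. p ^ j * r ^ (m - j) * u j) =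
      (\<Sum>j\<le>m. to_fract r ^ m * ?f ^ j * (\<Sum>i<N. fconst (coeff (C i) j) * to_fract [:0, 1:] ^ i))"
    unfolding to_fract_sum T.hom_mult T.hom_power to_u
    using r by (intro sum.cong refl) (simp add: power_diff power_divide)
  also have "\<dots> = (\<Sum>i<N. \<Sum>j\<le>m. to_fract r ^ m * (fconst (coeff (C i) j) * ?f ^ j * to_fract [:0, 1:] ^ i))"
    unfolding sum_distrib_left by (subst sum.swap) (simp only: mult_ac)
  also have "\<dots> = to_fract r ^ m * (\<Sum>i<N. poly (map_poly fconst (C i)) ?f * to_fract [:0, 1:] ^ i)"
    unfolding sum_distrib_left
  proof (intro sum.cong refl)
    fix i assume "i \<in> {..<N}"
    then have "poly (map_poly fconst (C i)) ?f = (\<Sum>j\<le>m. fconst (coeff (C i) j) * ?f ^ j)"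
      using m[of i] by (subst poly_eq_sum_le[of _ m]) (auto simp: fconst.coeff_map_poly_hom)
    then show "(\<Sum>j\<le>m. to_fract r ^ m * (fconst (coeff (C i) j) * ?f ^ j * to_fract [:0, 1:] ^ i)) =
        to_fract r ^ m * (poly (map_poly fconst (C i)) ?f * to_fract [:0, 1:] ^ i)"
      by (simp only: sum_distrib_left sum_distrib_right)
  qed
  also note rel
  finally have "to_fract (\<Sum>j\<le>m. p ^ j * r ^ (m - j) * u j) = to_fract 0" by simp
  then have rel1: "(\<Sum>j\<le>m. p ^ j * r ^ (m - j) * u j) = 0" unfolding to_fract_eq_iff .
  have "u j = 0" if "j \<le> m" for j
  proof (cases "degree p = N")
    case True
    then have "p \<noteq> 0" using i by auto
    then show ?thesis using homogeneous_relation_trivial[OF rel1 cop(1)] True deg_u that by blast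
  next
    case False
    then have N': "degree r = N" using N by (auto simp: max_def split: if_splits)
    \<comment> \<open>Now \<open>r\<close> is the one of degree \<open>N\<close>; reversing the
      order of summation exchanges \<open>p\<close> and \<open>r\<close>.\<close>
    have "(\<Sum>j\<le>m. r ^ j * p ^ (m - j) * u (m - j)) = (\<Sum>j\<le>m. p ^ j * r ^ (m - j) * u j)"
      by (rule sum.reindex_bij_witness[where i = "\<lambda>j. m - j" and j = "\<lambda>j. m - j"]) (auto simp: mult_ac)
    then have rel2: "(\<Sum>j\<le>m. r ^ j * p ^ (m - j) * u (m - j)) = 0" using rel1 by simp
    have "no_common_root r p" using cop(1) by (auto simp: no_common_root_def)
    then have "u (m - (m - j)) = 0"
      using homogeneous_relation_trivial[OF rel2 _ cop(2), of "m - j"] deg_u N' by simp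
    then show ?thesis using that by simp
  qed
  then have "coeff (C i) j = 0" for j
    using coeff_u[OF i, of j] m[OF i] by (cases "j \<le> m") (auto simp: coeff_eq_0)
  then show ?thesis by (simp add: poly_eq_iff)
qed


text \<open>Comparing both sides of \<open>k(s) = k(f)(g)\<close>: on the left the degree over \<open>k(f)\<close> is at least the
  degree of \<open>f\<close>, on the right it is at most the degree in \<open>y\<close> of the curve.\<close>
lemma parametrization_degree_le:
  fixes \<phi> :: "'k::alg_closed_field poly poly \<Rightarrow> 'k poly fract"
  assumes h: "type_ring_hom \<phi>" and const: "\<And>c. \<phi> (kconst c) = fconst c"
    and P: "\<phi> P = 0" "degree P = d" "d > 0"
    and gen: "\<phi> b \<noteq> 0" "to_fract [:0, 1:] = \<phi> a / \<phi> b"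
    and f: "\<phi> [:[:0, 1:]:] = to_fract p / to_fract r" "no_common_root p r" "r \<noteq> 0"
  shows "max (degree p) (degree r) \<le> d"
proof (rule ccontr)
  interpret h: type_ring_hom \<phi> by fact
  define N where "N = max (degree p) (degree r)"
  define f where "f = \<phi> [:[:0, 1:]:]"
  define g where "g = \<phi> [:0, 1:]"
  interpret cp: type_ring_hom "\<lambda>q. poly (map_poly fconst q) f" by (rule fconst.type_ring_hom_poly)
  assume "\<not> max (degree p) (degree r) \<le> d"
  then have dN: "d < N" unfolding N_def by linarith
  have \<phi>_const: "\<phi> [:q:] = poly (map_poly fconst q) f" for q
    using hom_eq_eval2[OF h, of "[:q:]"] eval2_const[OF fconst.type_ring_hom_axioms]
    by (simp add: const f_def)
  define l where "l = lead_coeff P"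
  have l: "l \<noteq> 0" using P by (auto simp: l_def)
  \<comment> \<open>Pseudo-division by \<open>P\<close>: up to a power of its leading coefficient, a
    polynomial in \<open>x\<close>, every element is represented with degree below \<open>d\<close>
    in \<open>y\<close>.\<close>
  have "\<exists>M R. degree R < d \<and> poly (map_poly fconst (l ^ M)) f * \<phi> G = \<phi> R" for G
  proof -
    obtain q R where qR: "pseudo_divmod G P = (q, R)" by (cases "pseudo_divmod G P")
    define M where "M = Suc (degree G) - degree P"
    have P0: "P \<noteq> 0" using P by auto
    have "smult (l ^ M) G = P * q + R" "R = 0 \<or> degree R < degree P"
      using pseudo_divmod[OF P0 qR] by (simp_all add: l_def M_def)
    then have "[:l ^ M:] * G = P * q + R" "degree R < d" using P by auto
    then have "\<phi> [:l ^ M:] * \<phi> G = \<phi> R" using P(1) by (metis h.hom_add h.hom_mult mult_zero_left add_0)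
    then show ?thesis using \<open>degree R < d\<close> unfolding \<phi>_const by blast
  qed
  then obtain M R where MR: "\<And>G. degree (R G) < d" "\<And>G. poly (map_poly fconst (l ^ M G)) f * \<phi> G = \<phi> (R G)"
    by metis
  \<comment> \<open>\<open>\<phi> (G i)\<close> is the power \<open>to_fract [:0, 1:] ^ i\<close> up
    to the common factor \<open>\<phi> b ^ N\<close>. The \<open>N\<close> reduced representatives
    have only \<open>d\<close> coefficients each, hence are dependent over \<open>k[x]\<close>,
    against the independence of the powers.\<close>
  define G where "G i = a ^ i * b ^ (N - i)" for i
  have "card {..<d} < card {..<N}" using dN by simp
  then obtain c where c: "\<exists>i\<in>{..<N}. c i \<noteq> 0" 
    "\<forall>j\<in>{..<d}. (\<Sum>i\<in>{..<N}. coeff (R (G i)) j * c i) = 0"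
    using homogeneous_system_nontrivial[of "{..<d}" "{..<N}" "\<lambda>j i. coeff (R (G i)) j"] by auto
  define C where "C i = c i * l ^ M (G i)" for i
  have s: "\<phi> (G i) = \<phi> b ^ N * to_fract [:0, 1:] ^ i" if "i < N" for i
    using gen(1) that unfolding gen(2) G_def h.hom_mult h.hom_power
    by (simp add: power_diff power_divide)
  have "\<phi> b ^ N * (\<Sum>i<N. poly (map_poly fconst (C i)) f * to_fract [:0, 1:] ^ i) =
      (\<Sum>i<N. poly (map_poly fconst (c i)) f * (poly (map_poly fconst (l ^ M (G i))) f * \<phi> (G i)))"
    unfolding sum_distrib_left C_def cp.hom_mult by (intro sum.cong refl) (simp add: s mult_ac)
  also have "\<dots> = (\<Sum>i<N. \<phi> [:c i:] * \<phi> (R (G i)))"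
    unfolding MR(2) \<phi>_const ..
  also have "\<dots> = \<phi> (\<Sum>i<N. [:c i:] * R (G i))" by (simp only: h.hom_sum h.hom_mult)
  also have "(\<Sum>i<N. [:c i:] * R (G i)) = 0"
  proof (rule poly_eqI)
    fix j
    show "coeff (\<Sum>i<N. [:c i:] * R (G i)) j = coeff 0 j"
    proof (cases "j < d")
      case True
      then show ?thesis using c(2) by (simp add: coeff_sum mult.commute)
    next
      case False
      then have "coeff (R (G i)) j = 0" for i using MR(1)[of "G i"] by (intro coeff_eq_0) simp
      then show ?thesis by (simp add: coeff_sum)
    qed
  qed
  finally have "(\<Sum>i<N. poly (map_poly fconst (C i)) f * to_fract [:0, 1:] ^ i) = 0"
    using gen(1) by (simp add: h.hom_0)
  then have "C i = 0" if "i < N" for i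
    using powers_independent_over_subfield[OF f(2,3) N_def _ that, of C] f(1) by (simp add: f_def)
  then show False using c(1) l by (auto simp: C_def)
qed

text \<open>If \<open>u\<close> or \<open>v\<close> had larger degree than all nonzero
  \<open>H j\<close>, then \<open>homogeneous_relation_trivial\<close> would force every
  \<open>H j\<close> to vanish, including \<open>H d\<close>.\<close>

lemma rational_root_bound:
  fixes u v :: "'k::alg_closed_field poly" and H :: "nat \<Rightarrow> 'k poly"
  assumes rel: "(\<Sum>j\<le>d. u ^ j * v ^ (d - j) * H j) = 0" and uv: "no_common_root u v" "v \<noteq> 0"
    and H: "H d \<noteq> 0" "\<And>j. j \<le> d \<Longrightarrow> degree (H j) \<le> m"
  shows "degree u \<le> m" "degree v \<le> m"
proof -
  have "no_common_root v u" using uv(1) by (auto simp: no_common_root_def)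
  have "\<exists>j\<le>d. H j \<noteq> 0 \<and> degree u \<le> degree (H j)"
  proof (cases "u = 0")
    case False
    show ?thesis
    proof (rule ccontr)
      assume "\<not> (\<exists>j\<le>d. H j \<noteq> 0 \<and> degree u \<le> degree (H j))"
      then show False
        using homogeneous_relation_trivial[OF rel uv(1) False, of d] H(1) by fastforce
    qed
  qed (use H in auto)
  then show "degree u \<le> m" using H(2) order.trans by blast
  have rel': "(\<Sum>j\<le>d. v ^ j * u ^ (d - j) * H (d - j)) = 0"
  proof -
    have "(\<Sum>j\<le>d. v ^ j * u ^ (d - j) * H (d - j)) = (\<Sum>j\<le>d. u ^ j * v ^ (d - j) * H j)"
      by (rule sum.reindex_bij_witness[where i = "\<lambda>j. d - j" and j = "\<lambda>j. d - j"]) (auto simp: mult_ac)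
    then show ?thesis using rel by simp
  qed
  have "\<exists>j\<le>d. H (d - j) \<noteq> 0 \<and> degree v \<le> degree (H (d - j))"
  proof (rule ccontr)
    assume "\<not> (\<exists>j\<le>d. H (d - j) \<noteq> 0 \<and> degree v \<le> degree (H (d - j)))"
    then show False
      using homogeneous_relation_trivial[OF rel' \<open>no_common_root v u\<close> uv(2), of 0] H(1) by fastforce
  qed
  then show "degree v \<le> m" using H(2)[OF diff_le_self] order.trans by blast
qed

text \<open>The \<open>x\<close>-coordinate has degree at most \<open>d\<close> by
  \<open>parametrization_degree_le\<close>. The \<open>y\<close>-coordinate is then a root of a
  polynomial whose coefficients have degree at most \<open>d * e\<close>; \<open>d * Suc e\<close>
  covers both, independently of \<open>c\<close>. That some minor of the coefficients of
  \<open>p\<close> and \<open>r\<close> is nonzero expresses, as a condition on coefficients, that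
  \<open>p / r\<close> is not constant.\<close>

theorem bounded_parametrization:
  fixes F :: "'k::alg_closed_field poly poly"
  assumes irr: "irreducible (F - kconst c)" and rat: "frac_quotient_is_rational (F - kconst c)"
    and d: "degree F = d" "d > 0" and e: "\<And>j. degree (coeff F j) \<le> e"
  shows "\<exists>p r u v :: 'k poly. degree p \<le> d * Suc e \<and> degree r \<le> d * Suc e \<and>
    degree u \<le> d * Suc e \<and> degree v \<le> d * Suc e \<and> v \<noteq> 0 \<and>
    (\<exists>i j. coeff p i * coeff r j \<noteq> coeff p j * coeff r i) \<and>
    (\<Sum>j\<le>d. \<Sum>i\<le>e. [:coeff (coeff F j) i:] * (p ^ i * r ^ (e - i) * u ^ j * v ^ (d - j))) =
      [:c:] * (r ^ e * v ^ d)"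
proof -
  define P where "P = F - kconst c"
  from rat obtain \<phi> :: "'k poly poly \<Rightarrow> 'k poly fract" where
    \<phi>: "\<forall>a b. \<phi> (a + b) = \<phi> a + \<phi> b" "\<forall>a b. \<phi> (a * b) = \<phi> a * \<phi> b" "\<phi> 1 = 1"
      "\<forall>c. \<phi> (kconst c) = to_fract [:c:]" "\<forall>a. \<phi> a = 0 \<longleftrightarrow> P dvd a"
      "\<forall>z. \<exists>a b. \<phi> b \<noteq> 0 \<and> z = \<phi> a / \<phi> b"
    unfolding frac_quotient_is_rational_def P_def by (elim exE conjE)
  interpret h: type_ring_hom \<phi> using \<phi> by unfold_locales auto
  interpret T: type_ring_hom "to_fract :: 'k poly \<Rightarrow> _" by standard auto
  note h = h.type_ring_hom_axioms
  have const: "\<phi> (kconst c) = fconst c" for c using \<phi>(4) by (simp add: fconst_def)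
  have P0: "\<phi> P = 0" using \<phi>(5) by simp
  have coeffP: "coeff P j = (if j = 0 then coeff F 0 - [:c:] else coeff F j)" for j
    by (simp add: P_def kconst_def coeff_pCons split: nat.split)
  have degP: "degree P = d"
  proof (rule antisym)
    show "degree P \<le> d" using d coeffP by (intro degree_le) (auto simp: coeff_eq_0)
    show "d \<le> degree P" using d coeffP by (intro le_degree) auto
  qed
  have eP: "degree (coeff P j) \<le> e" for j
    using e[of 0] e[of j] by (auto simp: coeffP intro!: degree_diff_le)
  define f where "f = \<phi> [:[:0, 1:]:]"
  define g where "g = \<phi> [:0, 1:]"
  have \<phi>_eval: "\<phi> G = eval2 fconst f g G" for G
    using hom_eq_eval2[OF h, of G] by (simp add: const f_def g_def)
  obtain a b where ab: "\<phi> b \<noteq> 0" "to_fract [:0, 1:] = \<phi> a / \<phi> b" using \<phi>(6) by blast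
  \<comment> \<open>If \<open>x\<close> were a constant on the curve, either \<open>x\<close> minus
    that constant would divide \<open>P\<close>, against irreducibility and \<open>d > 0\<close>, or
    \<open>y\<close> would be algebraic over the constants, and then the image could not generate
    \<open>k(t)\<close>.\<close>
  have fnc: "f \<notin> range fconst"
  proof
    assume "f \<in> range fconst"
    then obtain x where x: "f = fconst x" by blast
    define Q where "Q = map_poly (\<lambda>q. poly q x) P"
    interpret ex: type_ring_hom "\<lambda>q :: 'k poly. poly q x" by standard auto
    have ev: "\<phi> G = poly (map_poly fconst (map_poly (\<lambda>q. poly q x) G)) g" for G
    proof -
      have "map_poly (\<lambda>q. poly (map_poly fconst q) f) G = map_poly fconst (map_poly (\<lambda>q. poly q x) G)"
        unfolding x by (simp add: poly_eq_iff coeff_map_poly fconst.coeff_map_poly_hom fconst.poly_map_poly_hom fconst.hom_0)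
      then show ?thesis by (simp add: \<phi>_eval eval2_def)
    qed
    show False
    proof (cases "Q = 0")
      case True
      then have "poly (coeff P j) x = 0" for j
        by (metis Q_def ex.coeff_map_poly_hom coeff_0)
      then have "[:-x, 1:] dvd coeff P j" for j by (simp add: poly_eq_0_iff_dvd)
      then have "[:[:-x, 1:]:] dvd P" by (simp add: const_poly_dvd_iff)
      then obtain S where S: "P = [:[:-x, 1:]:] * S" by (elim dvdE)
      have "is_unit [:[:-x, 1:]:] \<or> is_unit S"
        using irreducibleD[OF irr[folded P_def] S] .
      moreover have "\<not> is_unit [:[:-x, 1:]:]" by (simp add: is_unit_const_poly_iff is_unit_iff_degree)
      ultimately have "degree S = 0" by (auto simp: is_unit_poly_iff)
      then have "degree P = 0" unfolding S by (auto elim!: degree_eq_zeroE)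
      then show False using degP d by simp
    next
      case False
      then have "g \<in> range fconst" using algebraic_over_constants[of Q g] ev[of P] P0 Q_def by simp
      then obtain y where y: "g = fconst y" by blast
      have "\<phi> G \<in> range fconst" for G unfolding ev y fconst.poly_map_poly_hom by simp
      then obtain a' b' where "\<phi> a = fconst a'" "\<phi> b = fconst b'" by blast
      then have "to_fract [:0, 1:] = fconst (a' / b')" using ab by (simp add: fconst.hom_divide)
      then have "[:0, 1:] = [:a' / b':]" unfolding fconst_def to_fract_eq_iff .
      then show False by simp
    qed
  qed
  obtain p r where pr: "r \<noteq> 0" "f = to_fract p / to_fract r" "no_common_root p r"
    using fract_no_common_root .
  obtain u v where uv: "v \<noteq> 0" "g = to_fract u / to_fract v" "no_common_root u v"
    using fract_no_common_root .
  have N: "max (degree p) (degree r) \<le> d"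
    by (rule parametrization_degree_le[OF h const P0 degP d(2) ab pr(2)[unfolded f_def] pr(3,1)])
  define H where "H j = (\<Sum>i\<le>e. [:coeff (coeff P j) i:] * (p ^ i * r ^ (e - i)))" for j
  have sum_eq: "to_fract (\<Sum>j\<le>d. \<Sum>i\<le>e. [:coeff (coeff G j) i:] * (p ^ i * r ^ (e - i) * u ^ j * v ^ (d - j))) =
      to_fract r ^ e * to_fract v ^ d * \<phi> G"
    if "degree G \<le> d" "\<And>j. degree (coeff G j) \<le> e" for G
  proof -
    have "to_fract r \<noteq> 0" "to_fract v \<noteq> 0" using pr uv by auto
    from eval2_bihomogeneous[OF fconst.type_ring_hom_axioms this that, of "to_fract p" "to_fract u"]
    show ?thesis unfolding \<phi>_eval pr(2)[symmetric] uv(2)[symmetric]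
      unfolding fconst_def to_fract_sum T.hom_mult T.hom_power .
  qed
  have rel: "(\<Sum>j\<le>d. u ^ j * v ^ (d - j) * H j) = 0"
  proof -
    have "(\<Sum>j\<le>d. u ^ j * v ^ (d - j) * H j) =
        (\<Sum>j\<le>d. \<Sum>i\<le>e. [:coeff (coeff P j) i:] * (p ^ i * r ^ (e - i) * u ^ j * v ^ (d - j)))"
      unfolding H_def sum_distrib_left by (intro sum.cong refl) (simp only: mult_ac)
    also have "to_fract \<dots> = to_fract 0" using sum_eq[of P] degP eP P0 by simp
    then have "(\<Sum>j\<le>d. \<Sum>i\<le>e. [:coeff (coeff P j) i:] * (p ^ i * r ^ (e - i) * u ^ j * v ^ (d - j))) = 0"
      unfolding to_fract_eq_iff .
    finally show ?thesis .
  qed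
  \<comment> \<open>Up to the factor \<open>r ^ e\<close>, this is the leading coefficient of
    \<open>P\<close> in \<open>y\<close> evaluated at \<open>f\<close>, and \<open>f\<close> is
    transcendental over the constants.\<close>
  have "H d \<noteq> 0"
  proof
    assume H: "H d = 0"
    define l where "l = coeff P d"
    have l: "l \<noteq> 0" using degP d by (auto simp: l_def)
    have rnz: "to_fract r \<noteq> 0" using pr by simp
    have "eval2 fconst (to_fract p / to_fract r) (1 / 1) [:l:] * to_fract r ^ e =
        (\<Sum>i\<le>e. fconst (coeff l i) * (to_fract p ^ i * to_fract r ^ (e - i)))"
      using eval2_bihomogeneous[OF fconst.type_ring_hom_axioms rnz, of 1 "[:l:]" 0 e "to_fract p" 1] eP[of d]
      by (simp add: l_def coeff_pCons split: nat.split)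
    also have "\<dots> = to_fract (H d)"
      unfolding H_def l_def fconst_def to_fract_sum T.hom_mult T.hom_power ..
    finally have "poly (map_poly fconst l) f = 0"
      using rnz H by (simp add: eval2_const[OF fconst.type_ring_hom_axioms] pr(2))
    then show False using algebraic_over_constants[OF l] fnc by blast
  qed
  moreover have "degree (H j) \<le> d * e" for j
    unfolding H_def
  proof (intro degree_sum_le)
    fix i assume "i \<in> {..e}"
    have "degree (p ^ i * r ^ (e - i)) \<le> degree p * i + degree r * (e - i)"
      by (intro order.trans[OF degree_mult_le] add_mono degree_power_le)
    also have "\<dots> \<le> d * i + d * (e - i)" using N by (intro add_mono mult_right_mono) auto
    also have "\<dots> = d * e" using \<open>i \<in> {..e}\<close> by (simp flip: distrib_left)
    finally show "degree ([:coeff (coeff P j) i:] * (p ^ i * r ^ (e - i))) \<le> d * e"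
      using degree_smult_le order.trans by fastforce
  qed simp
  ultimately have "degree u \<le> d * e" "degree v \<le> d * e"
    using rational_root_bound[OF rel uv(3,1)] by blast+
  moreover have "\<exists>i j. coeff p i * coeff r j \<noteq> coeff p j * coeff r i"
  proof (rule ccontr)
    assume "\<nexists>i j. coeff p i * coeff r j \<noteq> coeff p j * coeff r i"
    then have *: "coeff p i * lead_coeff r = lead_coeff r * 0 + coeff p (degree r) * coeff r i" for i by simp
    have "p = smult (coeff p (degree r) / lead_coeff r) r"
      using * pr(1) by (simp add: poly_eq_iff field_simps)
    then have "to_fract p = fconst (coeff p (degree r) / lead_coeff r) * to_fract r"
      unfolding fconst_def by (metis T.hom_mult mult_smult_left smult_1_left mult_1 smult_conv_map_poly mult_pCons_left add.right_neutral pCons_0_0 mult_zero_left)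
    then have "f = fconst (coeff p (degree r) / lead_coeff r)" using pr by simp
    then show False using fnc by blast
  qed
  moreover have "(\<Sum>j\<le>d. \<Sum>i\<le>e. [:coeff (coeff F j) i:] * (p ^ i * r ^ (e - i) * u ^ j * v ^ (d - j))) =
      [:c:] * (r ^ e * v ^ d)"
  proof -
    have "\<phi> F = fconst c" using P0 const by (simp add: P_def h.hom_diff)
    then have "to_fract (\<Sum>j\<le>d. \<Sum>i\<le>e. [:coeff (coeff F j) i:] * (p ^ i * r ^ (e - i) * u ^ j * v ^ (d - j))) =
        to_fract ([:c:] * (r ^ e * v ^ d))"
      using sum_eq[of F] d e unfolding fconst_def T.hom_mult T.hom_power by (simp add: mult_ac)
    then show ?thesis unfolding to_fract_eq_iff .
  qed
  ultimately show ?thesis using N uv(1) by (intro exI[of _ p] exI[of _ r] exI[of _ u] exI[of _ v]) auto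
qed

section \<open>Specialization\<close>

definition is_prime_ideal :: "'r::comm_ring_1 set \<Rightarrow> bool" where
  "is_prime_ideal N \<longleftrightarrow> 0 \<in> N \<and> 1 \<notin> N \<and> (\<forall>x\<in>N. \<forall>y\<in>N. x + y \<in> N) \<and>
     (\<forall>x\<in>N. \<forall>a. a * x \<in> N) \<and> (\<forall>a b. a * b \<in> N \<longrightarrow> a \<in> N \<or> b \<in> N)"

theorem prime_ideal_exists:
  fixes I :: "'r::comm_ring_1 set"
  assumes I: "0 \<in> I" "1 \<notin> I" "\<And>x y. x \<in> I \<Longrightarrow> y \<in> I \<Longrightarrow> x + y \<in> I" "\<And>a x. x \<in> I \<Longrightarrow> a * x \<in> I"
  shows "\<exists>N. is_prime_ideal N \<and> I \<subseteq> N"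
proof -
  define \<A> where "\<A> = {J. I \<subseteq> J \<and> 1 \<notin> J \<and> (\<forall>x\<in>J. \<forall>y\<in>J. x + y \<in> J) \<and> (\<forall>x\<in>J. \<forall>a. a * x \<in> J)}"
  have "\<Union>C \<in> \<A>" if ne: "C \<noteq> {}" and ch: "subset.chain \<A> C" for C
  proof -
    have c: "\<And>X Y. X \<in> C \<Longrightarrow> Y \<in> C \<Longrightarrow> X \<subseteq> Y \<or> Y \<subseteq> X" and sub: "\<And>X. X \<in> C \<Longrightarrow> X \<in> \<A>"
      using ch unfolding subset.chain_def by auto
    have "x + y \<in> \<Union>C" if xy: "x \<in> \<Union>C" "y \<in> \<Union>C" for x y
    proof -
      obtain X where "X \<in> C" "x \<in> X" "y \<in> X" using xy c by blast
      then show ?thesis using sub[of X] by (auto simp: \<A>_def)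
    qed
    moreover have "a * x \<in> \<Union>C" if "x \<in> \<Union>C" for a x
      using that sub unfolding \<A>_def by blast
    moreover have "1 \<notin> \<Union>C" "I \<subseteq> \<Union>C" using sub ne unfolding \<A>_def by blast+
    ultimately show ?thesis unfolding \<A>_def by blast
  qed
  moreover have "I \<in> \<A>" using I by (auto simp: \<A>_def)
  ultimately obtain N where "N \<in> \<A>" and max: "\<And>X. X \<in> \<A> \<Longrightarrow> N \<subseteq> X \<Longrightarrow> X = N"
    using subset_Zorn_nonempty[of \<A>] by (metis empty_iff)
  then have N: "I \<subseteq> N" "1 \<notin> N" "\<And>x y. x \<in> N \<Longrightarrow> y \<in> N \<Longrightarrow> x + y \<in> N" "\<And>a x. x \<in> N \<Longrightarrow> a * x \<in> N"
    by (auto simp: \<A>_def)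
  have "b \<in> N" if ab: "a * b \<in> N" and a: "a \<notin> N" for a b
  proof -
    define X where "X = {n + r * a | n r. n \<in> N}"
    have NX: "N \<subseteq> X"
    proof
      fix n assume "n \<in> N"
      then show "n \<in> X" unfolding X_def by (intro CollectI exI[of _ n] exI[of _ 0]) simp
    qed
    have "0 \<in> N" using N(1) I(1) by blast
    then have "a \<in> X" unfolding X_def by (intro CollectI exI[of _ 0] exI[of _ 1]) simp
    then have "X \<noteq> N" using a by blast
    then have "X \<notin> \<A>" using max NX by blast
    moreover have "I \<subseteq> X" using NX N(1) by blast
    moreover have "x + y \<in> X" if "x \<in> X" "y \<in> X" for x y
    proof -
      obtain n r n' r' where "n \<in> N" "x = n + r * a" "n' \<in> N" "y = n' + r' * a"
        using \<open>x \<in> X\<close> \<open>y \<in> X\<close> unfolding X_def by blast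
      then show ?thesis unfolding X_def
        by (intro CollectI exI[of _ "n + n'"] exI[of _ "r + r'"]) (simp add: N(3) algebra_simps)
    qed
    moreover have "c * x \<in> X" if "x \<in> X" for c x
    proof -
      obtain n r where "n \<in> N" "x = n + r * a" using \<open>x \<in> X\<close> unfolding X_def by blast
      then show ?thesis unfolding X_def
        by (intro CollectI exI[of _ "c * n"] exI[of _ "c * r"]) (simp add: N(4) algebra_simps)
    qed
    ultimately have "1 \<in> X" unfolding \<A>_def by blast
    then obtain n r where nr: "n \<in> N" "1 = n + r * a" unfolding X_def by blast
    have "b = b * (n + r * a)" by (simp flip: nr(2))
    also have "\<dots> = b * n + r * (a * b)" by (simp add: algebra_simps)
    finally show ?thesis using N(3)[OF N(4)[OF nr(1)] N(4)[OF ab]] by metis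
  qed
  then have "is_prime_ideal N" using N I(1) unfolding is_prime_ideal_def by blast
  then show ?thesis using N(1) by blast
qed

text \<open>A homomorphism on \<open>A\<close> with arbitrary values elsewhere; the conditions at 0
  and 1 make it usable with \<open>map_poly\<close>.\<close>

definition partial_hom :: "'r::comm_ring_1 set \<Rightarrow> ('r \<Rightarrow> 's::comm_ring_1) \<Rightarrow> bool" where
  "partial_hom A h \<longleftrightarrow> h 0 = 0 \<and> h 1 = 1 \<and> (\<forall>x\<in>A. \<forall>y\<in>A. h (x + y) = h x + h y \<and> h (x * y) = h x * h y)"

context
  fixes A :: "'r::comm_ring_1 set" and h :: "'r \<Rightarrow> 's::comm_ring_1"
  assumes A: "is_subring A" and h: "partial_hom A h"
begin

lemma partial_hom_0: "h 0 = 0" and partial_hom_1: "h 1 = 1"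
  and partial_hom_add: "x \<in> A \<Longrightarrow> y \<in> A \<Longrightarrow> h (x + y) = h x + h y"
  and partial_hom_mult: "x \<in> A \<Longrightarrow> y \<in> A \<Longrightarrow> h (x * y) = h x * h y"
  using h by (auto simp: partial_hom_def)

lemma partial_hom_diff: "x \<in> A \<Longrightarrow> y \<in> A \<Longrightarrow> h (x - y) = h x - h y"
  using partial_hom_add[OF is_subring_diff[OF A, of x y], of y] by simp

lemma partial_hom_sum: "(\<And>i. i \<in> I \<Longrightarrow> f i \<in> A) \<Longrightarrow> h (sum f I) = (\<Sum>i\<in>I. h (f i))"
  by (induction I rule: infinite_finite_induct)
    (auto simp: partial_hom_0 partial_hom_add is_subring_sum[OF A])

lemma partial_hom_power: "x \<in> A \<Longrightarrow> h (x ^ n) = h x ^ n"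
  by (induction n) (auto simp: partial_hom_1 partial_hom_mult is_subring_power[OF A])

lemma coeff_map_poly_partial: "coeff (map_poly h p) i = h (coeff p i)"
  by (simp add: coeff_map_poly partial_hom_0)

lemma partial_hom_map_poly: "partial_hom (polys_over A) (map_poly h)"
  unfolding partial_hom_def
proof (intro conjI ballI)
  show "map_poly h 0 = 0" "map_poly h 1 = 1" by (simp_all add: partial_hom_1)
  fix p q assume pq: "p \<in> polys_over A" "q \<in> polys_over A"
  show "map_poly h (p + q) = map_poly h p + map_poly h q"
    using pq by (auto simp: poly_eq_iff coeff_map_poly_partial polys_overD partial_hom_add)
  show "map_poly h (p * q) = map_poly h p * map_poly h q"
  proof (rule poly_eqI)
    fix n
    have "coeff (map_poly h (p * q)) n = h (\<Sum>i\<le>n. coeff p i * coeff q (n - i))"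
      by (simp add: coeff_map_poly_partial coeff_mult)
    also have "\<dots> = (\<Sum>i\<le>n. h (coeff p i * coeff q (n - i)))"
      by (rule partial_hom_sum) (use pq in \<open>auto intro: is_subring_mult[OF A] polys_overD\<close>)
    also have "\<dots> = (\<Sum>i\<le>n. h (coeff p i) * h (coeff q (n - i)))"
      using pq by (intro sum.cong refl partial_hom_mult polys_overD)
    also have "\<dots> = coeff (map_poly h p * map_poly h q) n"
      by (simp add: coeff_mult coeff_map_poly_partial)
    finally show "coeff (map_poly h (p * q)) n = coeff (map_poly h p * map_poly h q) n" .
  qed
qed

lemma partial_hom_extend:
  assumes K: "\<And>p. p \<in> polys_over A \<Longrightarrow> poly p z \<in> N \<Longrightarrow> poly (map_poly h p) \<xi> = 0" and N: "0 \<in> N"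
  shows "\<exists>h'. partial_hom (adjoin A z) h' \<and> (\<forall>p\<in>polys_over A. h' (poly p z) = poly (map_poly h p) \<xi>)"
proof -
  note S = is_subring_polys_over[OF A]
  have M: "partial_hom (polys_over A) (map_poly h)" by (rule partial_hom_map_poly)
  have wd: "poly (map_poly h p) \<xi> = poly (map_poly h q) \<xi>"
    if pq: "p \<in> polys_over A" "q \<in> polys_over A" "poly p z = poly q z" for p q
  proof -
    have "map_poly h p = map_poly h ((p - q) + q)" by simp
    also have "\<dots> = map_poly h (p - q) + map_poly h q"
      using M is_subring_diff[OF S pq(1,2)] pq(2) unfolding partial_hom_def by blast
    finally have "poly (map_poly h p) \<xi> = poly (map_poly h (p - q)) \<xi> + poly (map_poly h q) \<xi>"
      by simp
    then show ?thesis using K[OF is_subring_diff[OF S pq(1,2)]] pq(3) N by simp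
  qed
  define h' where "h' y = poly (map_poly h (SOME p. p \<in> polys_over A \<and> y = poly p z)) \<xi>" for y
  have h': "h' (poly p z) = poly (map_poly h p) \<xi>" if p: "p \<in> polys_over A" for p
  proof -
    have "\<exists>q. q \<in> polys_over A \<and> poly p z = poly q z" using p by blast
    from someI_ex[OF this] show ?thesis unfolding h'_def using wd p by metis
  qed
  have "partial_hom (adjoin A z) h'" unfolding partial_hom_def
  proof (intro conjI ballI)
    show "h' 0 = 0" using h'[OF is_subring_0[OF S]] by simp
    show "h' 1 = 1" using h'[OF is_subring_1[OF S]] by (simp add: partial_hom_1)
    fix x y assume "x \<in> adjoin A z" "y \<in> adjoin A z"
    then obtain p q where pq: "p \<in> polys_over A" "x = poly p z" "q \<in> polys_over A" "y = poly q z"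
      unfolding adjoin_def by blast
    show "h' (x + y) = h' x + h' y"
      using h'[OF is_subring_add[OF S pq(1,3)]] h'[OF pq(1)] h'[OF pq(3)] M pq by (simp add: partial_hom_def)
    show "h' (x * y) = h' x * h' y"
      using h'[OF is_subring_mult[OF S pq(1,3)]] h'[OF pq(1)] h'[OF pq(3)] M pq by (simp add: partial_hom_def)
  qed
  then show ?thesis using h' by blast
qed

end

text \<open>The last two clauses on the quotient are what the specialization uses: they bound its
  degree and compute its top coefficient as a product of leading coefficients, so that it is seen to
  be nonzero modulo a prime ideal.\<close>

lemma pseudo_division:
  fixes p m :: "'r::comm_ring_1 poly"
  assumes A: "is_subring A" and p: "p \<in> polys_over A" "p \<noteq> 0" and m: "m \<in> polys_over A"
  shows "\<exists>k c r. c \<in> polys_over A \<and> r \<in> polys_over A \<and> smult (lead_coeff p ^ k) m = c * p + r \<and>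
    (r = 0 \<or> degree r < degree p) \<and> (\<forall>i. i + degree p > degree m \<longrightarrow> coeff c i = 0) \<and>
    (degree p \<le> degree m \<and> m \<noteq> 0 \<longrightarrow> (\<exists>l. coeff c (degree m - degree p) = lead_coeff p ^ l * lead_coeff m))"
  using m
proof (induction "degree m" arbitrary: m rule: less_induct)
  case less
  note S = is_subring_polys_over[OF A]
  let ?a = "lead_coeff p" and ?n = "degree p"
  show ?case
  proof (cases "m = 0 \<or> degree m < ?n")
    case True
    then show ?thesis using less.prems is_subring_0[OF S]
      by (intro exI[of _ 0] exI[of _ m]) auto
  next
    case False
    then have m0: "m \<noteq> 0" and mn: "?n \<le> degree m" by auto
    let ?\<delta> = "degree m - ?n"
    define t where "t = monom (lead_coeff m) ?\<delta>"
    define m' where "m' = smult ?a m - t * p"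
    have aA: "?a \<in> A" "lead_coeff m \<in> A" using p less.prems by (auto intro: polys_overD)
    have tA: "t \<in> polys_over A" unfolding t_def using polys_over_monom[OF A aA(2)] .
    have m'A: "m' \<in> polys_over A" unfolding m'_def
      by (intro is_subring_diff[OF S] is_subring_mult[OF S] polys_over_smult[OF A] aA tA p less.prems)
    have ct: "coeff (t * p) i = (if i < ?\<delta> then 0 else lead_coeff m * coeff p (i - ?\<delta>))" for i
      unfolding t_def by (simp add: coeff_monom_mult)
    have cm': "coeff m' i = 0" if "i \<ge> degree m" for i
    proof (cases "i = degree m")
      case True
      then show ?thesis using mn unfolding m'_def coeff_diff ct by (simp add: mult.commute)
    next
      case False
      then have "coeff m i = 0" "coeff p (i - ?\<delta>) = 0" using that mn by (auto intro!: coeff_eq_0)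
      then show ?thesis unfolding m'_def by (simp add: ct)
    qed
    show ?thesis
    proof (cases "degree m = 0")
      case True
      then have "m' = 0" using cm' by (simp add: poly_eq_iff)
      then have "smult (?a ^ 1) m = t * p + 0" by (simp add: m'_def)
      moreover have "\<exists>l. coeff t ?\<delta> = ?a ^ l * lead_coeff m" by (intro exI[of _ 0]) (simp add: t_def)
      moreover have "\<forall>i. i + ?n > degree m \<longrightarrow> coeff t i = 0" using mn by (auto simp: t_def)
      ultimately show ?thesis using tA is_subring_0[OF S] by blast
    next
      case False
      have "degree m' < degree m"
      proof (rule ccontr)
        assume n: "\<not> degree m' < degree m"
        then have "lead_coeff m' = 0" using cm' by simp
        then show False using n False by simp
      qed
      from less.hyps[OF this m'A] obtain k c r where IH: "c \<in> polys_over A" "r \<in> polys_over A"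
        "smult (?a ^ k) m' = c * p + r" "r = 0 \<or> degree r < ?n" 
        "\<forall>i. i + ?n > degree m' \<longrightarrow> coeff c i = 0" by blast
      define c' where "c' = c + smult (?a ^ k) t"
      have "smult (?a ^ Suc k) m = smult (?a ^ k) (m' + t * p)" by (simp add: m'_def mult.commute)
      also have "\<dots> = c' * p + r" by (simp add: smult_add_right IH(3) c'_def algebra_simps)
      finally have 1: "smult (?a ^ Suc k) m = c' * p + r" .
      have 2: "c' \<in> polys_over A" unfolding c'_def
        by (intro is_subring_add[OF S] polys_over_smult[OF A] is_subring_power[OF A] aA tA IH(1))
      have 3: "\<forall>i. i + ?n > degree m \<longrightarrow> coeff c' i = 0"
        using IH(5) \<open>degree m' < degree m\<close> mn by (auto simp: c'_def t_def)
      have "coeff c ?\<delta> = 0" using IH(5) \<open>degree m' < degree m\<close> mn by simp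
      then have 4: "coeff c' ?\<delta> = ?a ^ k * lead_coeff m" by (simp add: c'_def t_def)
      show ?thesis using 1 2 3 4 IH(2,4) by blast
    qed
  qed
qed

context
  fixes N :: "'r::comm_ring_1 set" and A0 :: "'r set" and h0 :: "'r \<Rightarrow> 's::alg_closed_field"
  assumes N: "is_prime_ideal N"
begin

lemma prime_ideal_rules:
  "0 \<in> N" "1 \<notin> N" "x \<in> N \<Longrightarrow> y \<in> N \<Longrightarrow> x + y \<in> N" "x \<in> N \<Longrightarrow> a * x \<in> N" "x \<in> N \<Longrightarrow> x * a \<in> N"
  "a * b \<in> N \<Longrightarrow> a \<in> N \<or> b \<in> N"
  using N unfolding is_prime_ideal_def by (blast, blast, blast, blast, metis mult.commute, blast)

lemma prime_ideal_diff: "x \<in> N \<Longrightarrow> y \<in> N \<Longrightarrow> x - y \<in> N"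
  using prime_ideal_rules(3)[of x "-1 * y"] prime_ideal_rules(4)[of y "-1"] by simp

lemma prime_ideal_sum: "(\<And>i. i \<in> I \<Longrightarrow> f i \<in> N) \<Longrightarrow> sum f I \<in> N"
  by (induction I rule: infinite_finite_induct) (auto intro: prime_ideal_rules)

lemma prime_ideal_power: "a \<notin> N \<Longrightarrow> a ^ n \<notin> N"
  by (induction n) (use prime_ideal_rules(2,6) in auto)

lemma poly_coeffs_in_prime_ideal: "(\<And>i. coeff p i \<in> N) \<Longrightarrow> poly p z \<in> N"
  unfolding poly_altdef by (intro prime_ideal_sum prime_ideal_rules(5))

text \<open>The extension property of the domain \<open>A\<close> modulo \<open>N\<close> over
  \<open>A0\<close>, phrased without quotients: any prescribed element that is nonzero modulo
  \<open>N\<close> stays nonzero under some homomorphism to an algebraically closed field extending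
  \<open>h0\<close>. Avoiding an element \<open>v\<close> is what keeps inequations alive and drives
  the induction.\<close>

definition specializable :: "'r set \<Rightarrow> bool" where
  "specializable A \<longleftrightarrow> is_subring A \<and> A0 \<subseteq> A \<and> (\<forall>v\<in>A. v \<notin> N \<longrightarrow>
     (\<exists>h. partial_hom A h \<and> (\<forall>x\<in>A \<inter> N. h x = 0) \<and> (\<forall>x\<in>A0. h x = h0 x) \<and> h v \<noteq> 0))"

text \<open>If \<open>z\<close> is transcendental over \<open>A\<close> modulo \<open>N\<close>,
  almost any value \<open>\<xi>\<close> is allowed. If it is algebraic, \<open>\<xi>\<close> must be
  a root of the image of a relation \<open>m\<close> of least degree, and the element to avoid in
  the adjunction is traded for one in \<open>A\<close>.\<close>

lemma specializable_adjoin: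
  assumes spec: "specializable A"
  shows "specializable (adjoin A z)"
proof -
  have A: "is_subring A" "A0 \<subseteq> A" using spec by (auto simp: specializable_def)
  note S = is_subring_polys_over[OF A(1)]
  have ext: "\<exists>h'. partial_hom (adjoin A z) h' \<and> (\<forall>x\<in>adjoin A z \<inter> N. h' x = 0) \<and> (\<forall>x\<in>A0. h' x = h0 x) \<and> h' v \<noteq> 0"
    if h: "partial_hom A h" "\<forall>x\<in>A0. h x = h0 x"
      and K: "\<And>p. p \<in> polys_over A \<Longrightarrow> poly p z \<in> N \<Longrightarrow> poly (map_poly h p) \<xi> = 0"
      and v: "p \<in> polys_over A" "v = poly p z" "poly (map_poly h p) \<xi> \<noteq> 0" for h \<xi> p v
  proof -
    obtain h' where h': "partial_hom (adjoin A z) h'" "\<forall>p\<in>polys_over A. h' (poly p z) = poly (map_poly h p) \<xi>"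
      using partial_hom_extend[OF A(1) h(1) K prime_ideal_rules(1)] by blast
    have "h' x = h0 x" if "x \<in> A0" for x
    proof -
      have "[:x:] \<in> polys_over A" using that A by (simp add: polys_over_pCons is_subring_0[OF S] subsetD)
      then have "h' (poly [:x:] z) = poly (map_poly h [:x:]) \<xi>" using h'(2) by blast
      then show ?thesis using h that partial_hom_0[OF A(1) h(1)] by (simp add: map_poly_pCons)
    qed
    moreover have "h' x = 0" if "x \<in> adjoin A z \<inter> N" for x
      using that h'(2) K unfolding adjoin_def by auto
    ultimately show ?thesis using h' v by metis
  qed
  have main: "\<exists>h'. partial_hom (adjoin A z) h' \<and> (\<forall>x\<in>adjoin A z \<inter> N. h' x = 0) \<and> (\<forall>x\<in>A0. h' x = h0 x) \<and> h' v \<noteq> 0"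
    if v: "v \<in> adjoin A z" "v \<notin> N" for v
  proof -
    obtain p where p: "p \<in> polys_over A" "v = poly p z" using v(1) unfolding adjoin_def by blast
    show ?thesis
    proof (cases "\<exists>m\<in>polys_over A. poly m z \<in> N \<and> (\<exists>i. coeff m i \<notin> N)")
      case False
      have "\<exists>i. coeff p i \<notin> N" using poly_coeffs_in_prime_ideal[of p z] v(2) p(2) by blast
      then obtain i where i: "coeff p i \<notin> N" by blast
      then obtain h where h: "partial_hom A h" "\<forall>x\<in>A \<inter> N. h x = 0" "\<forall>x\<in>A0. h x = h0 x" "h (coeff p i) \<noteq> 0"
        using spec polys_overD[OF p(1), of i] unfolding specializable_def by blast
      note cm = coeff_map_poly_partial[OF A(1) h(1)]
      let ?q = "map_poly h p"
      have q0: "?q \<noteq> 0" using h(4) cm[of p i] by auto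
      have "\<exists>\<xi>. poly ?q \<xi> \<noteq> 0"
      proof (cases "degree ?q = 0")
        case True
        then obtain c where c: "?q = [:c:]" by (auto elim: degree_eq_zeroE)
        then show ?thesis using q0 by simp
      next
        case False
        \<comment> \<open>A root of \<open>?q - 1\<close> is a point where \<open>?q\<close> has the
          value 1.\<close>
        have "degree (?q - 1) > 0" using False by (subst diff_conv_add_uminus, subst degree_add_eq_left) auto
        then obtain \<xi> where "poly (?q - 1) \<xi> = 0" using alg_closed_imp_poly_has_root by blast
        then show ?thesis by (intro exI[of _ \<xi>]) simp
      qed
      then obtain \<xi> where \<xi>: "poly ?q \<xi> \<noteq> 0" by blast
      have "poly (map_poly h m) \<xi> = 0" if "m \<in> polys_over A" "poly m z \<in> N" for m
      proof -
        have "coeff m i \<in> A \<inter> N" for i using that False polys_overD by blast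
        then have "map_poly h m = 0" using h(2) by (simp add: poly_eq_iff cm)
        then show ?thesis by simp
      qed
      then show ?thesis using ext[OF h(1,3) _ p \<xi>] by blast
    next
      case True
      define Q where "Q m \<longleftrightarrow> m \<in> polys_over A \<and> poly m z \<in> N \<and> (\<exists>i. coeff m i \<notin> N)" for m
      from True have "\<exists>m. Q m" unfolding Q_def by blast
      then obtain m0 where "Q m0" by blast
      from ex_has_least_nat[of Q, OF this, of degree] obtain m where
        m: "Q m" and min: "\<forall>q. Q q \<longrightarrow> degree m \<le> degree q" by blast
      let ?n = "degree m" and ?a = "lead_coeff m"
      have mA: "m \<in> polys_over A" "poly m z \<in> N" using m by (auto simp: Q_def)
      have small: "coeff q i \<in> N" if "q \<in> polys_over A" "poly q z \<in> N" "degree q < ?n" for q i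
        using that min leD unfolding Q_def by blast
      \<comment> \<open>A leading coefficient in \<open>N\<close> could be dropped, which would
        leave a relation of smaller degree.\<close>
      have aN: "?a \<notin> N"
      proof
        assume a: "?a \<in> N"
        define m' where "m' = m - monom ?a ?n"
        have "?n \<noteq> 0"
        proof
          assume "?n = 0"
          then obtain c where "m = [:c:]" by (auto elim: degree_eq_zeroE)
          then have "coeff m i \<in> N" for i
            using a prime_ideal_rules(1) by (auto simp: coeff_pCons split: nat.split)
          then show False using m by (auto simp: Q_def)
        qed
        have "coeff m' i = 0" if "i \<ge> ?n" for i
          using that by (cases "i = ?n") (auto simp: m'_def intro!: coeff_eq_0)
        then have "degree m' < ?n" using \<open>?n \<noteq> 0\<close>
          by (metis not_le leading_coeff_0_iff degree_0 neq0_conv)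
        moreover have "m' \<in> polys_over A" unfolding m'_def
          by (intro is_subring_diff[OF S] polys_over_monom[OF A(1)] polys_overD[OF mA(1)] mA)
        moreover have "poly m' z \<in> N"
          using prime_ideal_diff[OF mA(2) prime_ideal_rules(5)[OF a, of "z ^ ?n"]]
          by (simp add: m'_def poly_monom)
        ultimately have c: "coeff m' i \<in> N" for i using small by blast
        have "coeff m i = coeff m' i + (if i = ?n then ?a else 0)" for i by (simp add: m'_def)
        then have "coeff m i \<in> N" for i using c a prime_ideal_rules(3)[OF c, of _ i] prime_ideal_rules(1) by (metis (full_types))
        then show False using m by (auto simp: Q_def)
      qed
      have m0: "m \<noteq> 0" using aN prime_ideal_rules(1) by auto
      have n: "?n \<noteq> 0"
      proof
        assume "?n = 0"
        then obtain c where "m = [:c:]" by (auto elim: degree_eq_zeroE)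
        then show False using aN mA by simp
      qed
      \<comment> \<open>Inversion modulo \<open>N\<close> up to a factor \<open>b\<close> from
        \<open>A\<close>, by the Euclidean algorithm: \<open>m\<close> is divided by
        \<open>s\<close>, and the remainder is inverted by induction.\<close>
      have inv_small: "\<exists>b q. b \<in> A \<and> b \<notin> N \<and> q \<in> polys_over A \<and> poly q z * poly s z - b \<in> N"
        if "s \<in> polys_over A" "poly s z \<notin> N" "degree s < ?n" for s
        using that
      proof (induction "degree s" arbitrary: s rule: less_induct)
        case less
        have s0: "s \<noteq> 0" using less.prems prime_ideal_rules(1) by auto
        show ?case
        proof (cases "degree s = 0")
          case True
          then obtain b where "s = [:b:]" by (auto elim: degree_eq_zeroE)
          then show ?thesis using less.prems is_subring_1[OF S] prime_ideal_rules(1) polys_over_pCons[OF A(1)]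
            by (intro exI[of _ b] exI[of _ 1]) auto
        next
          case False
          show ?thesis
          proof (cases "lead_coeff s \<in> N")
            case True
            define s' where "s' = s - monom (lead_coeff s) (degree s)"
            have "coeff s' i = 0" if "i \<ge> degree s" for i
              using that by (cases "i = degree s") (auto simp: s'_def intro!: coeff_eq_0)
            then have d: "degree s' < degree s" using False
              by (metis not_le leading_coeff_0_iff degree_0 neq0_conv)
            have s'A: "s' \<in> polys_over A" unfolding s'_def
              by (intro is_subring_diff[OF S] polys_over_monom[OF A(1)] polys_overD[OF less.prems(1)] less.prems)
            have eq: "poly s z = poly s' z + lead_coeff s * z ^ degree s" by (simp add: s'_def poly_monom)
            have lz: "lead_coeff s * z ^ degree s \<in> N" by (rule prime_ideal_rules(5)[OF True])
            then have "poly s' z \<notin> N" using less.prems(2) prime_ideal_rules(3) eq by metis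
            then obtain b q where bq: "b \<in> A" "b \<notin> N" "q \<in> polys_over A" "poly q z * poly s' z - b \<in> N"
              using less.hyps[OF d s'A] d less.prems(3) by auto
            have "poly q z * poly s z - b = (poly q z * poly s' z - b) + poly q z * (lead_coeff s * z ^ degree s)"
              by (simp add: eq algebra_simps)
            then have "poly q z * poly s z - b \<in> N"
              using prime_ideal_rules(3)[OF bq(4) prime_ideal_rules(4)[OF lz]] by metis
            then show ?thesis using bq by blast
          next
            case lN: False
            obtain k c r where cr: "c \<in> polys_over A" "r \<in> polys_over A" "smult (lead_coeff s ^ k) m = c * s + r"
              "r = 0 \<or> degree r < degree s" "\<forall>i. i + degree s > ?n \<longrightarrow> coeff c i = 0"
              "degree s \<le> ?n \<and> m \<noteq> 0 \<longrightarrow> (\<exists>l. coeff c (?n - degree s) = lead_coeff s ^ l * ?a)"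
              using pseudo_division[OF A(1) less.prems(1) s0 mA(1)] by blast
            have "poly (smult (lead_coeff s ^ k) m) z \<in> N" using prime_ideal_rules(4)[OF mA(2)] by simp
            then have csr: "poly c z * poly s z + poly r z \<in> N" unfolding cr(3) by simp
            \<comment> \<open>Otherwise the quotient \<open>c\<close> would be a relation of degree
              below that of \<open>m\<close>, although its top coefficient is a product of elements
              outside \<open>N\<close>.\<close>
            have "poly r z \<notin> N"
            proof
              assume "poly r z \<in> N"
              from prime_ideal_diff[OF csr this] have "poly c z * poly s z \<in> N" by simp
              then have "poly c z \<in> N" using prime_ideal_rules(6) less.prems(2) by blast
              moreover have "degree c \<le> ?n - degree s" by (rule degree_le) (use cr(5) in auto)
              then have "degree c < ?n" using False n by linarith
              ultimately have "coeff c (?n - degree s) \<in> N" using small cr(1) by blast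
              moreover have "\<exists>l. coeff c (?n - degree s) = lead_coeff s ^ l * ?a" using cr(6) m0 less.prems(3) by simp
              ultimately show False using prime_ideal_rules(6) prime_ideal_power[OF lN] aN by metis
            qed
            moreover from this have "degree r < degree s" using cr(4) prime_ideal_rules(1) by auto
            ultimately obtain b q where bq: "b \<in> A" "b \<notin> N" "q \<in> polys_over A" "poly q z * poly r z - b \<in> N"
              using less.hyps[OF _ cr(2)] less.prems(3) by auto
            have "poly (- (q * c)) z * poly s z - b = 
                (poly q z * poly r z - b) - poly q z * (poly c z * poly s z + poly r z)"
              by (simp add: algebra_simps)
            then have "poly (- (q * c)) z * poly s z - b \<in> N"
              using prime_ideal_diff[OF bq(4) prime_ideal_rules(4)[OF csr]] by metis
            moreover have "- (q * c) \<in> polys_over A"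
              by (intro is_subring_uminus[OF S] is_subring_mult[OF S] bq cr)
            ultimately show ?thesis using bq by blast
          qed
        qed
      qed
      obtain k c r where cr: "c \<in> polys_over A" "r \<in> polys_over A" "smult (?a ^ k) p = c * m + r"
        "r = 0 \<or> degree r < ?n" using pseudo_division[OF A(1) mA(1) m0 p(1)] by blast
      have "?a ^ k * poly p z = poly c z * poly m z + poly r z"
        using arg_cong[OF cr(3), of "\<lambda>q. poly q z"] by simp
      then have rN: "poly r z \<notin> N"
        using prime_ideal_rules(3)[OF prime_ideal_rules(4)[OF mA(2)]] prime_ideal_rules(6)
          prime_ideal_power[OF aN] v(2) p(2) by metis
      then have "degree r < ?n" using cr(4) prime_ideal_rules(1) by auto
      then obtain b q where bq: "b \<in> A" "b \<notin> N" "q \<in> polys_over A" "poly q z * poly r z - b \<in> N"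
        using inv_small[OF cr(2) rN] by blast
      \<comment> \<open>Avoiding \<open>?a\<close> keeps the image of \<open>m\<close> of positive
        degree, so that it has a root; avoiding \<open>b\<close> keeps the image of \<open>v\<close>
        nonzero, since \<open>v\<close> divides \<open>b\<close> modulo \<open>N\<close> up to a
        power of \<open>?a\<close>.\<close>
      have "?a * b \<notin> N" using prime_ideal_rules(6) aN bq(2) by blast
      moreover have aA: "?a \<in> A" using mA by (auto intro: polys_overD)
      ultimately obtain h where h: "partial_hom A h" "\<forall>x\<in>A \<inter> N. h x = 0" "\<forall>x\<in>A0. h x = h0 x" "h (?a * b) \<noteq> 0"
        using spec is_subring_mult[OF A(1) aA bq(1)] unfolding specializable_def by blast
      have hab: "h ?a \<noteq> 0" "h b \<noteq> 0" using h(4) partial_hom_mult[OF A(1) h(1) aA bq(1)] by auto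
      note cm = coeff_map_poly_partial[OF A(1) h(1)]
      note M = partial_hom_map_poly[OF A(1) h(1)]
      have "coeff (map_poly h m) ?n \<noteq> 0" using hab by (simp add: cm)
      then have "degree (map_poly h m) > 0" using n le_degree by (metis le_0_eq neq0_conv)
      then obtain \<xi> where \<xi>: "poly (map_poly h m) \<xi> = 0" using alg_closed_imp_poly_has_root by blast
      have small0: "poly (map_poly h s) \<xi> = 0" if "s \<in> polys_over A" "poly s z \<in> N" "s = 0 \<or> degree s < ?n" for s
      proof -
        have "coeff s i \<in> A \<inter> N" for i using small[of s i] that polys_overD[OF that(1)] prime_ideal_rules(1) by auto
        then have "map_poly h s = 0" using h(2) by (simp add: poly_eq_iff cm)
        then show ?thesis by simp
      qed
      have red: "h ?a ^ k * poly (map_poly h s) \<xi> = poly (map_poly h r) \<xi>"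
        if "s \<in> polys_over A" "c \<in> polys_over A" "r \<in> polys_over A" "smult (?a ^ k) s = c * m + r" for s c r k
      proof -
        have ak: "?a ^ k \<in> A" by (rule is_subring_power[OF A(1) aA])
        have "map_poly h (smult (?a ^ k) s) = smult (h ?a ^ k) (map_poly h s)"
          using partial_hom_mult[OF A(1) h(1) ak polys_overD[OF that(1)]] partial_hom_power[OF A(1) h(1) aA]
          by (simp add: poly_eq_iff cm)
        moreover have "map_poly h (c * m + r) = map_poly h c * map_poly h m + map_poly h r"
          using M is_subring_mult[OF S that(2) mA(1)] that mA unfolding partial_hom_def by metis
        ultimately have "smult (h ?a ^ k) (map_poly h s) = map_poly h c * map_poly h m + map_poly h r"
          using that(4) by simp
        from arg_cong[OF this, of "\<lambda>q. poly q \<xi>"] show ?thesis using \<xi> by simp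
      qed
      \<comment> \<open>The pseudo-remainder of any relation by \<open>m\<close> is a relation of
        smaller degree, so its coefficients lie in \<open>N\<close> and are sent to 0.\<close>
      have K: "poly (map_poly h s) \<xi> = 0" if s: "s \<in> polys_over A" "poly s z \<in> N" for s
      proof -
        obtain k c r where cr: "c \<in> polys_over A" "r \<in> polys_over A" "smult (?a ^ k) s = c * m + r"
          "r = 0 \<or> degree r < ?n" using pseudo_division[OF A(1) mA(1) m0 s(1)] by blast
        have "?a ^ k * poly s z = poly c z * poly m z + poly r z"
          using arg_cong[OF cr(3), of "\<lambda>q. poly q z"] by simp
        then have "poly r z = ?a ^ k * poly s z - poly c z * poly m z" by simp
        then have "poly r z \<in> N"
          using prime_ideal_diff[OF prime_ideal_rules(4)[OF s(2)] prime_ideal_rules(4)[OF mA(2)]] by metis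
        then have "poly (map_poly h r) \<xi> = 0" using small0 cr by blast
        then show ?thesis using red[OF s(1) cr(1-3)] hab by simp
      qed
      have qr: "q * r \<in> polys_over A" "[:b:] \<in> polys_over A"
        using is_subring_mult[OF S bq(3) cr(2)] bq(1) by (simp_all add: polys_over_pCons[OF A(1)] is_subring_0[OF S])
      have "poly (map_poly h (q * r - [:b:])) \<xi> = 0"
        using K[OF is_subring_diff[OF S qr]] bq(4) by simp
      moreover have "map_poly h (q * r - [:b:]) = map_poly h q * map_poly h r - [:h b:]"
        using partial_hom_diff[OF S M qr] partial_hom_mult[OF S M bq(3) cr(2)]
        by (simp add: map_poly_pCons partial_hom_0[OF A(1) h(1)])
      ultimately have "poly (map_poly h q) \<xi> * poly (map_poly h r) \<xi> = h b" by simp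
      then have "poly (map_poly h r) \<xi> \<noteq> 0" using hab by auto
      then have "poly (map_poly h p) \<xi> \<noteq> 0" using red[OF p(1) cr(1-3)] by auto
      then show ?thesis using ext[OF h(1,3) K p] by blast
    qed
  qed
  show ?thesis unfolding specializable_def
    using main is_subring_adjoin[OF A(1)] adjoin_base[OF A(1)] A(2) by blast
qed

theorem specializable_finite_extension:
  assumes "specializable A0" "finite X"
  shows "\<exists>A. specializable A \<and> X \<subseteq> A"
  using assms(2)
proof induction
  case empty
  then show ?case using assms(1) by blast
next
  case (insert x X)
  then obtain A where "specializable A" "X \<subseteq> A" by blast
  then show ?case
    using specializable_adjoin[of A x] adjoin_base[of A x] adjoin_gen[of A x]
    by (intro exI[of _ "adjoin A x"]) (auto simp: specializable_def)
qed

end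

section \<open>A solution over the generic point\<close>

lemma infinite_UNIV_alg_closed: "infinite (UNIV :: 'k::alg_closed_field set)"
proof
  assume fin: "finite (UNIV :: 'k set)"
  define p :: "'k poly" where "p = (\<Prod>a\<in>UNIV. [:-a, 1:]) + 1"
  have "degree (\<Prod>a\<in>UNIV. [:-a, 1 :: 'k:]) = (\<Sum>a\<in>(UNIV :: 'k set). 1)"
    by (subst degree_prod_eq_sum_degree) auto
  then have "degree (\<Prod>a\<in>UNIV. [:-a, 1 :: 'k:]) > 0" using fin by (simp add: finite_UNIV_card_ge_0)
  then have "degree p > 0" unfolding p_def by (subst degree_add_eq_left) auto
  then obtain x where x: "poly p x = 0" using alg_closed_imp_poly_has_root by blast
  have "poly (\<Prod>a\<in>UNIV. [:-a, 1:]) x = 0" using fin by (auto simp: poly_prod)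
  then show False using x by (simp add: p_def)
qed

text \<open>The numerator of the value of \<open>F\<close> at \<open>p / r\<close> and
  \<open>u / v\<close> over the denominator \<open>r ^ e * v ^ d\<close>. Being polynomial in its
  arguments, it commutes with homomorphisms on the coefficients.\<close>

definition bihom :: "('k::field \<Rightarrow> 'r::comm_ring_1) \<Rightarrow> 'k poly poly \<Rightarrow> nat \<Rightarrow> nat \<Rightarrow>
    'r poly \<Rightarrow> 'r poly \<Rightarrow> 'r poly \<Rightarrow> 'r poly \<Rightarrow> 'r poly" where
  "bihom c F d e p r u v =
    (\<Sum>j\<le>d. \<Sum>i\<le>e. [:c (coeff (coeff F j) i):] * (p ^ i * r ^ (e - i) * u ^ j * v ^ (d - j)))"

lemma bihom_in_polys_over:
  assumes A: "is_subring A" and c: "\<And>a. c a \<in> A" and P: "p \<in> polys_over A" "r \<in> polys_over A" "u \<in> polys_over A" "v \<in> polys_over A"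
  shows "bihom c F d e p r u v \<in> polys_over A"
proof -
  note S = is_subring_polys_over[OF A]
  have "[:c a:] \<in> polys_over A" for a using c by (simp add: polys_over_pCons[OF A] is_subring_0[OF S])
  then show ?thesis unfolding bihom_def
    by (intro is_subring_sum[OF S] is_subring_mult[OF S] is_subring_power[OF S] P)
qed

lemma map_poly_bihom:
  assumes A: "is_subring A" and h: "partial_hom A h" and c: "\<And>a. c a \<in> A"
    and P: "p \<in> polys_over A" "r \<in> polys_over A" "u \<in> polys_over A" "v \<in> polys_over A"
  shows "map_poly h (bihom c F d e p r u v) =
    bihom (\<lambda>a. h (c a)) F d e (map_poly h p) (map_poly h r) (map_poly h u) (map_poly h v)"
proof -
  note S = is_subring_polys_over[OF A] and M = partial_hom_map_poly[OF A h]
  have C: "[:c a:] \<in> polys_over A" for a using c by (simp add: polys_over_pCons[OF A] is_subring_0[OF S])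
  have hC: "map_poly h [:c a:] = [:h (c a):]" for a
    by (simp add: map_poly_pCons partial_hom_0[OF A h])
  have term_eq: "map_poly h ([:c a:] * (p ^ i * r ^ i' * u ^ j * v ^ j')) =
      [:h (c a):] * (map_poly h p ^ i * map_poly h r ^ i' * map_poly h u ^ j * map_poly h v ^ j')"
    and mem: "[:c a:] * (p ^ i * r ^ i' * u ^ j * v ^ j') \<in> polys_over A" for a i i' j j'
  proof -
    note pw = is_subring_power[OF S] and ml = is_subring_mult[OF S]
    have m1: "p ^ i * r ^ i' \<in> polys_over A" "p ^ i * r ^ i' * u ^ j \<in> polys_over A"
      "p ^ i * r ^ i' * u ^ j * v ^ j' \<in> polys_over A" by (intro ml pw P)+
    show "[:c a:] * (p ^ i * r ^ i' * u ^ j * v ^ j') \<in> polys_over A" by (intro ml C m1)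
    have "map_poly h ([:c a:] * (p ^ i * r ^ i' * u ^ j * v ^ j')) =
        map_poly h [:c a:] * map_poly h (p ^ i * r ^ i' * u ^ j * v ^ j')"
      by (rule partial_hom_mult[OF S M C m1(3)])
    also have "map_poly h (p ^ i * r ^ i' * u ^ j * v ^ j') = map_poly h (p ^ i * r ^ i' * u ^ j) * map_poly h (v ^ j')"
      by (rule partial_hom_mult[OF S M m1(2) pw[OF P(4)]])
    also have "map_poly h (p ^ i * r ^ i' * u ^ j) = map_poly h (p ^ i * r ^ i') * map_poly h (u ^ j)"
      by (rule partial_hom_mult[OF S M m1(1) pw[OF P(3)]])
    also have "map_poly h (p ^ i * r ^ i') = map_poly h (p ^ i) * map_poly h (r ^ i')"
      by (rule partial_hom_mult[OF S M pw[OF P(1)] pw[OF P(2)]])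
    finally show "map_poly h ([:c a:] * (p ^ i * r ^ i' * u ^ j * v ^ j')) =
      [:h (c a):] * (map_poly h p ^ i * map_poly h r ^ i' * map_poly h u ^ j * map_poly h v ^ j')"
      by (simp only: hC partial_hom_power[OF S M P(1)] partial_hom_power[OF S M P(2)]
          partial_hom_power[OF S M P(3)] partial_hom_power[OF S M P(4)])
  qed
  show ?thesis unfolding bihom_def
    by (simp only: partial_hom_sum[OF S M] mem is_subring_sum[OF S] term_eq)
qed

context
  fixes \<kappa> :: "'k::alg_closed_field poly \<Rightarrow> 'c::alg_closed_field"
  assumes \<kappa>: "type_ring_hom \<kappa>" and \<kappa>_inj: "\<And>p. \<kappa> p = 0 \<Longrightarrow> p = 0"
begin

interpretation \<kappa>: type_ring_hom \<kappa> by (rule \<kappa>)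

text \<open>Polynomial conditions with bounded solutions for almost every \<open>l \<in> k\<close> acquire a solution
  over an algebraically closed field containing \<open>k(\<tau>)\<close>: the solutions form functions of \<open>l\<close>, and
  the ring of functions modulo a prime ideal containing those of finite support specializes.\<close>
lemma generic_solution:
  assumes fin: "finite Bad"
    and sol: "\<And>l. l \<notin> Bad \<Longrightarrow> \<exists>p r u v :: 'k poly. degree p \<le> D \<and> degree r \<le> D \<and> degree u \<le> D \<and>
      degree v \<le> D \<and> v \<noteq> 0 \<and> (\<exists>i j. coeff p i * coeff r j \<noteq> coeff p j * coeff r i) \<and>
      bihom (\<lambda>a. a) F d e p r u v = [:l:] * (r ^ e * v ^ d)"
  shows "\<exists>p r u v :: 'c poly. v \<noteq> 0 \<and> (\<exists>i j. coeff p i * coeff r j \<noteq> coeff p j * coeff r i) \<and>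
      bihom (\<lambda>a. \<kappa> [:a:]) F d e p r u v = [:\<kappa> [:0, 1:]:] * (r ^ e * v ^ d)"
proof -
  have ev_hom: "type_ring_hom (\<lambda>f :: 'k \<Rightarrow> 'k. f l)" for l by standard auto
  \<comment> \<open>Modulo a prime ideal containing \<open>I\<close>, functions that agree for
    almost all \<open>l\<close> become equal, so the set \<open>Bad\<close> has no
    influence.\<close>
  define I :: "('k \<Rightarrow> 'k) set" where "I = {f. finite {l. f l \<noteq> 0}}"
  have "\<exists>N. is_prime_ideal N \<and> I \<subseteq> N"
  proof (rule prime_ideal_exists)
    show "0 \<in> I" by (simp add: I_def)
    show "1 \<notin> I" using infinite_UNIV_alg_closed[where 'k = 'k] by (simp add: I_def)
    fix x y :: "'k \<Rightarrow> 'k" assume "x \<in> I"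
    then have x: "finite {l. x l \<noteq> 0}" by (simp add: I_def)
    show "a * x \<in> I" for a
      unfolding I_def mem_Collect_eq by (rule finite_subset[OF _ x]) auto
    assume "y \<in> I"
    then have y: "finite {l. y l \<noteq> 0}" by (simp add: I_def)
    show "x + y \<in> I"
      unfolding I_def mem_Collect_eq by (rule finite_subset[OF _ finite_UnI[OF x y]]) auto
  qed
  then obtain N where N: "is_prime_ideal N" and "I \<subseteq> N" by blast
  then have IN: "f \<in> N" if "finite {l. f l \<noteq> 0}" for f
    using that subsetD[of I N f] by (simp add: I_def)
  note Nr = prime_ideal_rules[OF N]
  have no_inv: "f \<notin> N" if "finite {l. f l \<noteq> 1}" for f
  proof
    assume "f \<in> N"
    moreover have "1 - f \<in> N" by (rule IN, rule finite_subset[OF _ that]) auto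
    ultimately have "(1 - f) + f \<in> N" by (intro Nr(3))
    then show False using Nr(2) by simp
  qed
  \<comment> \<open>Polynomials in the parameter become functions of \<open>l\<close>. A nonzero one
    is invertible off its finitely many roots, so the ring modulo \<open>N\<close> still contains
    \<open>k[\<tau>]\<close>, with the identity function as \<open>\<tau>\<close>.\<close>
  define pf :: "'k poly \<Rightarrow> 'k \<Rightarrow> 'k" where "pf p = (\<lambda>l. poly p l)" for p
  interpret pf: type_ring_hom pf by standard (auto simp: pf_def fun_eq_iff)
  have pfN: "p = 0" if "pf p \<in> N" for p
  proof (rule ccontr)
    assume "p \<noteq> 0"
    then have "finite {l. poly p l = 0}" by (rule poly_roots_finite)
    moreover have "{l. ((\<lambda>l. inverse (poly p l)) * pf p) l \<noteq> 1} \<subseteq> {l. poly p l = 0}"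
      using left_inverse by (auto simp: pf_def)
    ultimately have "(\<lambda>l. inverse (poly p l)) * pf p \<notin> N" by (intro no_inv) (rule finite_subset)
    then show False using Nr(4)[OF that] by blast
  qed
  have pf_inj: "inj pf"
  proof (rule injI)
    fix p q assume "pf p = pf q"
    then have "pf (p - q) \<in> N" using Nr(1) by (simp add: pf.hom_diff)
    then show "p = q" using pfN by fastforce
  qed
  define h0 where "h0 f = \<kappa> (inv_into UNIV pf f)" for f
  have h0: "h0 (pf p) = \<kappa> p" for p by (simp add: h0_def pf_inj)
  have sub: "is_subring (range pf)" unfolding is_subring_def
  proof (intro conjI ballI)
    show "0 \<in> range pf" "1 \<in> range pf" using pf.hom_0 pf.hom_1 by (metis rangeI)+
    fix x assume "x \<in> range pf"
    then obtain p where x: "x = pf p" by blast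
    show "- x \<in> range pf" unfolding x pf.hom_uminus[symmetric] by (rule rangeI)
    fix y assume "y \<in> range pf"
    then obtain q where y: "y = pf q" by blast
    show "x + y \<in> range pf" unfolding x y pf.hom_add[symmetric] by (rule rangeI)
    show "x * y \<in> range pf" unfolding x y pf.hom_mult[symmetric] by (rule rangeI)
  qed
  have "specializable N (range pf) h0 (range pf)"
    unfolding specializable_def[OF N]
  proof (intro conjI ballI impI sub subset_refl)
    fix v assume v: "v \<in> range pf" "v \<notin> N"
    have "partial_hom (range pf) h0"
      unfolding partial_hom_def using h0[of 0] h0[of 1]
      by (auto simp: h0 pf.hom_0 pf.hom_1 \<kappa>.hom_simps simp flip: pf.hom_add pf.hom_mult)
    moreover have "h0 x = 0" if "x \<in> range pf \<inter> N" for x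
    proof -
      obtain p where p: "x = pf p" using \<open>x \<in> range pf \<inter> N\<close> by blast
      have "p = 0" by (rule pfN) (use \<open>x \<in> range pf \<inter> N\<close> p in simp)
      then show ?thesis using p h0[of 0] \<kappa>.hom_0 by simp
    qed
    moreover have "h0 v \<noteq> 0"
    proof -
      obtain p where p: "v = pf p" using v by blast
      then have "p \<noteq> 0" using v(2) Nr(1) pf.hom_0 by auto
      then show ?thesis using \<kappa>_inj p h0 by auto
    qed
    ultimately show "\<exists>h. partial_hom (range pf) h \<and> (\<forall>x\<in>range pf \<inter> N. h x = 0) \<and> (\<forall>x\<in>range pf. h x = h0 x) \<and> h v \<noteq> 0"
      by blast
  qed
  note spec0 = this
  define Q where "Q l t \<longleftrightarrow> (case t of (p, r, u, v) \<Rightarrow> degree p \<le> D \<and> degree r \<le> D \<and> degree u \<le> D \<and>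
      degree v \<le> D \<and> v \<noteq> 0 \<and> (\<exists>i j. coeff p i * coeff r j \<noteq> coeff p j * coeff r i) \<and>
      bihom (\<lambda>a. a) F d e p r u v = [:l:] * (r ^ e * v ^ d))" for l t
  define T where "T l = (SOME t. Q l t)" for l
  have T: "Q l (T l)" if "l \<notin> Bad" for l
  proof -
    have "\<exists>t. Q l t" using sol[OF that] unfolding Q_def by auto
    then show ?thesis unfolding T_def by (rule someI_ex)
  qed
  define p r u v where "p l = fst (T l)" and "r l = fst (snd (T l))" and
    "u l = fst (snd (snd (T l)))" and "v l = snd (snd (snd (T l)))" for l
  have good: "degree (p l) \<le> D" "degree (r l) \<le> D" "degree (u l) \<le> D" "degree (v l) \<le> D" "v l \<noteq> 0"
    "\<exists>i j. coeff (p l) i * coeff (r l) j \<noteq> coeff (p l) j * coeff (r l) i"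
    "bihom (\<lambda>a. a) F d e (p l) (r l) (u l) (v l) = [:l:] * (r l ^ e * v l ^ d)" if "l \<notin> Bad" for l
    using T[OF that] unfolding Q_def p_def r_def u_def v_def by (simp_all add: case_prod_unfold)
  define cf :: "('k \<Rightarrow> 'k poly) \<Rightarrow> nat \<Rightarrow> 'k \<Rightarrow> 'k" where "cf q i = (\<lambda>l. coeff (q l) i)" for q i
  \<comment> \<open>The coefficients of the solutions chosen for each \<open>l\<close> become
    functions of \<open>l\<close>. Truncation at \<open>D\<close> can change a solution only for
    \<open>l\<close> in \<open>Bad\<close>.\<close>
  define L :: "('k \<Rightarrow> 'k poly) \<Rightarrow> ('k \<Rightarrow> 'k) poly" where "L q = (\<Sum>i\<le>D. monom (cf q i) i)" for q
  have coeff_L: "coeff (L q) i = (if i \<le> D then cf q i else 0)" for q i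
    by (simp add: L_def coeff_sum)
  have ev_L: "map_poly (\<lambda>f. f l) (L q) = q l" if "degree (q l) \<le> D" for q l
    using that by (auto simp: poly_eq_iff type_ring_hom.coeff_map_poly_hom[OF ev_hom] coeff_L cf_def coeff_eq_0)
  define X where "X = (\<lambda>(q, i). cf q i) ` ({p, r, u, v} \<times> {..D})"
  have "finite X" by (simp add: X_def)
  then obtain A where A: "specializable N (range pf) h0 A" "X \<subseteq> A"
    using specializable_finite_extension[OF N spec0] by blast
  have SA: "is_subring A" and A0: "range pf \<subseteq> A" using A(1) unfolding specializable_def[OF N] by blast+
  note S = is_subring_polys_over[OF SA]
  have cfA: "cf q i \<in> A" if "q \<in> {p, r, u, v}" "i \<le> D" for q i
    using that A(2) unfolding X_def by blast
  have LA: "L q \<in> polys_over A" if "q \<in> {p, r, u, v}" for q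
    unfolding polys_over_def using cfA[OF that] is_subring_0[OF SA] by (auto simp: coeff_L)
  \<comment> \<open>\<open>w\<close> encodes the inequations: a minor of the coefficients of
    \<open>p\<close> and \<open>r\<close>, times a coefficient of \<open>v\<close>. The suitable
    indices depend on \<open>l\<close>, yet some triple is outside \<open>N\<close>: otherwise the
    inverses of values selected for each \<open>l\<close> would combine the \<open>w t\<close> into
    an element of \<open>N\<close> that is 1 off \<open>Bad\<close>.\<close>
  define w where "w = (\<lambda>(i, j, k). (cf p i * cf r j - cf p j * cf r i) * cf v k)"
  let ?J = "{..D} \<times> {..D} \<times> {..D}"
  have "\<exists>t\<in>?J. w t \<notin> N"
  proof (rule ccontr)
    assume all: "\<not> (\<exists>t\<in>?J. w t \<notin> N)"
    have ex: "\<exists>t\<in>?J. w t l \<noteq> 0" if lB: "l \<notin> Bad" for l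
    proof -
      obtain i j where ij: "coeff (p l) i * coeff (r l) j \<noteq> coeff (p l) j * coeff (r l) i"
        using good(6)[OF lB] by blast
      have "i \<le> D" "j \<le> D"
        using ij good(1,2)[OF lB] coeff_eq_0[of "p l"] coeff_eq_0[of "r l"]
        by (metis le_less_trans mult_zero_left mult_zero_right not_le)+
      moreover have "w (i, j, degree (v l)) l \<noteq> 0" using ij good(5)[OF lB] by (simp add: w_def cf_def)
      ultimately show ?thesis using good(4)[OF lB] by (intro bexI[of _ "(i, j, degree (v l))"]) auto
    qed
    define sel where "sel l = (SOME t. t \<in> ?J \<and> w t l \<noteq> 0)" for l
    have sel: "sel l \<in> ?J \<and> w (sel l) l \<noteq> 0" if "l \<notin> Bad" for l
      unfolding sel_def by (rule someI_ex) (use ex[OF that] in blast)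
    define g where "g t = (\<lambda>l. if t = sel l then inverse (w t l) else 0)" for t
    have "(\<Sum>t\<in>?J. g t * w t) l = 1" if "l \<notin> Bad" for l
    proof -
      have "(\<Sum>t\<in>?J. g t * w t) l = (\<Sum>t\<in>?J. (g t * w t) l)"
        by (rule type_ring_hom.hom_sum[OF ev_hom])
      also have "\<dots> = (\<Sum>t\<in>?J. if t = sel l then 1 else 0)"
        using sel[OF that] by (intro sum.cong refl) (auto simp: g_def)
      also have "\<dots> = 1" using sel[OF that] by (subst sum.delta) auto
      finally show ?thesis .
    qed
    then have "{l. (\<Sum>t\<in>?J. g t * w t) l \<noteq> 1} \<subseteq> Bad" by blast
    then have "(\<Sum>t\<in>?J. g t * w t) \<notin> N" by (intro no_inv finite_subset[OF _ fin])
    moreover have "(\<Sum>t\<in>?J. g t * w t) \<in> N"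
      using all by (intro prime_ideal_sum[OF N] Nr(4)) blast
    ultimately show False by blast
  qed
  then obtain i j k where ijk: "i \<le> D" "j \<le> D" "k \<le> D" "w (i, j, k) \<notin> N" by auto
  have wA: "w (i, j, k) \<in> A" unfolding w_def prod.case
    by (intro is_subring_mult[OF SA] is_subring_diff[OF SA] cfA ijk) auto
  obtain h where h: "partial_hom A h" "\<forall>x\<in>A \<inter> N. h x = 0" "\<forall>x\<in>range pf. h x = h0 x" "h (w (i, j, k)) \<noteq> 0"
    using A(1) wA ijk(4) unfolding specializable_def[OF N] by blast
  note cm = coeff_map_poly_partial[OF SA h(1)] and M = partial_hom_map_poly[OF SA h(1)]
  have hpf: "h (pf q) = \<kappa> q" for q using h(3) h0 by auto
  define p' r' u' v' where "p' = map_poly h (L p)" and "r' = map_poly h (L r)" and "u' = map_poly h (L u)"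
    and "v' = map_poly h (L v)"
  have cf_p: "coeff p' i = h (cf p i)" "coeff r' i = h (cf r i)" "coeff v' i = h (cf v i)" if "i \<le> D" for i
    using that by (simp_all add: p'_def r'_def v'_def cm coeff_L)
  have "h (w (i, j, k)) = (coeff p' i * coeff r' j - coeff p' j * coeff r' i) * coeff v' k"
  proof -
    have a: "cf p i * cf r j \<in> A" "cf p j * cf r i \<in> A" by (intro is_subring_mult[OF SA] cfA ijk; simp)+
    have "h (w (i, j, k)) = h (cf p i * cf r j - cf p j * cf r i) * h (cf v k)"
      unfolding w_def prod.case
      by (intro partial_hom_mult[OF SA h(1)] is_subring_diff[OF SA] a cfA ijk) auto
    also have "h (cf p i * cf r j - cf p j * cf r i) = h (cf p i * cf r j) - h (cf p j * cf r i)"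
      by (rule partial_hom_diff[OF SA h(1) a])
    also have "h (cf p i * cf r j) = h (cf p i) * h (cf r j)"
      by (intro partial_hom_mult[OF SA h(1)] cfA ijk) auto
    also have "h (cf p j * cf r i) = h (cf p j) * h (cf r i)"
      by (intro partial_hom_mult[OF SA h(1)] cfA ijk) auto
    finally show ?thesis using ijk by (simp add: cf_p)
  qed
  then have nz: "v' \<noteq> 0" "coeff p' i * coeff r' j \<noteq> coeff p' j * coeff r' i" using h(4) by auto
  have LA': "L p \<in> polys_over A" "L r \<in> polys_over A" "L u \<in> polys_over A" "L v \<in> polys_over A"
    using LA by auto
  define c where "c a = pf [:a:]" for a
  have cA: "c a \<in> A" for a unfolding c_def using A0 by blast
  define B where "B = bihom c F d e (L p) (L r) (L u) (L v)"
  define B' where "B' = [:pf [:0, 1:]:] * (L r ^ e * L v ^ d)"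
  have BA: "B \<in> polys_over A" unfolding B_def by (rule bihom_in_polys_over[OF SA cA LA'])
  have B'A: "[:pf [:0, 1:]:] \<in> polys_over A" "L r ^ e \<in> polys_over A" "L v ^ d \<in> polys_over A"
    "L r ^ e * L v ^ d \<in> polys_over A" "B' \<in> polys_over A"
  proof -
    show 1: "[:pf [:0, 1:]:] \<in> polys_over A" using A0 by (simp add: polys_over_pCons[OF SA] is_subring_0[OF S] subsetD)
    show 2: "L r ^ e \<in> polys_over A" "L v ^ d \<in> polys_over A" by (intro is_subring_power[OF S] LA')+
    show 3: "L r ^ e * L v ^ d \<in> polys_over A" by (intro is_subring_mult[OF S] 2)
    show "B' \<in> polys_over A" unfolding B'_def by (intro is_subring_mult[OF S] 1 3)
  qed
  \<comment> \<open>Evaluation at \<open>l\<close> outside \<open>Bad\<close> returns the equation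
    solved there, so each coefficient has finite support.\<close>
  have "coeff (B - B') n \<in> N" for n
  proof (rule IN, rule finite_subset[OF _ fin], rule subsetI, rule ccontr)
    fix l assume l: "l \<in> {l. coeff (B - B') n l \<noteq> 0}" "l \<notin> Bad"
    interpret ev: type_ring_hom "\<lambda>f :: 'k \<Rightarrow> 'k. f l" by (rule ev_hom)
    interpret evp: type_ring_hom "map_poly (\<lambda>f :: 'k \<Rightarrow> 'k. f l)" by (rule ev.map_poly_hom)
    have ph: "partial_hom UNIV (\<lambda>f :: 'k \<Rightarrow> 'k. f l)" by (simp add: partial_hom_def)
    have U: "is_subring (UNIV :: ('k \<Rightarrow> 'k) set)" by (simp add: is_subring_def)
    have "map_poly (\<lambda>f. f l) B = bihom (\<lambda>a. a) F d e (p l) (r l) (u l) (v l)"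
      unfolding B_def by (subst map_poly_bihom[OF U ph])
        (auto simp: polys_over_def c_def pf_def ev_L good[OF l(2)])
    moreover have "map_poly (\<lambda>f. f l) B' = [:l:] * (r l ^ e * v l ^ d)"
      unfolding B'_def evp.hom_mult evp.hom_power
      by (simp add: ev_L good[OF l(2)] ev.map_poly_hom_pCons) (simp add: pf_def)
    ultimately have "map_poly (\<lambda>f. f l) (B - B') = 0" unfolding evp.hom_diff using good(7)[OF l(2)] by simp
    then have "coeff (B - B') n l = 0" using ev.coeff_map_poly_hom[of "B - B'" n] by simp
    then show False using l(1) by simp
  qed
  then have "coeff (B - B') n \<in> A \<inter> N" for n using polys_overD[OF is_subring_diff[OF S BA B'A(5)]] by blast
  then have "map_poly h (B - B') = 0" using h(2) by (simp add: poly_eq_iff cm)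
  then have "map_poly h B = map_poly h B'" using partial_hom_diff[OF S M BA B'A(5)] by simp
  moreover have "map_poly h B = bihom (\<lambda>a. \<kappa> [:a:]) F d e p' r' u' v'"
    unfolding B_def map_poly_bihom[OF SA h(1) cA LA'] by (simp add: c_def hpf p'_def r'_def u'_def v'_def)
  moreover have "map_poly h B' = [:\<kappa> [:0, 1:]:] * (r' ^ e * v' ^ d)"
    unfolding B'_def partial_hom_mult[OF S M B'A(1,4)] partial_hom_mult[OF S M B'A(2,3)]
      partial_hom_power[OF S M LA'(2)] partial_hom_power[OF S M LA'(4)]
    by (simp add: map_poly_pCons partial_hom_0[OF SA h(1)] hpf r'_def v'_def)
  ultimately show ?thesis using nz by metis
qed

end

section \<open>Parametrizing the generic fibre\<close>

definition fract_ext :: "('a::idom \<Rightarrow> 'm::field) \<Rightarrow> 'a fract \<Rightarrow> 'm" where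
  "fract_ext h z = (SOME w. \<exists>p q. q \<noteq> 0 \<and> z = to_fract p / to_fract q \<and> w = h p / h q)"

lemma fract_ext_fract:
  assumes h: "type_ring_hom h" "\<And>x. h x = 0 \<Longrightarrow> x = 0" and q: "q \<noteq> 0"
  shows "fract_ext h (to_fract p / to_fract q) = h p / h q"
  unfolding fract_ext_def
proof (rule some_equality)
  show "\<exists>p' q'. q' \<noteq> 0 \<and> to_fract p / to_fract q = to_fract p' / to_fract q' \<and> h p / h q = h p' / h q'"
    using q by blast
next
  interpret h: type_ring_hom h by fact
  fix w assume "\<exists>p' q'. q' \<noteq> 0 \<and> to_fract p / to_fract q = to_fract p' / to_fract q' \<and> w = h p' / h q'"
  then obtain p' q' where *: "q' \<noteq> 0" "to_fract p / to_fract q = to_fract p' / to_fract q'" "w = h p' / h q'"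
    by blast
  have "to_fract (p * q') = to_fract (p' * q)" using * q by (simp add: field_simps)
  then have "p * q' = p' * q" unfolding to_fract_eq_iff .
  then have "h p * h q' = h p' * h q" by (simp flip: h.hom_mult)
  moreover have "h q \<noteq> 0" "h q' \<noteq> 0" using h(2) q *(1) by blast+
  ultimately show "w = h p / h q" unfolding *(3) by (simp add: field_simps)
qed

lemma field_embedding_fract_ext:
  assumes h: "type_ring_hom h" "\<And>x. h x = 0 \<Longrightarrow> x = 0"
  shows "field_embedding (fract_ext h)" and "fract_ext h (to_fract p) = h p"
proof -
  interpret h: type_ring_hom h by fact
  have ext: "fract_ext h (to_fract p / to_fract q) = h p / h q" if "q \<noteq> 0" for p q
    using fract_ext_fract[of h q p] h that by blast
  show to: "fract_ext h (to_fract p) = h p" for p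
    using ext[of 1 p] by (simp add: h.hom_1)
  have nz: "h q \<noteq> 0" if "q \<noteq> 0" for q using h(2) that by blast
  show "field_embedding (fract_ext h)"
  proof
    show "fract_ext h 1 = 1" using to[of 1] by (simp add: h.hom_1)
    fix x y :: "'a fract"
    obtain a b where x: "b \<noteq> 0" "x = to_fract a / to_fract b" by (cases x) (auto simp: Fract_conv_to_fract)
    obtain c d where y: "d \<noteq> 0" "y = to_fract c / to_fract d" by (cases y) (auto simp: Fract_conv_to_fract)
    have bd: "b * d \<noteq> 0" using x y by simp
    have "x + y = to_fract (a * d + c * b) / to_fract (b * d)"
      using x(1) y(1) unfolding x(2) y(2) by (simp add: field_simps)
    then show "fract_ext h (x + y) = fract_ext h x + fract_ext h y"
      using ext[OF bd, of "a * d + c * b"] ext[OF x(1), of a] ext[OF y(1), of c] nz[OF x(1)] nz[OF y(1)]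
      by (simp only: x(2) y(2) h.hom_simps) (simp add: field_simps)
    have "x * y = to_fract (a * c) / to_fract (b * d)" unfolding x(2) y(2) by simp
    then show "fract_ext h (x * y) = fract_ext h x * fract_ext h y"
      using ext[OF bd, of "a * c"] ext[OF x(1), of a] ext[OF y(1), of c]
      by (simp only: x(2) y(2) h.hom_simps) simp
  qed
qed

lemma fract_poly_clear_denominators:
  fixes q :: "'a::idom fract poly"
  assumes "q \<noteq> 0"
  obtains Q d where "d \<noteq> 0" "Q \<noteq> 0" "smult (to_fract d) q = map_poly to_fract Q"
proof -
  have "\<exists>Q d. d \<noteq> 0 \<and> smult (to_fract d) q = map_poly to_fract Q"
  proof (induction q)
    case 0
    show ?case by (intro exI[of _ 0] exI[of _ 1]) auto
  next
    case (pCons a q)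
    then obtain Q d where Q: "d \<noteq> 0" "smult (to_fract d) q = map_poly to_fract Q" by blast
    obtain x y where a: "y \<noteq> 0" "a = to_fract x / to_fract y" by (cases a) (auto simp: Fract_conv_to_fract)
    have "smult (to_fract (d * y)) (pCons a q) =
        pCons (to_fract (d * x)) (smult (to_fract y) (smult (to_fract d) q))"
      using a by (simp add: mult.commute)
    also have "\<dots> = map_poly to_fract (pCons (d * x) (smult y Q))"
      unfolding Q(2) by (simp add: map_poly_pCons)
    finally show ?case using Q(1) a(1) by (intro exI[of _ "pCons (d * x) (smult y Q)"] exI[of _ "d * y"]) simp
  qed
  then obtain Q d where "d \<noteq> 0" "smult (to_fract d) q = map_poly to_fract Q" by blast
  moreover from this have "Q \<noteq> 0" using assms by auto
  ultimately show ?thesis using that by blast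
qed

text \<open>With the trivial valuation ring of a field as base, the integrality criterion becomes a
  criterion for being algebraic over that field.\<close>

lemma valuation_ring_UNIV: "valuation_ring UNIV"
  by (simp add: valuation_ring_def)

context
  fixes \<kappa> :: "'k::alg_closed_field poly \<Rightarrow> 'c::alg_closed_field"
  assumes \<kappa>: "type_ring_hom \<kappa>" and \<kappa>_inj: "\<And>p. \<kappa> p = 0 \<Longrightarrow> p = 0"
begin

interpretation \<kappa>: type_ring_hom \<kappa> by (rule \<kappa>)

private lemma const_hom: "type_ring_hom (\<lambda>a. \<kappa> [:a:])"
proof
  fix x y
  show "\<kappa> [:x + y:] = \<kappa> [:x:] + \<kappa> [:y:]" using \<kappa>.hom_add[of "[:x:]" "[:y:]"] by simp
  show "\<kappa> [:x * y:] = \<kappa> [:x:] * \<kappa> [:y:]" using \<kappa>.hom_mult[of "[:x:]" "[:y:]"] by (simp add: mult.commute)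
  show "\<kappa> [:1:] = 1" using \<kappa>.hom_1 by (simp only: one_pCons)
qed

interpretation \<kappa>0: field_embedding "\<lambda>a. \<kappa> [:a:]"
  by (rule field_embedding.intro[OF const_hom])

private lemma fconst_hom: "type_ring_hom (\<lambda>a. fconst (\<kappa> [:a:]))"
  by (rule type_ring_hom_comp[OF const_hom fconst.type_ring_hom_axioms])

interpretation \<kappa>1: field_embedding "\<lambda>a. fconst (\<kappa> [:a:])"
  by (rule field_embedding.intro[OF fconst_hom])

lemma \<kappa>_poly: "poly (map_poly (\<lambda>a. \<kappa> [:a:]) p) (\<kappa> q) = \<kappa> (pcompose p q)"
proof -
  have "map_poly (\<lambda>a. \<kappa> [:a:]) p = map_poly \<kappa> (map_poly (\<lambda>x. [:x:]) p)"
    by (simp add: poly_eq_iff \<kappa>0.coeff_map_poly_hom \<kappa>.coeff_map_poly_hom coeff_map_poly)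
  then show ?thesis by (simp add: \<kappa>.poly_map_poly_hom pcompose_altdef)
qed

text \<open>A nonzero kernel would make \<open>\<eta>\<close>, and with it \<open>\<tau>\<close> as
  the value of \<open>F\<close>, algebraic over \<open>k(\<xi>)\<close>. But \<open>\<xi>\<close> is
  transcendental over a field containing \<open>k(\<tau>)\<close>, and \<open>\<tau>\<close> is
  transcendental over \<open>k\<close>.\<close>

lemma eval2_injective:
  assumes \<xi>: "\<xi> \<notin> range fconst"
    and F: "eval2 (\<lambda>a. fconst (\<kappa> [:a:])) \<xi> \<eta> F = fconst (\<kappa> [:0, 1:])"
    and G: "eval2 (\<lambda>a. fconst (\<kappa> [:a:])) \<xi> \<eta> G = 0"
  shows "G = 0"
proof (rule ccontr)
  assume G0: "G \<noteq> 0"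
  define s where "s p = poly (map_poly (\<lambda>a. fconst (\<kappa> [:a:])) p) \<xi>" for p
  have s_hom: "type_ring_hom s" using \<kappa>1.type_ring_hom_poly[of \<xi>] by (simp add: s_def[abs_def])
  have map_fconst: "map_poly (\<lambda>a. fconst (\<kappa> [:a:])) p = map_poly fconst (map_poly (\<lambda>a. \<kappa> [:a:]) p)" for p
    by (simp add: poly_eq_iff \<kappa>0.coeff_map_poly_hom \<kappa>1.coeff_map_poly_hom fconst.coeff_map_poly_hom)
  have s_inj: "p = 0" if "s p = 0" for p
  proof (rule ccontr)
    assume "p \<noteq> 0"
    then have "map_poly (\<lambda>a. \<kappa> [:a:]) p \<noteq> 0" by simp
    then show False using algebraic_over_constants[of "map_poly (\<lambda>a. \<kappa> [:a:]) p" \<xi>] that \<xi>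
      unfolding s_def map_fconst by blast
  qed
  define \<sigma> where "\<sigma> = fract_ext s"
  interpret \<sigma>: field_embedding \<sigma> unfolding \<sigma>_def by (rule field_embedding_fract_ext(1)[OF s_hom s_inj])
  have \<sigma>: "\<sigma> (to_fract p) = s p" for p unfolding \<sigma>_def by (rule field_embedding_fract_ext(2)[OF s_hom s_inj])
  interpret s: type_ring_hom s by (rule s_hom)
  have \<sigma>_map: "map_poly \<sigma> (map_poly to_fract Q) = map_poly s Q" for Q
    by (simp add: poly_eq_iff \<sigma>.coeff_map_poly_hom s.coeff_map_poly_hom coeff_map_poly \<sigma>)
  have ev: "eval2 (\<lambda>a. fconst (\<kappa> [:a:])) \<xi> y Q = poly (map_poly \<sigma> (map_poly to_fract Q)) y" for Q y
    unfolding \<sigma>_map eval2_def s_def[abs_def] ..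
  have "map_poly to_fract G \<noteq> 0" using G0 by simp
  moreover have "poly (map_poly \<sigma> (map_poly to_fract G)) \<eta> = 0" using G unfolding ev .
  ultimately obtain m where m: "\<sigma>.min_poly_of m \<eta>" using \<sigma>.min_poly_of_exists by blast
  define \<tau> where "\<tau> = \<kappa> [:0, 1:]"
  \<comment> \<open>A valuation ring containing \<open>k(\<xi>)\<close> contains the algebraic
    element \<open>\<eta>\<close> and then \<open>\<tau>\<close>, so the criterion makes
    \<open>\<tau>\<close> algebraic over \<open>k(\<xi>)\<close>.\<close>
  have "fconst \<tau> \<in> R" if R: "valuation_ring R" "\<sigma> -` R = UNIV" for R
  proof -
    note S = valuation_ring_is_subring[OF R(1)]
    have \<sigma>R: "map_poly \<sigma> q \<in> polys_over R" for q
      using R(2) by (auto simp: polys_over_def \<sigma>.coeff_map_poly_hom)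
    have "lead_coeff (map_poly \<sigma> m) = 1" "poly (map_poly \<sigma> m) \<eta> = 0"
      using m by (simp_all add: \<sigma>.min_poly_of_def \<sigma>.coeff_map_poly_hom \<sigma>.hom_1)
    then have "\<eta> \<in> R" using valuation_ring_integrally_closed[OF R(1) \<sigma>R] by blast
    then show ?thesis using poly_polys_over[OF S \<sigma>R] F unfolding ev \<tau>_def by metis
  qed
  from \<sigma>.integral_if_in_all_extensions[OF valuation_ring_UNIV this]
  obtain q where q: "lead_coeff q = 1" "poly (map_poly \<sigma> q) (fconst \<tau>) = 0" by blast
  then have "q \<noteq> 0" by auto
  then obtain Q d where Q: "d \<noteq> 0" "Q \<noteq> 0" "smult (to_fract d) q = map_poly to_fract Q"
    by (rule fract_poly_clear_denominators)
  have "map_poly \<sigma> (map_poly to_fract Q) = smult (\<sigma> (to_fract d)) (map_poly \<sigma> q)"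
    unfolding Q(3)[symmetric] by (simp add: poly_eq_iff \<sigma>.coeff_map_poly_hom \<sigma>.hom_mult)
  then have "poly (map_poly s Q) (fconst \<tau>) = 0" using q(2) unfolding \<sigma>_map by simp
  then have z: "(\<Sum>i\<le>degree Q. s (coeff Q i) * fconst \<tau> ^ i) = 0"
    using map_poly_degree_leq[of s Q] by (subst (asm) poly_eq_sum_le[of _ "degree Q"]) (simp_all add: s.coeff_map_poly_hom)
  \<comment> \<open>The relation between \<open>\<xi>\<close> and \<open>\<tau>\<close> is reordered
    as a polynomial in \<open>\<xi>\<close> with coefficients in \<open>k[\<tau>]\<close>.
    Transcendence of \<open>\<xi>\<close> makes these coefficients vanish, and
    \<open>\<kappa>_inj\<close> then makes \<open>Q\<close> vanish.\<close>
  define T where "T = (\<Sum>i\<le>degree Q. smult (\<tau> ^ i) (map_poly (\<lambda>a. \<kappa> [:a:]) (coeff Q i)))"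
  interpret E: type_ring_hom "\<lambda>p. poly (map_poly fconst p) \<xi>" by (rule fconst.type_ring_hom_poly)
  have sm: "poly (map_poly fconst (smult c p)) \<xi> = fconst c * poly (map_poly fconst p) \<xi>" for c p
    using E.hom_mult[of "[:c:]" p] by (simp add: fconst.map_poly_hom_pCons)
  have "poly (map_poly fconst T) \<xi> = 0"
    unfolding T_def E.hom_sum sm using z by (simp add: s_def map_fconst fconst.hom_power mult.commute)
  then have T0: "T = 0" using algebraic_over_constants[of T \<xi>] \<xi> by blast
  have "coeff (coeff Q i) j = 0" if "i \<le> degree Q" for i j
  proof -
    define B where "B = (\<Sum>i\<le>degree Q. monom (coeff (coeff Q i) j) i)"
    have mon: "\<kappa> (monom a i) = \<kappa> [:a:] * \<tau> ^ i" for a i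
    proof -
      have "monom a i = [:a:] * [:0, 1:] ^ i" by (simp add: monom_altdef)
      then show ?thesis unfolding \<tau>_def by (simp only: \<kappa>.hom_mult \<kappa>.hom_power)
    qed
    have "\<kappa> B = coeff T j"
      by (simp add: B_def T_def coeff_sum \<kappa>.hom_sum mon \<kappa>0.coeff_map_poly_hom mult.commute)
    then have "B = 0" using T0 \<kappa>_inj by simp
    moreover have "coeff B i = coeff (coeff Q i) j" using that by (simp add: B_def coeff_sum)
    ultimately show ?thesis by simp
  qed
  then have "coeff Q i = 0" if "i \<le> degree Q" for i using that by (simp add: poly_eq_iff)
  then have "lead_coeff Q = 0" by blast
  then show False using Q(2) by simp
qed

text \<open>The generic solution satisfies \<open>F = \<tau>\<close> and has nonconstant
  \<open>x\<close>-coordinate, so injectivity on all of \<open>A\<close> is automatic by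
  \<open>eval2_injective\<close>. The degree bound requires \<open>F\<close> to involve
  \<open>y\<close>; the remaining case is treated by hand.\<close>

theorem generic_parametrization:
  assumes "generally_rational F"
  shows "\<exists>\<psi> :: 'k poly poly \<Rightarrow> 'c poly fract. type_ring_hom \<psi> \<and> (\<forall>G. \<psi> G = 0 \<longrightarrow> G = 0) \<and>
    (\<forall>a. \<psi> (kconst a) = fconst (\<kappa> [:a:])) \<and> \<psi> F = fconst (\<kappa> [:0, 1:]) \<and> (\<exists>G. \<psi> G \<notin> range fconst)"
proof -
  define Bad where "Bad = {l. \<not> (irreducible (F - kconst l) \<and> frac_quotient_is_rational (F - kconst l))}"
  have fin: "finite Bad" using assms by (simp add: generally_rational_def Bad_def)
  show ?thesis
  proof (cases "degree F = 0")
    case False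
    define d where "d = degree F"
    define e where "e = (\<Sum>j\<le>d. degree (coeff F j))"
    have e: "degree (coeff F j) \<le> e" for j
    proof (cases "j \<le> d")
      case True
      then show ?thesis unfolding e_def by (intro member_le_sum) auto
    next
      case False
      then show ?thesis by (simp add: coeff_eq_0 d_def)
    qed
    have sol: "\<exists>p r u v :: 'k poly. degree p \<le> d * Suc e \<and> degree r \<le> d * Suc e \<and>
      degree u \<le> d * Suc e \<and> degree v \<le> d * Suc e \<and> v \<noteq> 0 \<and>
      (\<exists>i j. coeff p i * coeff r j \<noteq> coeff p j * coeff r i) \<and>
      bihom (\<lambda>a. a) F d e p r u v = [:l:] * (r ^ e * v ^ d)" if "l \<notin> Bad" for l
      unfolding bihom_def using that False e
      by (intro bounded_parametrization) (auto simp: Bad_def d_def)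
    from generic_solution[OF \<kappa> \<kappa>_inj fin sol]
    obtain p r u v :: "'c poly" where P: "v \<noteq> 0" "\<exists>i j. coeff p i * coeff r j \<noteq> coeff p j * coeff r i"
      "bihom (\<lambda>a. \<kappa> [:a:]) F d e p r u v = [:\<kappa> [:0, 1:]:] * (r ^ e * v ^ d)" by blast
    have r: "r \<noteq> 0" using P(2) by auto
    define \<xi> where "\<xi> = to_fract p / to_fract r"
    define \<eta> where "\<eta> = to_fract u / to_fract v"
    have \<xi>: "\<xi> \<notin> range fconst"
    proof
      assume "\<xi> \<in> range fconst"
      then obtain c where "to_fract p = to_fract ([:c:] * r)"
        using r unfolding to_fract_mult by (auto simp: \<xi>_def fconst_def field_simps)
      then have "p = [:c:] * r" unfolding to_fract_eq_iff .
      then have "p = smult c r" by simp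
      then show False using P(2) by (auto simp: mult_ac)
    qed
    interpret T: type_ring_hom "to_fract :: 'c poly \<Rightarrow> _" by standard auto
    have nz: "to_fract r \<noteq> 0" "to_fract v \<noteq> 0" using r P(1) by auto
    have deg: "degree F \<le> d" by (simp add: d_def)
    have "to_fract (bihom (\<lambda>a. \<kappa> [:a:]) F d e p r u v) =
        to_fract r ^ e * to_fract v ^ d * eval2 (\<lambda>a. fconst (\<kappa> [:a:])) \<xi> \<eta> F"
      using eval2_bihomogeneous[OF fconst_hom nz deg e, of "to_fract p" "to_fract u"]
      unfolding \<xi>_def \<eta>_def bihom_def fconst_def to_fract_sum T.hom_mult T.hom_power .
    also have "to_fract (bihom (\<lambda>a. \<kappa> [:a:]) F d e p r u v) = fconst (\<kappa> [:0, 1:]) * (to_fract r ^ e * to_fract v ^ d)"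
      unfolding P(3) fconst_def T.hom_mult T.hom_power ..
    finally have \<tau>: "eval2 (\<lambda>a. fconst (\<kappa> [:a:])) \<xi> \<eta> F = fconst (\<kappa> [:0, 1:])"
      using nz by simp
    show ?thesis
      using type_ring_hom_eval2[OF fconst_hom, of \<xi> \<eta>] eval2_injective[OF \<xi> \<tau>] \<tau>
        eval2_simps[OF fconst_hom, of \<xi> \<eta>] \<xi>
      by (intro exI[of _ "eval2 (\<lambda>a. fconst (\<kappa> [:a:])) \<xi> \<eta>"]) metis
  next
    \<comment> \<open>Now \<open>F\<close> is a polynomial in \<open>x\<close>. Irreducibility of
      one good fibre over an algebraically closed field makes it linear; \<open>x0\<close> is its
      inverse under composition, and \<open>y\<close> is the parameter of the generic line.\<close>
    case True
    then obtain g where g: "F = [:g:]" by (auto elim: degree_eq_zeroE)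
    obtain l where "l \<notin> Bad" using fin infinite_UNIV_alg_closed[where 'k = 'k] by (metis ex_new_if_finite)
    then have "irreducible [:g - [:l:]:]" by (simp add: Bad_def g kconst_def)
    then have irr: "irreducible (g - [:l:])" by (simp add: irreducible_const_poly_iff)
    then have "degree (g - [:l:]) \<noteq> 0" by (auto simp: irreducible_def is_unit_iff_degree)
    then obtain a where "poly (g - [:l:]) a = 0" using alg_closed_imp_poly_has_root by blast
    then obtain q where q: "g - [:l:] = [:-a, 1:] * q" using poly_root_factor by blast
    have "is_unit [:-a, 1:] \<or> is_unit q" by (rule irreducibleD[OF irr q])
    moreover have "\<not> is_unit [:-a, 1:]" by (simp add: is_unit_iff_degree)
    ultimately obtain \<alpha> where \<alpha>: "q = [:\<alpha>:]" "\<alpha> \<noteq> 0" by (auto simp: is_unit_poly_iff dvd_field_iff)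
    define \<beta> where "\<beta> = l - \<alpha> * a"
    have "g = [:-a, 1:] * q + [:l:]" using q by (simp add: algebra_simps)
    then have g': "g = [:\<beta>, \<alpha>:]" by (simp add: \<alpha> \<beta>_def)
    define x0 where "x0 = [:- \<beta> / \<alpha>, 1 / \<alpha>:]"
    define \<xi> where "\<xi> = fconst (\<kappa> x0)"
    define \<eta> :: "'c poly fract" where "\<eta> = to_fract [:0, 1:]"
    have lin: "pcompose g x0 = [:0, 1:]" using \<alpha> by (simp add: g' x0_def pcompose_pCons)
    have ev1: "poly (map_poly (\<lambda>a. fconst (\<kappa> [:a:])) p) \<xi> = fconst (\<kappa> (pcompose p x0))" for p
    proof -
      have "map_poly (\<lambda>a. fconst (\<kappa> [:a:])) p = map_poly fconst (map_poly (\<lambda>a. \<kappa> [:a:]) p)"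
        by (simp add: poly_eq_iff \<kappa>0.coeff_map_poly_hom \<kappa>1.coeff_map_poly_hom fconst.coeff_map_poly_hom)
      then show ?thesis unfolding \<xi>_def by (simp only: fconst.poly_map_poly_hom \<kappa>_poly)
    qed
    have \<tau>: "eval2 (\<lambda>a. fconst (\<kappa> [:a:])) \<xi> \<eta> F = fconst (\<kappa> [:0, 1:])"
      unfolding g eval2_const[OF fconst_hom] ev1 lin ..
    have inj: "G = 0" if G: "eval2 (\<lambda>a. fconst (\<kappa> [:a:])) \<xi> \<eta> G = 0" for G
    proof -
      define T where "T = map_poly (\<lambda>p. \<kappa> (pcompose p x0)) G"
      have cT: "coeff T j = \<kappa> (pcompose (coeff G j) x0)" for j
        by (simp add: T_def coeff_map_poly \<kappa>.hom_0)
      have "map_poly (\<lambda>g. poly (map_poly (\<lambda>a. fconst (\<kappa> [:a:])) g) \<xi>) G = map_poly fconst T"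
        by (simp add: poly_eq_iff ev1 fconst.coeff_map_poly_hom cT coeff_map_poly \<kappa>.hom_0 fconst.hom_0)
      then have "to_fract T = 0"
        using G unfolding eval2_def \<eta>_def by (simp add: to_fract_eq_poly[of T])
      then have "pcompose (coeff G j) x0 = 0" for j using \<kappa>_inj cT[of j] by simp
      moreover have "degree x0 > 0" using \<alpha> by (simp add: x0_def)
      ultimately have "coeff G j = 0" for j using pcompose_eq_0 by blast
      then show ?thesis by (simp add: poly_eq_iff)
    qed
    have "\<eta> \<notin> range fconst"
    proof
      assume "\<eta> \<in> range fconst"
      then obtain c where "to_fract [:0, 1:] = to_fract [:c :: 'c:]" by (auto simp: \<eta>_def fconst_def)
      then show False unfolding to_fract_eq_iff by simp
    qed
    then show ?thesis
      using type_ring_hom_eval2[OF fconst_hom, of \<xi> \<eta>] inj \<tau> eval2_simps[OF fconst_hom, of \<xi> \<eta>]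
      by (intro exI[of _ "eval2 (\<lambda>a. fconst (\<kappa> [:a:])) \<xi> \<eta>"]) metis
  qed
qed

end

section \<open>Valuations of the generic fibre\<close>

lemma bidegree_diff_kconst_le: "bidegree (u - kconst c) \<le> bidegree u"
proof (cases "degree u = 0")
  case True
  then obtain g where g: "u = [:g:]" by (auto elim: degree_eq_zeroE)
  have "degree (g - [:c:]) \<le> degree g" by (intro degree_diff_le) auto
  then show ?thesis by (simp add: bidegree_def g kconst_def)
next
  case False
  have c: "coeff (u - kconst c) i = coeff u i" if "i \<noteq> 0" for i
    using that by (simp add: kconst_def coeff_pCons split: nat.split)
  have "degree (u - kconst c) = degree u"
  proof (rule antisym)
    show "degree (u - kconst c) \<le> degree u"
      by (rule degree_le) (use c False in \<open>auto simp: coeff_eq_0\<close>)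
    show "degree u \<le> degree (u - kconst c)"
      by (rule le_degree) (use c[OF False] False in auto)
  qed
  then show ?thesis using c[OF False] by (simp add: bidegree_def)
qed

locale generic_fibration =
  fixes F :: "'k::alg_closed_field poly poly"
    and \<psi> :: "'k poly poly \<Rightarrow> 'k poly fract alg_closure poly fract"
  assumes gen_rat: "generally_rational F"
    and \<psi>_hom: "type_ring_hom \<psi>"
    and \<psi>_inj: "\<psi> G = 0 \<Longrightarrow> G = 0"
    and \<psi>_const: "\<psi> (kconst a) = fconst (to_ac (to_fract [:a:]))"
    and \<psi>_F: "\<psi> F = fconst (to_ac (to_fract [:0, 1:]))"
    and \<psi>_nonconst: "\<exists>G. \<psi> G \<notin> range fconst"
begin

interpretation \<psi>: type_ring_hom \<psi> by (rule \<psi>_hom)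

abbreviation Fev :: "'k poly \<Rightarrow> 'k poly poly" where "Fev p \<equiv> subst_F p F"

lemma type_ring_hom_Fev: "type_ring_hom Fev"
  unfolding subst_F_def by (rule type_ring_hom.type_ring_hom_poly[OF type_ring_hom_kconst])

sublocale Fev: type_ring_hom Fev by (rule type_ring_hom_Fev)

lemma Fev_const: "Fev [:c:] = kconst c"
  by (simp add: subst_F_def map_poly_pCons type_ring_hom.hom_0[OF type_ring_hom_kconst])

lemma Fev_linear: "Fev [:-c, 1:] = F - kconst c"
  using type_ring_hom.hom_uminus[OF type_ring_hom_kconst, of c]
  by (simp add: subst_F_def type_ring_hom.map_poly_hom_pCons[OF type_ring_hom_kconst]
      type_ring_hom.hom_1[OF type_ring_hom_kconst])

lemma hom_Fev:
  assumes h: "type_ring_hom h"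
  shows "h (Fev p) = poly (map_poly (\<lambda>a. h (kconst a)) p) (h F)"
proof -
  interpret h: type_ring_hom h by fact
  have "map_poly (\<lambda>a. h (kconst a)) p = map_poly h (map_poly kconst p)"
    by (simp add: poly_eq_iff h.coeff_map_poly_hom coeff_map_poly
        type_ring_hom.hom_0[OF type_ring_hom_kconst] h.hom_0)
  then show ?thesis by (simp add: subst_F_def h.poly_map_poly_hom)
qed

lemma \<psi>_Fev: "\<psi> (Fev p) = fconst (to_ac (to_fract p))"
proof -
  have K: "type_ring_hom (\<lambda>p :: 'k poly. fconst (to_ac (to_fract p)))"
    by standard (simp_all add: fconst.hom_simps)
  have "map_poly (\<lambda>a. \<psi> (kconst a)) p = map_poly (\<lambda>q. fconst (to_ac (to_fract q))) (map_poly (\<lambda>a. [:a:]) p)"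
    by (simp add: poly_eq_iff \<psi>_const type_ring_hom.coeff_map_poly_hom[OF K] coeff_map_poly fconst.hom_0)
  then have "\<psi> (Fev p) = fconst (to_ac (to_fract (poly (map_poly (\<lambda>a. [:a:]) p) [:0, 1:])))"
    unfolding hom_Fev[OF \<psi>_hom] \<psi>_F by (simp only: type_ring_hom.poly_map_poly_hom[OF K])
  then show ?thesis by (simp flip: pcompose_altdef)
qed

lemma Fev_inj: "Fev p = 0 \<Longrightarrow> p = 0"
  using \<psi>_Fev[of p] by (simp add: \<psi>.hom_0)

lemma Fev_eq_iff: "Fev p = Fev q \<longleftrightarrow> p = q"
  using Fev_inj[of "p - q"] by (auto simp: Fev.hom_diff)

lemma F_minus_not_unit: "\<not> is_unit (F - kconst l)" and F_minus_nonzero: "F - kconst l \<noteq> 0"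
proof -
  have n: "F - kconst l \<noteq> kconst c" for c
    unfolding Fev_linear[symmetric, of l] Fev_const[symmetric, of c] Fev_eq_iff by simp
  show "\<not> is_unit (F - kconst l)" using bivariate_unit n by blast
  show "F - kconst l \<noteq> 0" using n[of 0] unfolding type_ring_hom.hom_0[OF type_ring_hom_kconst] .
qed

definition bad_fibres :: "'k set" where
  "bad_fibres = {l. \<not> (irreducible (F - kconst l) \<and> frac_quotient_is_rational (F - kconst l))}"

lemma finite_bad_fibres: "finite bad_fibres"
  using gen_rat by (simp add: generally_rational_def bad_fibres_def)

text \<open>Write \<open>u\<close> as \<open>kconst c0 + (F - kconst l0) * u1\<close>. On any other
  fibre where \<open>u\<close> has the value \<open>c\<close>, \<open>u1\<close> has the value
  \<open>(c - c0) / (l - l0)\<close>, so \<open>u1\<close> inherits the hypothesis with smaller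
  \<open>bidegree\<close>.\<close>

lemma constant_on_fibres_imp_in_kF:
  assumes "infinite {l. \<exists>c. F - kconst l dvd u - kconst c}"
  shows "u \<in> range Fev"
  using assms
proof (induction "bidegree u" arbitrary: u rule: less_induct)
  case less
  interpret k: type_ring_hom "kconst :: 'k \<Rightarrow> _" by (rule type_ring_hom_kconst)
  obtain l0 c0 where l0: "F - kconst l0 dvd u - kconst c0"
    using less.prems not_finite_existsD by blast
  then obtain u1 where u1: "u - kconst c0 = (F - kconst l0) * u1" by (elim dvdE)
  then have u_eq: "u = kconst c0 + (F - kconst l0) * u1" by (simp add: algebra_simps)
  show ?case
  proof (cases "u1 = 0")
    case True
    then have "u = Fev [:c0:]" using u_eq by (simp add: Fev_const)
    then show ?thesis by blast
  next
    case False
    have "bidegree (F - kconst l0) > 0" using F_minus_nonzero F_minus_not_unit by (rule bidegree_pos)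
    then have "bidegree u1 < bidegree (u - kconst c0)"
      unfolding u1 using bidegree_mult[OF F_minus_nonzero False] by simp
    then have d: "bidegree u1 < bidegree u" using bidegree_diff_kconst_le[of u c0] by simp
    have "{l. \<exists>c. F - kconst l dvd u - kconst c} - {l0} \<subseteq> {l. \<exists>c. F - kconst l dvd u1 - kconst c}"
    proof
      fix l assume "l \<in> {l. \<exists>c. F - kconst l dvd u - kconst c} - {l0}"
      then obtain c where l: "l \<noteq> l0" "F - kconst l dvd u - kconst c" by blast
      have "u - kconst c = (F - kconst l) * u1 + (kconst (l - l0) * u1 - kconst (c - c0))"
        by (simp add: u_eq k.hom_diff algebra_simps)
      then have "F - kconst l dvd kconst (l - l0) * u1 - kconst (c - c0)"
        using l(2) by (simp add: dvd_add_right_iff)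
      then have "F - kconst l dvd kconst (inverse (l - l0)) * (kconst (l - l0) * u1 - kconst (c - c0))"
        by (rule dvd_mult)
      also have "kconst (inverse (l - l0)) * (kconst (l - l0) * u1 - kconst (c - c0)) =
          (kconst (inverse (l - l0)) * kconst (l - l0)) * u1 - kconst (inverse (l - l0)) * kconst (c - c0)"
        by (simp only: right_diff_distrib mult.assoc)
      also have "kconst (inverse (l - l0)) * kconst (l - l0) = kconst (inverse (l - l0) * (l - l0))"
        by (rule k.hom_mult[symmetric])
      also have "inverse (l - l0) * (l - l0) = 1" using l(1) by simp
      also have "kconst (inverse (l - l0)) * kconst (c - c0) = kconst (inverse (l - l0) * (c - c0))"
        by (rule k.hom_mult[symmetric])
      finally have "F - kconst l dvd u1 - kconst (inverse (l - l0) * (c - c0))" by (simp only: k.hom_1 mult_1)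
      then show "l \<in> {l. \<exists>c. F - kconst l dvd u1 - kconst c}" by blast
    qed
    then have "infinite {l. \<exists>c. F - kconst l dvd u1 - kconst c}"
      using less.prems by (meson finite_Diff2 finite_subset finite.emptyI finite.insertI)
    from less.hyps[OF d this] obtain g where "u1 = Fev g" by blast
    then have "u = Fev ([:c0:] + [:-l0, 1:] * g)"
      unfolding u_eq by (simp only: Fev.hom_add Fev.hom_mult Fev_const Fev_linear)
    then show ?thesis by blast
  qed
qed

text \<open>On a good fibre where the leading coefficient of \<open>Q\<close> does not vanish,
  \<open>u\<close> restricts to an element of \<open>k(t)\<close> algebraic over \<open>k\<close>,
  hence to a constant.\<close>

lemma algebraic_over_kF:
  assumes Q: "Q \<noteq> 0" "poly (map_poly Fev Q) u = 0"
  shows "u \<in> range Fev"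
proof (rule constant_on_fibres_imp_in_kF)
  define X where "X = bad_fibres \<union> {l. poly (lead_coeff Q) l = 0}"
  have "finite X" unfolding X_def using finite_bad_fibres poly_roots_finite[of "lead_coeff Q"] Q by simp
  moreover have "- X \<subseteq> {l. \<exists>c. F - kconst l dvd u - kconst c}"
  proof
    fix l assume l: "l \<in> - X"
    then have "frac_quotient_is_rational (F - kconst l)" by (auto simp: X_def bad_fibres_def)
    then obtain \<phi> :: "'k poly poly \<Rightarrow> 'k poly fract" where
      \<phi>: "\<forall>a b. \<phi> (a + b) = \<phi> a + \<phi> b" "\<forall>a b. \<phi> (a * b) = \<phi> a * \<phi> b" "\<phi> 1 = 1"
        "\<forall>c. \<phi> (kconst c) = to_fract [:c:]" "\<forall>a. \<phi> a = 0 \<longleftrightarrow> F - kconst l dvd a"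
      unfolding frac_quotient_is_rational_def by (elim exE conjE)
    interpret \<phi>: type_ring_hom \<phi> using \<phi> by unfold_locales auto
    have c: "\<phi> (kconst a) = fconst a" for a using \<phi>(4) by (simp add: fconst_def)
    have "\<phi> (F - kconst l) = 0" using \<phi>(5) by simp
    then have F: "\<phi> F = fconst l" by (simp add: \<phi>.hom_diff c)
    have Fe: "\<phi> (Fev p) = fconst (poly p l)" for p
      unfolding hom_Fev[OF \<phi>.type_ring_hom_axioms] c F by (rule fconst.poly_map_poly_hom)
    define q where "q = map_poly (\<lambda>p. poly p l) Q"
    interpret e: type_ring_hom "\<lambda>p. poly p l" by standard auto
    have "coeff q (degree Q) \<noteq> 0" using l by (simp add: q_def X_def e.coeff_map_poly_hom)
    then have q0: "q \<noteq> 0" by auto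
    have "map_poly \<phi> (map_poly Fev Q) = map_poly fconst q"
      by (simp add: poly_eq_iff \<phi>.coeff_map_poly_hom Fev.coeff_map_poly_hom fconst.coeff_map_poly_hom
          q_def e.coeff_map_poly_hom Fe)
    then have "poly (map_poly fconst q) (\<phi> u) = \<phi> (poly (map_poly Fev Q) u)"
      using \<phi>.poly_map_poly_hom[of "map_poly Fev Q" u] by simp
    then have "\<phi> u \<in> range fconst" using algebraic_over_constants[OF q0] Q(2) \<phi>.hom_0 by simp
    then obtain x where "\<phi> u = fconst x" by blast
    then have "\<phi> (u - kconst x) = 0" by (simp add: \<phi>.hom_diff c)
    then show "l \<in> {l. \<exists>c. F - kconst l dvd u - kconst c}" using \<phi>(5) by blast
  qed
  ultimately show "infinite {l. \<exists>c. F - kconst l dvd u - kconst c}"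
    using infinite_UNIV_alg_closed[where 'k = 'k] finite_compl finite_subset by blast
qed

text \<open>The isomorphism of the abstract field \<open>k(\<tau>)\<close> onto \<open>k(F)\<close>,
  by which valuation rings containing \<open>k(F)\<close> become extensions of the trivial
  one.\<close>

definition \<theta> :: "'k poly fract \<Rightarrow> 'k poly poly fract" where
  "\<theta> = fract_ext (\<lambda>p. to_fract (Fev p))"

lemma to_fract_Fev_hom: "type_ring_hom (\<lambda>p. to_fract (Fev p))"
  by standard (simp_all add: Fev.hom_simps)

lemma to_fract_Fev_inj: "to_fract (Fev p) = 0 \<Longrightarrow> p = 0"
  using Fev_inj by simp

sublocale \<theta>: field_embedding \<theta>
  unfolding \<theta>_def by (rule field_embedding_fract_ext(1)[OF to_fract_Fev_hom to_fract_Fev_inj])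

lemma \<theta>_to_fract: "\<theta> (to_fract p) = to_fract (Fev p)"
  unfolding \<theta>_def by (rule field_embedding_fract_ext(2)[OF to_fract_Fev_hom to_fract_Fev_inj])

lemma kF_eq: "kF F = range \<theta>"
proof (intro equalityI subsetI)
  fix z assume "z \<in> kF F"
  then obtain a b where "z = to_fract (Fev a) / to_fract (Fev b)" unfolding kF_def by blast
  then have "z = \<theta> (to_fract a / to_fract b)" by (simp add: \<theta>.hom_divide \<theta>_to_fract)
  then show "z \<in> range \<theta>" by blast
next
  fix z assume "z \<in> range \<theta>"
  then obtain y where "z = \<theta> y" by blast
  moreover obtain a b where "b \<noteq> 0" "y = to_fract a / to_fract b" by (cases y) (auto simp: Fract_conv_to_fract)
  ultimately have "z = to_fract (Fev a) / to_fract (Fev b)" "Fev b \<noteq> 0"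
    using Fev_inj by (auto simp: \<theta>.hom_divide \<theta>_to_fract)
  then show "z \<in> kF F" unfolding kF_def by blast
qed

text \<open>The valuation rings containing \<open>k(F)\<close> are those with trivial preimage under
  \<open>\<theta>\<close>. So the element is algebraic over \<open>k(F)\<close>, and clearing
  denominators leads to \<open>algebraic_over_kF\<close>.\<close>

lemma in_all_valuation_rings_imp_in_kF:
  assumes "\<And>R. valuation_ring R \<Longrightarrow> kF F \<subseteq> R \<Longrightarrow> to_fract a \<in> R"
  shows "a \<in> range Fev"
proof -
  have "to_fract a \<in> R" if "valuation_ring R" "\<theta> -` R = UNIV" for R
    using assms that by (auto simp: kF_eq)
  from \<theta>.integral_if_in_all_extensions[OF valuation_ring_UNIV this]
  obtain q where q: "lead_coeff q = 1" "poly (map_poly \<theta> q) (to_fract a) = 0" by blast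
  then have "q \<noteq> 0" by auto
  then obtain Q d where Q: "d \<noteq> 0" "Q \<noteq> 0" "smult (to_fract d) q = map_poly to_fract Q"
    by (rule fract_poly_clear_denominators)
  have "map_poly \<theta> (map_poly to_fract Q) = smult (\<theta> (to_fract d)) (map_poly \<theta> q)"
    unfolding Q(3)[symmetric] by (simp add: poly_eq_iff \<theta>.coeff_map_poly_hom \<theta>.hom_mult)
  moreover have "map_poly \<theta> (map_poly to_fract Q) = map_poly to_fract (map_poly Fev Q)"
    by (simp add: poly_eq_iff \<theta>.coeff_map_poly_hom coeff_map_poly \<theta>_to_fract Fev.hom_0)
  ultimately have "poly (map_poly to_fract (map_poly Fev Q)) (to_fract a) = 0" using q(2) by simp
  moreover interpret T: type_ring_hom "to_fract :: 'k poly poly \<Rightarrow> _" by standard auto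
  have "poly (map_poly to_fract (map_poly Fev Q)) (to_fract a) = to_fract (poly (map_poly Fev Q) a)"
    by (rule T.poly_map_poly_hom)
  ultimately have "poly (map_poly Fev Q) a = 0" by simp
  then show ?thesis by (rule algebraic_over_kF[OF Q(2)])
qed

definition \<iota> :: "'k poly poly fract \<Rightarrow> 'k poly fract alg_closure poly fract" where
  "\<iota> = fract_ext \<psi>"

sublocale \<iota>: field_embedding \<iota>
  unfolding \<iota>_def by (rule field_embedding_fract_ext(1)[OF \<psi>_hom \<psi>_inj])

lemma \<iota>_to_fract: "\<iota> (to_fract p) = \<psi> p"
  unfolding \<iota>_def by (rule field_embedding_fract_ext(2)[OF \<psi>_hom \<psi>_inj])

lemma \<iota>_\<theta>: "\<iota> (\<theta> z) = fconst (to_ac z)"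
proof -
  obtain a b where "b \<noteq> 0" "z = to_fract a / to_fract b" by (cases z) (auto simp: Fract_conv_to_fract)
  then show ?thesis
    by (simp add: \<theta>.hom_divide \<iota>.hom_divide \<theta>_to_fract \<iota>_to_fract \<psi>_Fev fconst.hom_divide)
qed

lemma fconst_subset_valuation_ring:
  assumes R: "valuation_ring R" "kF F \<subseteq> \<iota> -` R"
  shows "range fconst \<subseteq> R"
proof
  fix z :: "'k poly fract alg_closure poly fract" assume "z \<in> range fconst"
  then obtain c where c: "z = fconst c" by blast
  obtain p where p: "p \<noteq> 0" "poly (map_poly to_ac p) c = 0" by (rule alg_closure_algebraic)
  have th: "type_ring_hom (to_ac :: 'k poly fract \<Rightarrow> _)" by standard auto
  interpret ta: field_embedding "to_ac :: 'k poly fract \<Rightarrow> _" by (rule field_embedding.intro[OF th])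
  obtain m where m: "ta.min_poly_of m c" using ta.min_poly_of_exists[OF p] by blast
  let ?m = "map_poly fconst (map_poly to_ac m)"
  have "fconst (to_ac x) \<in> R" for x using R(2) by (auto simp: kF_eq simp flip: \<iota>_\<theta>)
  then have "?m \<in> polys_over R"
    by (simp add: polys_over_def fconst.coeff_map_poly_hom ta.coeff_map_poly_hom)
  moreover have "lead_coeff ?m = 1" "poly ?m (fconst c) = 0"
    using m by (simp_all add: ta.min_poly_of_def fconst.coeff_map_poly_hom ta.coeff_map_poly_hom
        fconst.hom_simps fconst.poly_map_poly_hom)
  ultimately show "z \<in> R" using valuation_ring_integrally_closed[OF R(1)] c by blast
qed

text \<open>A proper ring would have residue field \<open>K'\<close>. The residue \<open>c\<close>
  of the nonconstant \<open>\<psi> G\<close> is a root of some nonzero \<open>p\<close> over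
  \<open>k(F)\<close>; then \<open>p\<close> at \<open>\<psi> G\<close> is a nonunit of
  \<open>R\<close>, although it is a nonzero element of the image of \<open>Frac A\<close>, which
  \<open>R\<close> contains.\<close>

lemma valuation_ring_over_L:
  assumes R: "valuation_ring R" "\<iota> -` R = UNIV"
  shows "R = UNIV"
proof (rule ccontr)
  assume proper: "R \<noteq> UNIV"
  have const: "range fconst \<subseteq> R" using fconst_subset_valuation_ring[OF R(1)] R(2) by blast
  obtain G where G: "\<psi> G \<notin> range fconst" using \<psi>_nonconst by blast
  have GR: "\<psi> G \<in> R" using R(2) by (auto simp flip: \<iota>_to_fract)
  then obtain c where c: "\<psi> G - fconst c \<in> vmax R"
    using residue_field_constants[OF R(1) const proper] by blast
  obtain p where p: "p \<noteq> 0" "poly (map_poly to_ac p) c = 0" by (rule alg_closure_algebraic)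
  then obtain q where q: "map_poly to_ac p = [:-c, 1:] * q" using poly_root_factor by blast
  interpret E: type_ring_hom "\<lambda>p. poly (map_poly fconst p) (\<psi> G)" by (rule fconst.type_ring_hom_poly)
  have "poly (map_poly fconst (map_poly to_ac p)) (\<psi> G) = (\<psi> G - fconst c) * poly (map_poly fconst q) (\<psi> G)"
    unfolding q E.hom_mult by (simp add: fconst.map_poly_hom_pCons fconst.hom_simps)
  also have "map_poly fconst q \<in> polys_over R" using const by (auto simp: polys_over_def fconst.coeff_map_poly_hom)
  then have "(\<psi> G - fconst c) * poly (map_poly fconst q) (\<psi> G) \<in> vmax R"
    by (intro vmax_mult[OF R(1) c] poly_polys_over[OF valuation_ring_is_subring[OF R(1)] _ GR])
  finally have v: "poly (map_poly fconst (map_poly to_ac p)) (\<psi> G) \<in> vmax R" .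
  have "map_poly fconst (map_poly to_ac p) = map_poly \<iota> (map_poly \<theta> p)"
    by (simp add: poly_eq_iff fconst.coeff_map_poly_hom \<iota>.coeff_map_poly_hom \<theta>.coeff_map_poly_hom
        coeff_map_poly \<iota>_\<theta>)
  then have eq: "poly (map_poly fconst (map_poly to_ac p)) (\<psi> G) = \<iota> (poly (map_poly \<theta> p) (to_fract G))"
    by (simp flip: \<iota>_to_fract \<iota>.poly_map_poly_hom)
  have "map_poly to_ac p \<noteq> 0" using p(1) by (simp add: map_poly_eq_0_iff)
  then have "poly (map_poly fconst (map_poly to_ac p)) (\<psi> G) \<noteq> 0"
    using algebraic_over_constants G by blast
  then have "inverse (poly (map_poly fconst (map_poly to_ac p)) (\<psi> G)) \<notin> R" using v by (simp add: vmax_def)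
  then show False using R(2) unfolding eq by (auto simp flip: \<iota>.hom_inverse)
qed

text \<open>No nontrivial valuation of \<open>K'(s)\<close> is trivial on the image of
  \<open>Frac A\<close>, so the integrality criterion applies to every \<open>f\<close>. This
  provides the minimal polynomials needed for norm-like elements.\<close>

lemma algebraic_over_L: "\<exists>q. q \<noteq> 0 \<and> poly (map_poly \<iota> q) f = 0"
proof -
  have "f \<in> R" if "valuation_ring R" "\<iota> -` R = UNIV" for R
    using valuation_ring_over_L[OF that] by simp
  from \<iota>.integral_if_in_all_extensions[OF valuation_ring_UNIV this]
  obtain q where "lead_coeff q = 1" "poly (map_poly \<iota> q) f = 0" by blast
  then show ?thesis by (intro exI[of _ q]) auto
qed

lemma extension_is_place_ring:
  assumes "valuation_ring R'" "kF F \<subseteq> \<iota> -` R'" "R' \<noteq> UNIV"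
  shows "\<exists>P. R' = place_ring P"
  by (rule valuation_ring_rational_function_field[OF assms(1) fconst_subset_valuation_ring[OF assms(1,2)] assms(3)])

text \<open>Chevalley's theorem extends \<open>R\<close>, and the classification over
  \<open>K'\<close> identifies the extension. This equips an abstract valuation ring with an
  integer-valued order.\<close>

lemma dicritical_place_exists:
  assumes "R \<in> dicriticals F"
  shows "\<exists>P. valuation_ring (place_ring P) \<and> \<iota> -` place_ring P = R"
proof -
  have R: "valuation_ring R" "kF F \<subseteq> R" "R \<noteq> UNIV" using assms by (auto simp: dicriticals_def)
  obtain R' where R': "valuation_ring R'" "\<iota> -` R' = R"
    using \<iota>.valuation_ring_extension_exists[OF R(1)] by blast
  then have "R' \<noteq> UNIV" using R(3) by auto
  then show ?thesis using extension_is_place_ring[OF R'(1)] R' R(2) by auto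
qed

text \<open>The element \<open>u\<close> is the norm-like element of a function on the projective line over the
  algebraic closure of \<open>k(F)\<close> with one zero, above \<open>R1\<close>, and one pole, above \<open>R2\<close>.\<close>
lemma unit_with_two_places:
  assumes P1: "valuation_ring (place_ring P1)" "\<iota> -` place_ring P1 = R1" "kF F \<subseteq> R1"
    and P2: "valuation_ring (place_ring P2)" "\<iota> -` place_ring P2 = R2" "kF F \<subseteq> R2"
    and ne: "R1 \<noteq> R2"
  shows "\<exists>u. u \<noteq> 0 \<and> place_ord P1 (\<iota> u) > 0 \<and> place_ord P2 (\<iota> u) < 0 \<and>
    (\<forall>R. valuation_ring R \<and> kF F \<subseteq> R \<and> R \<noteq> R1 \<and> R \<noteq> R2 \<longrightarrow> u \<in> R \<and> inverse u \<in> R)"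
proof -
  have PP: "P1 \<noteq> P2" using P1 P2 ne by auto
  define f where "f = place_elem P1 / place_elem P2"
  have f0: "f \<noteq> 0" by (simp add: f_def place_elem_nonzero)
  note f = place_ord_elem[OF PP, folded f_def]
  \<comment> \<open>An extension is trivial or the ring of a place, and \<open>f\<close> has its
    only pole at \<open>P2\<close>. Hence \<open>f\<close> is missing at most from rings above
    \<open>R2\<close>, and dually \<open>inverse f\<close> at most from rings above
    \<open>R1\<close>.\<close>
  have fR: "f \<in> R'" if R': "valuation_ring R'" "kF F \<subseteq> \<iota> -` R'" "\<iota> -` R' \<noteq> R2" for R'
  proof (cases "R' = UNIV")
    case False
    then obtain Q where Q: "R' = place_ring Q" using extension_is_place_ring[OF R'(1,2)] by blast
    then have "Q \<noteq> P2" using R'(3) P2(2) by blast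
    then have "place_ord Q f \<ge> 0" using f by (cases "Q = P1") auto
    then show ?thesis unfolding Q by (simp add: place_ring_def)
  qed simp
  have ifR: "inverse f \<in> R'" if R': "valuation_ring R'" "kF F \<subseteq> \<iota> -` R'" "\<iota> -` R' \<noteq> R1" for R'
  proof (cases "R' = UNIV")
    case False
    then obtain Q where Q: "R' = place_ring Q" using extension_is_place_ring[OF R'(1,2)] by blast
    then have "Q \<noteq> P1" using R'(3) P1(2) by blast
    then have "place_ord Q f \<le> 0" using f by (cases "Q = P2") auto
    then show ?thesis unfolding Q using f0 by (simp add: place_ring_def place_ord_inverse)
  qed simp
  obtain q where q: "q \<noteq> 0" "poly (map_poly \<iota> q) f = 0" using algebraic_over_L by blast
  show ?thesis
  proof (rule \<iota>.norm_like_element[OF q f0])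
    fix u assume u: "u \<noteq> 0"
      "\<And>R. valuation_ring R \<Longrightarrow> (\<And>R'. valuation_ring R' \<Longrightarrow> \<iota> -` R' = R \<Longrightarrow> f \<in> R') \<Longrightarrow> u \<in> R"
      "\<And>R'. (\<And>R''. valuation_ring R'' \<Longrightarrow> \<iota> -` R'' = \<iota> -` R' \<Longrightarrow> f \<in> R'') \<Longrightarrow>
         valuation_ring R' \<Longrightarrow> f \<in> vmax R' \<Longrightarrow> u \<in> vmax (\<iota> -` R')"
      "\<And>R. valuation_ring R \<Longrightarrow> (\<And>R'. valuation_ring R' \<Longrightarrow> \<iota> -` R' = R \<Longrightarrow> inverse f \<in> R') \<Longrightarrow> inverse u \<in> R"
      "\<And>R'. (\<And>R''. valuation_ring R'' \<Longrightarrow> \<iota> -` R'' = \<iota> -` R' \<Longrightarrow> inverse f \<in> R'') \<Longrightarrow>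
         valuation_ring R' \<Longrightarrow> inverse f \<in> vmax R' \<Longrightarrow> inverse u \<in> vmax (\<iota> -` R')"
    have "u \<in> vmax (\<iota> -` place_ring P1)"
    proof (rule u(3)[OF _ P1(1)])
      show "f \<in> R''" if "valuation_ring R''" "\<iota> -` R'' = \<iota> -` place_ring P1" for R''
        using fR[OF that(1)] that(2) P1 ne by simp
      show "f \<in> vmax (place_ring P1)" using f(1) by (simp add: vmax_place_ring)
    qed
    then have "\<iota> u \<in> vmax (place_ring P1)" by (simp add: \<iota>.vmax_vimage)
    then have 1: "place_ord P1 (\<iota> u) > 0" using u(1) by (simp add: vmax_place_ring)
    have "inverse u \<in> vmax (\<iota> -` place_ring P2)"
    proof (rule u(5)[OF _ P2(1)])
      show "inverse f \<in> R''" if "valuation_ring R''" "\<iota> -` R'' = \<iota> -` place_ring P2" for R''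
        using ifR[OF that(1)] that(2) P2 ne by simp
      show "inverse f \<in> vmax (place_ring P2)" using f(2) f0 by (simp add: vmax_place_ring place_ord_inverse)
    qed
    then have "\<iota> (inverse u) \<in> vmax (place_ring P2)" by (simp add: \<iota>.vmax_vimage)
    then have 2: "place_ord P2 (\<iota> u) < 0" using u(1) by (simp add: vmax_place_ring \<iota>.hom_inverse place_ord_inverse)
    have "u \<in> R \<and> inverse u \<in> R" if R: "valuation_ring R" "kF F \<subseteq> R" "R \<noteq> R1" "R \<noteq> R2" for R
    proof
      show "u \<in> R" by (rule u(2)[OF R(1)]) (use fR R in blast)
      show "inverse u \<in> R" by (rule u(4)[OF R(1)]) (use ifR R in blast)
    qed
    then show ?thesis using u(1) 1 2 by blast
  qed
qed

text \<open>Without dicriticals, every valuation ring over \<open>k(F)\<close> would contain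
  \<open>A\<close>, and \<open>A\<close> would equal \<open>k[F]\<close>, on which
  \<open>\<psi>\<close> takes only constant values.\<close>

lemma dicriticals_nonempty: "dicriticals F \<noteq> {}"
proof -
  obtain G where G: "\<psi> G \<notin> range fconst" using \<psi>_nonconst by blast
  have "G \<notin> range Fev" using G \<psi>_Fev by auto
  then obtain R where R: "valuation_ring R" "kF F \<subseteq> R" "to_fract G \<notin> R"
    using in_all_valuation_rings_imp_in_kF by blast
  have "to_fract G \<in> loc_A F"
    unfolding loc_A_def by (intro CollectI exI[of _ G] exI[of _ 1]) (simp add: Fev.hom_1)
  then have "R \<in> dicriticals F" using R unfolding dicriticals_def by auto
  then show ?thesis by blast
qed

end

section \<open>Counting\<close>

text \<open>The common interface of the orders along prime elements and at dicriticals. Only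
  products are evaluated in the count, so no condition on sums is included.\<close>

definition log_hom :: "('f::field \<Rightarrow> int) \<Rightarrow> bool" where
  "log_hom v \<longleftrightarrow> (\<forall>x y. x \<noteq> 0 \<longrightarrow> y \<noteq> 0 \<longrightarrow> v (x * y) = v x + v y)"

context
  fixes v :: "'f::field \<Rightarrow> int"
  assumes v: "log_hom v"
begin

lemma log_hom_mult: "x \<noteq> 0 \<Longrightarrow> y \<noteq> 0 \<Longrightarrow> v (x * y) = v x + v y"
  using v by (simp add: log_hom_def)

lemma log_hom_1: "v 1 = 0"
  using log_hom_mult[of 1 1] by simp

lemma log_hom_inverse: "x \<noteq> 0 \<Longrightarrow> v (inverse x) = - v x"
  using log_hom_mult[of x "inverse x"] by (simp add: log_hom_1)

lemma log_hom_divide: "x \<noteq> 0 \<Longrightarrow> y \<noteq> 0 \<Longrightarrow> v (x / y) = v x - v y"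
  using log_hom_mult[of x "inverse y"] by (simp add: log_hom_inverse divide_inverse)

lemma log_hom_power: "x \<noteq> 0 \<Longrightarrow> v (x ^ n) = int n * v x"
  by (induction n) (simp_all add: log_hom_1 log_hom_mult algebra_simps)

lemma log_hom_powi: "x \<noteq> 0 \<Longrightarrow> v (x powi n) = n * v x"
  by (cases n rule: int_cases2) (simp_all add: power_int_minus log_hom_power log_hom_inverse)

lemma log_hom_prod: "(\<And>i. i \<in> I \<Longrightarrow> f i \<noteq> 0) \<Longrightarrow> v (prod f I) = (\<Sum>i\<in>I. v (f i))"
  by (induction I rule: infinite_finite_induct) (simp_all add: log_hom_1 log_hom_mult)

end

lemma log_hom_padic: "prime_elem P \<Longrightarrow> log_hom (padic_ord P)"
  using additive_order.fract_ord_mult[OF additive_order_bi_mult] by (auto simp: log_hom_def)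

lemma padic_ord_to_fract: "prime_elem P \<Longrightarrow> x \<noteq> 0 \<Longrightarrow> padic_ord P (to_fract x) = int (bi_mult P x)"
  by (rule additive_order.fract_ord_to_fract[OF additive_order_bi_mult])

lemma bi_mult_self: "prime_elem P \<Longrightarrow> bi_mult P P = 1"
  unfolding bi_mult_def by (rule multiplicity_prime) (simp add: to_fld_prime_elem_iff)

lemma bi_mult_cong:
  assumes "prime_elem P" "prime_elem Q" "gen_by P = gen_by Q" "x \<noteq> 0"
  shows "bi_mult P x = bi_mult Q x"
proof -
  have "P dvd Q" "Q dvd P" using assms(3) gen_by_subset_iff by blast+
  then have "P ^ n dvd x \<longleftrightarrow> Q ^ n dvd x" for n
    using dvd_power_same dvd_trans by blast
  then have "n \<le> bi_mult P x \<longleftrightarrow> n \<le> bi_mult Q x" for n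
    using power_dvd_iff_bi_mult[OF assms(1,4)] power_dvd_iff_bi_mult[OF assms(2,4)] by blast
  then show ?thesis by (metis order.refl order.antisym)
qed

lemma padic_ord_cong:
  assumes "prime_elem P" "prime_elem Q" "gen_by P = gen_by Q" "w \<noteq> 0"
  shows "padic_ord P w = padic_ord Q w"
proof -
  obtain a b where ab: "a \<noteq> 0" "b \<noteq> 0" "w = to_fract a / to_fract b"
    using fract_cases_nonzero[OF assms(4)] .
  then show ?thesis
    using bi_mult_cong[OF assms(1-3) ab(1)] bi_mult_cong[OF assms(1-3) ab(2)]
      additive_order.fract_ord_fract[OF additive_order_bi_mult[OF assms(1)] ab(1,2)]
      additive_order.fract_ord_fract[OF additive_order_bi_mult[OF assms(2)] ab(1,2)]
    by simp
qed

lemma fract_no_common_prime: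
  fixes w :: "'k::field poly poly fract"
  assumes "w \<noteq> 0"
  obtains a b where "a \<noteq> 0" "b \<noteq> 0" "w = to_fract a / to_fract b"
    "\<forall>P. prime_elem P \<longrightarrow> P dvd a \<longrightarrow> \<not> P dvd b"
proof -
  define Q where "Q n \<longleftrightarrow> (\<exists>a b. a \<noteq> 0 \<and> b \<noteq> 0 \<and> w = to_fract a / to_fract b \<and> bidegree b = n)" for n
  obtain a0 b0 where "a0 \<noteq> 0" "b0 \<noteq> 0" "w = to_fract a0 / to_fract b0"
    using fract_cases_nonzero[OF assms] .
  then have "Q (bidegree b0)" by (auto simp: Q_def)
  then have "Q (LEAST n. Q n)" by (rule LeastI)
  then obtain a b where ab: "a \<noteq> 0" "b \<noteq> 0" "w = to_fract a / to_fract b" "bidegree b = (LEAST n. Q n)"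
    by (auto simp: Q_def)
  have "\<not> P dvd b" if P: "prime_elem P" "P dvd a" for P
  proof
    assume "P dvd b"
    then obtain a' b' where e: "a = P * a'" "b = P * b'" using P(2) by (auto elim!: dvdE)
    have nz: "a' \<noteq> 0" "b' \<noteq> 0" "P \<noteq> 0" using e ab by auto
    have "w = to_fract a' / to_fract b'" unfolding ab(3) e to_fract_mult using nz by simp
    then have "Q (bidegree b')" using nz by (auto simp: Q_def)
    moreover have "bidegree P > 0" using P(1) nz by (intro bidegree_pos) (auto simp: prime_elem_not_unit)
    then have "bidegree b' < bidegree b" unfolding e(2) using nz by (simp add: bidegree_mult)
    ultimately show False using not_less_Least[of "bidegree b'" Q] ab(4) by simp
  qed
  then show ?thesis using that ab by blast
qed

lemma log_hom_of_prime_factors: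
  fixes v :: "'k::field poly poly fract \<Rightarrow> int"
  assumes v: "log_hom v" and const: "\<And>c. c \<noteq> 0 \<Longrightarrow> v (to_fract (kconst c)) = 0"
    and a: "a \<noteq> 0" "\<And>P. prime_elem P \<Longrightarrow> P dvd a \<Longrightarrow> v (to_fract P) = 0"
  shows "v (to_fract a) = 0"
  using a
proof (induction rule: bivariate_factor_induct)
  case (const c)
  then show ?case using assms(2) by blast
next
  case (prime q p)
  have "v (to_fract q) = 0" using prime by simp
  moreover have "v (to_fract p) = 0" using prime by (simp add: dvd_mult)
  moreover have "to_fract q \<noteq> 0" "to_fract p \<noteq> 0" using prime by auto
  ultimately show ?case using log_hom_mult[OF v, of "to_fract q" "to_fract p"] by simp
qed

text \<open>By factoriality \<open>a\<close> is a constant times a power of \<open>P\<close>. It is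
  applied to a fibre with one component, which may be a multiple one.\<close>

lemma log_hom_of_prime_power:
  fixes v :: "'k::field poly poly fract \<Rightarrow> int"
  assumes v: "log_hom v" and const: "\<And>c. c \<noteq> 0 \<Longrightarrow> v (to_fract (kconst c)) = 0"
    and P: "prime_elem P" and a: "a \<noteq> 0" "\<And>Q. prime_elem Q \<Longrightarrow> Q dvd a \<Longrightarrow> gen_by Q = gen_by P"
  shows "v (to_fract a) = int (bi_mult P a) * v (to_fract P)"
  using a
proof (induction rule: bivariate_factor_induct)
  case (const c)
  have "bi_mult P (kconst c) = 0"
  proof (rule ccontr)
    assume "bi_mult P (kconst c) \<noteq> 0"
    then have "P dvd kconst c" using bi_mult_pos_iff[OF P, of "kconst c"] is_unit_kconst[OF const(1)] by fastforce
    then show False using is_unit_kconst[OF const(1)] P by (meson dvd_trans prime_elem_not_unit)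
  qed
  then show ?case using assms(2)[OF const(1)] by simp
next
  case (prime q p)
  have gq: "gen_by q = gen_by P" by (rule prime.prems[OF prime(1)]) simp
  then have "P dvd q" "q dvd P" using gen_by_subset_iff by blast+
  then obtain r where r: "q = P * r" by (elim dvdE)
  have "is_unit r" using irreducibleD[OF prime_elem_imp_irreducible[OF prime(1)] r] P by auto
  then obtain c where c: "c \<noteq> 0" "r = kconst c" using bivariate_unit by blast
  have nz: "to_fract P \<noteq> 0" "to_fract r \<noteq> 0" "to_fract q \<noteq> 0" "to_fract p \<noteq> 0"
    using prime(1,2) P r by auto
  have "v (to_fract q) = v (to_fract P)"
    using log_hom_mult[OF v nz(1,2)] assms(2)[OF c(1)] by (simp add: r c(2))
  moreover have "bi_mult P (q * p) = Suc (bi_mult P p)"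
  proof -
    have "bi_mult P q = bi_mult q q"
      using bi_mult_cong[OF P prime(1) gq[symmetric]] prime(1) by auto
    also have "bi_mult q q = 1" by (rule bi_mult_self[OF prime(1)])
    finally show ?thesis using bi_mult_mult[OF P, of q p] prime(1,2) by auto
  qed
  moreover have "v (to_fract p) = int (bi_mult P p) * v (to_fract P)"
    by (rule prime.IH) (rule prime.prems, assumption, erule dvd_mult)
  ultimately show ?case using log_hom_mult[OF v nz(3,4)] by (simp add: algebra_simps)
qed

definition rep :: "'k::field poly poly set \<Rightarrow> 'k poly poly" where
  "rep p = (SOME P. prime_elem P \<and> gen_by P = p)"

lemma rep:
  assumes "p \<in> minimal_primes_over G" "G \<noteq> 0"
  shows "prime_elem (rep p)" "gen_by (rep p) = p" "rep p dvd G"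
proof -
  obtain P where P: "prime_elem P" "P dvd G" "p = gen_by P"
    using assms minimal_primes_over_eq[OF assms(2)] by blast
  then have "\<exists>P. prime_elem P \<and> gen_by P = p" by blast
  then have r: "prime_elem (rep p) \<and> gen_by (rep p) = p" unfolding rep_def by (rule someI_ex)
  then show "prime_elem (rep p)" "gen_by (rep p) = p" by auto
  have "rep p dvd P" using r P(3) gen_by_subset_iff[of P "rep p"] by simp
  then show "rep p dvd G" using P(2) dvd_trans by blast
qed

section \<open>Components of the fibres\<close>

context generic_fibration
begin

abbreviation comps :: "'k \<Rightarrow> 'k poly poly set set" where
  "comps l \<equiv> minimal_primes_over (F - kconst l)"

lemma finite_comps: "finite (comps l)"
  by (rule finite_minimal_primes_over[OF F_minus_nonzero])

lemma n_comp_pos: "n_comp F l > 0"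
proof -
  obtain P where "prime_elem P" "P dvd F - kconst l"
    using bivariate_prime_divisor_exists[OF F_minus_nonzero F_minus_not_unit] by blast
  then have "gen_by P \<in> comps l" unfolding minimal_primes_over_eq[OF F_minus_nonzero] by blast
  then have "comps l \<noteq> {}" by blast
  then show ?thesis unfolding n_comp_def using finite_comps[of l] by (simp add: card_gt_0_iff)
qed

definition \<Lambda> :: "'k set" where "\<Lambda> = {l. n_comp F l \<noteq> 1}"

lemma finite_\<Lambda>: "finite \<Lambda>"
proof (rule finite_subset[OF _ finite_bad_fibres], rule subsetI, rule ccontr)
  fix l assume l: "l \<in> \<Lambda>" "l \<notin> bad_fibres"
  then have "prime_elem (F - kconst l)"
    by (intro bivariate_irreducible_imp_prime_elem) (simp add: bad_fibres_def)
  then have p: "gen_by (F - kconst l) \<in> gen_by ` {P. prime_elem P \<and> P dvd F - kconst l}"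
    by (intro imageI) simp
  have "comps l = {gen_by (F - kconst l)}"
    unfolding minimal_primes_over_eq[OF F_minus_nonzero]
  proof (intro equalityI subsetI)
    fix I assume "I \<in> gen_by ` {P. prime_elem P \<and> P dvd F - kconst l}"
    then obtain P where P: "prime_elem P" "P dvd F - kconst l" "I = gen_by P" by blast
    show "I \<in> {gen_by (F - kconst l)}"
      unfolding P(3) using prime_elem_dvd_imp_gen_by_eq[OF P(1) \<open>prime_elem (F - kconst l)\<close> P(2)] by simp
  qed (use p in simp)
  then show False using l by (simp add: \<Lambda>_def n_comp_def)
qed

lemma prime_dvd_fibre_unique:
  assumes "prime_elem P" "P dvd F - kconst l" "P dvd F - kconst m"
  shows "l = m"
proof (rule ccontr)
  assume "l \<noteq> m"
  have "P dvd (F - kconst m) - (F - kconst l)" by (rule dvd_diff[OF assms(3,2)])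
  also have "(F - kconst m) - (F - kconst l) = kconst (l - m)"
    by (simp add: type_ring_hom.hom_diff[OF type_ring_hom_kconst])
  finally have "is_unit P" using is_unit_kconst[of "l - m"] \<open>l \<noteq> m\<close> by (meson dvd_trans right_minus_eq)
  then show False using assms(1) by (simp add: prime_elem_not_unit)
qed

lemma comps_disjoint: "l \<noteq> m \<Longrightarrow> comps l \<inter> comps m = {}"
proof (rule ccontr)
  assume "l \<noteq> m" "comps l \<inter> comps m \<noteq> {}"
  then obtain p where p: "p \<in> comps l" "p \<in> comps m" by blast
  show False
    using prime_dvd_fibre_unique[OF rep(1)[OF p(1) F_minus_nonzero] rep(3)[OF p(1) F_minus_nonzero]
        rep(3)[OF p(2) F_minus_nonzero]] \<open>l \<noteq> m\<close> by simp
qed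

lemma Fev_in_kF: "s \<noteq> 0 \<Longrightarrow> to_fract (Fev a) / to_fract (Fev s) \<in> kF F"
  unfolding kF_def using Fev_inj by blast

text \<open>\<open>g\<close> splits into linear factors, each giving one fibre of \<open>F\<close>,
  and \<open>P\<close> divides the fibre over \<open>l\<close> only.\<close>

lemma bi_mult_Fev:
  assumes P: "prime_elem P" "P dvd F - kconst l" and g: "g \<noteq> 0"
  shows "bi_mult P (Fev g) = order l g * bi_mult P (F - kconst l)"
  using g
proof (induction "degree g" arbitrary: g rule: less_induct)
  case less
  show ?case
  proof (cases "degree g = 0")
    case True
    then obtain c where c: "g = [:c:]" "c \<noteq> 0" using less.prems by (auto elim: degree_eq_zeroE)
    have "\<not> P dvd kconst c"
      using is_unit_kconst[OF c(2)] P(1) by (meson dvd_trans prime_elem_not_unit)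
    moreover have "kconst c \<noteq> 0" using is_unit_kconst[OF c(2)] by auto
    ultimately have "bi_mult P (kconst c) = 0" using bi_mult_pos_iff[OF P(1)] by blast
    moreover have "order l g = 0" using c by (intro order_0I) simp
    ultimately show ?thesis by (simp add: c Fev_const)
  next
    case False
    then obtain a where "poly g a = 0" using alg_closed_imp_poly_has_root by blast
    then obtain q where q: "g = [:-a, 1:] * q" using poly_root_factor by blast
    have q0: "q \<noteq> 0" using q less.prems by auto
    then have "degree q < degree g" unfolding q by (subst degree_mult_eq) auto
    from less.hyps[OF this q0] have IH: "bi_mult P (Fev q) = order l q * bi_mult P (F - kconst l)" .
    have "Fev q \<noteq> 0" using q0 Fev_inj by blast
    then have "bi_mult P (Fev g) = bi_mult P (F - kconst a) + bi_mult P (Fev q)"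
      unfolding q Fev.hom_mult Fev_linear by (intro bi_mult_mult[OF P(1) F_minus_nonzero])
    moreover have "order l g = order l [:-a, 1:] + order l q"
      unfolding q using q0 by (intro order_mult) (metis less.prems q)
    moreover have "bi_mult P (F - kconst a) = 0" if "a \<noteq> l"
      using that prime_dvd_fibre_unique[OF P(1) _ P(2), of a] bi_mult_pos_iff[OF P(1) F_minus_nonzero] by blast
    ultimately show ?thesis using IH by (cases "a = l") (auto simp: order_linear)
  qed
qed

lemma prime_dvd_Fev:
  assumes P: "prime_elem P" "P dvd Fev g" and g: "g \<noteq> 0"
  shows "\<exists>l. P dvd F - kconst l"
  using P(2) g
proof (induction "degree g" arbitrary: g rule: less_induct)
  case less
  show ?case
  proof (cases "degree g = 0")
    case True
    then obtain c where c: "g = [:c:]" "c \<noteq> 0" using less.prems by (auto elim: degree_eq_zeroE)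
    then show ?thesis using less.prems(1) is_unit_kconst[OF c(2)] P(1) Fev_const
      by (metis dvd_trans prime_elem_not_unit)
  next
    case False
    then obtain a where "poly g a = 0" using alg_closed_imp_poly_has_root by blast
    then obtain q where q: "g = [:-a, 1:] * q" using poly_root_factor by blast
    have q0: "q \<noteq> 0" using q less.prems by auto
    then have d: "degree q < degree g" unfolding q by (subst degree_mult_eq) auto
    have "P dvd F - kconst a \<or> P dvd Fev q"
      using less.prems(1) P(1) unfolding q Fev.hom_mult Fev_linear by (simp add: prime_elem_dvd_mult_iff)
    then show ?thesis using less.hyps[OF d _ q0] by blast
  qed
qed

text \<open>Such a \<open>P\<close> is a closed point of the generic fibre: no denominator from
  \<open>k[F]\<close> is divisible by it, so its ring contains the localization of \<open>A\<close>
  and is not at infinity.\<close>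

lemma nonvertical_padic_ring:
  assumes P: "prime_elem P" "\<And>l. \<not> P dvd F - kconst l"
  shows "kF F \<subseteq> padic_ring P" "padic_ring P \<notin> dicriticals F"
proof -
  have s: "bi_mult P (Fev s) = 0" if "Fev s \<noteq> 0" for s
  proof -
    have "s \<noteq> 0" using that Fev.hom_0 by auto
    then have "\<not> P dvd Fev s" using prime_dvd_Fev[OF P(1)] P(2) by blast
    then show ?thesis using bi_mult_pos_iff[OF P(1) that] by blast
  qed
  have m: "to_fract a / to_fract (Fev s) \<in> padic_ring P" if "Fev s \<noteq> 0" for a s
  proof (cases "a = 0")
    case False
    then show ?thesis
      using additive_order.fract_ord_fract[OF additive_order_bi_mult[OF P(1)] False that] s[OF that]
      by (simp add: padic_ring_def)
  qed (simp add: padic_ring_def)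
  have "loc_A F \<subseteq> padic_ring P" unfolding loc_A_def using m by auto
  then show "padic_ring P \<notin> dicriticals F" by (simp add: dicriticals_def)
  show "kF F \<subseteq> padic_ring P" unfolding kF_def using m by auto
qed

section \<open>Orders at the dicriticals\<close>

definition place_of :: "'k poly poly fract set \<Rightarrow> 'k poly fract alg_closure option" where
  "place_of R = (SOME P. valuation_ring (place_ring P) \<and> \<iota> -` place_ring P = R)"

text \<open>The order at one chosen place above a dicritical is a positive multiple of its
  normalized valuation. Only signs and vanishing are used.\<close>

definition dval :: "'k poly poly fract set \<Rightarrow> 'k poly poly fract \<Rightarrow> int" where
  "dval R z = place_ord (place_of R) (\<iota> z)"

lemma place_of:
  assumes "R \<in> dicriticals F"
  shows "valuation_ring (place_ring (place_of R))" "\<iota> -` place_ring (place_of R) = R"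
proof -
  have "valuation_ring (place_ring (place_of R)) \<and> \<iota> -` place_ring (place_of R) = R"
    unfolding place_of_def by (rule someI_ex[OF dicritical_place_exists[OF assms]])
  then show "valuation_ring (place_ring (place_of R))" "\<iota> -` place_ring (place_of R) = R" by auto
qed

lemma log_hom_dval: "log_hom (dval R)"
  unfolding log_hom_def dval_def by (simp add: \<iota>.hom_mult place_ord_mult)

lemma mem_dicritical_iff: "R \<in> dicriticals F \<Longrightarrow> z \<noteq> 0 \<Longrightarrow> z \<in> R \<longleftrightarrow> dval R z \<ge> 0"
  using place_of(2)[of R] by (auto simp: dval_def place_ring_def)

lemma dval_unit: "R \<in> dicriticals F \<Longrightarrow> z \<noteq> 0 \<Longrightarrow> z \<in> R \<Longrightarrow> inverse z \<in> R \<Longrightarrow> dval R z = 0"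
  using mem_dicritical_iff[of R z] mem_dicritical_iff[of R "inverse z"] log_hom_inverse[OF log_hom_dval, of z R]
  by simp

lemma dval_Fev:
  assumes "R \<in> dicriticals F" "g \<noteq> 0"
  shows "dval R (to_fract (Fev g)) = 0"
proof (rule dval_unit[OF assms(1)])
  have k: "kF F \<subseteq> R" using assms by (simp add: dicriticals_def)
  show "to_fract (Fev g) \<noteq> 0" using assms(2) Fev_inj by auto
  show "to_fract (Fev g) \<in> R" using Fev_in_kF[of 1 g] k by (auto simp: Fev.hom_1)
  show "inverse (to_fract (Fev g)) \<in> R"
    using Fev_in_kF[OF assms(2), of 1] k by (auto simp: Fev.hom_1 inverse_eq_divide)
qed

lemma dval_fibre: "R \<in> dicriticals F \<Longrightarrow> dval R (to_fract (F - kconst l)) = 0"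
  using dval_Fev[of R "[:-l, 1:]"] unfolding Fev_linear by simp

lemma dval_kconst: "R \<in> dicriticals F \<Longrightarrow> c \<noteq> 0 \<Longrightarrow> dval R (to_fract (kconst c)) = 0"
  using dval_Fev[of R "[:c:]"] unfolding Fev_const by simp

text \<open>A component of an irreducible fibre has a power in \<open>k(F)\<close>, so only the reducible
  fibres contribute to the valuations at the dicriticals.\<close>
lemma dval_eq_0_if_supported_on_irreducible_fibres:
  assumes R: "R \<in> dicriticals F" and w: "w \<noteq> 0"
    and ord: "\<And>P. prime_elem P \<Longrightarrow> padic_ord P w \<noteq> 0 \<Longrightarrow> \<exists>l. l \<notin> \<Lambda> \<and> P dvd F - kconst l"
  shows "dval R w = 0"
proof -
  obtain a b where ab: "a \<noteq> 0" "b \<noteq> 0" "w = to_fract a / to_fract b"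
    "\<forall>P. prime_elem P \<longrightarrow> P dvd a \<longrightarrow> \<not> P dvd b"
    using fract_no_common_prime[OF w] .
  have pw: "padic_ord P w = int (bi_mult P a) - int (bi_mult P b)" if "prime_elem P" for P
    unfolding ab(3) by (rule additive_order.fract_ord_fract[OF additive_order_bi_mult[OF that] ab(1,2)])
  have P0: "dval R (to_fract P) = 0" if P: "prime_elem P" "P dvd a \<or> P dvd b" for P
  proof -
    have "padic_ord P w \<noteq> 0"
      using P ab(4) bi_mult_pos_iff[OF P(1) ab(1)] bi_mult_pos_iff[OF P(1) ab(2)] pw[OF P(1)] by auto
    then obtain l where l: "l \<notin> \<Lambda>" "P dvd F - kconst l" using ord[OF P(1)] by blast
    then have "card (comps l) = 1" by (simp add: \<Lambda>_def n_comp_def)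
    then obtain p where p: "comps l = {p}" by (auto simp: card_1_singleton_iff)
    have "gen_by Q = p" if "prime_elem Q" "Q dvd F - kconst l" for Q
      using that p unfolding minimal_primes_over_eq[OF F_minus_nonzero] by blast
    then have "gen_by Q = gen_by P" if "prime_elem Q" "Q dvd F - kconst l" for Q
      using that P(1) l(2) by simp
    from log_hom_of_prime_power[OF log_hom_dval dval_kconst[OF R] P(1) F_minus_nonzero this]
    have "int (bi_mult P (F - kconst l)) * dval R (to_fract P) = 0"
      using dval_fibre[OF R] by (simp del: to_fract_diff)
    moreover have "bi_mult P (F - kconst l) > 0" using bi_mult_pos_iff[OF P(1) F_minus_nonzero] l(2) by blast
    ultimately show ?thesis by simp
  qed
  have "dval R (to_fract a) = 0" "dval R (to_fract b) = 0"
    using log_hom_of_prime_factors[OF log_hom_dval dval_kconst[OF R]] ab(1,2) P0 by blast+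
  then show ?thesis unfolding ab(3) using log_hom_divide[OF log_hom_dval] ab(1,2) by simp
qed

section \<open>The two inequalities\<close>

definition \<B> :: "'k poly poly set set" where "\<B> = (\<Union>l\<in>\<Lambda>. comps l)"

lemma finite_\<B>: "finite \<B>"
  unfolding \<B>_def using finite_\<Lambda> finite_comps by blast

lemma card_\<B>: "card \<B> = (\<Sum>l\<in>\<Lambda>. n_comp F l)"
  unfolding \<B>_def n_comp_def using comps_disjoint
  by (intro card_UN_disjoint finite_\<Lambda>) (auto simp: finite_comps)

lemma padic_ord_fibre:
  assumes "prime_elem P"
  shows "padic_ord P (to_fract (F - kconst l)) = int (bi_mult P (F - kconst l))"
  by (rule padic_ord_to_fract[OF assms F_minus_nonzero])

text \<open>For each \<open>R\<close> in \<open>D\<close> other than \<open>R1\<close> there is a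
  unit with a zero at \<open>R1\<close> and a pole at \<open>R\<close>. If these, together with the
  reducible fibres, outnumber the components in \<open>\<B>\<close>, some nontrivial product
  \<open>w\<close> has order 0 along all of \<open>\<B>\<close>. Then \<open>w\<close> is supported
  on irreducible fibres and has order 0 at every dicritical, which kills the exponents one after the
  other.\<close>

lemma card_dicriticals_le:
  assumes D: "D \<subseteq> dicriticals F" "finite D" "D \<noteq> {}"
  shows "card \<Lambda> + card D \<le> card \<B> + 1"
proof (rule ccontr)
  assume gt: "\<not> card \<Lambda> + card D \<le> card \<B> + 1"
  obtain R1 where R1: "R1 \<in> D" using D by blast
  define D' where "D' = D - {R1}"
  have dic: "R \<in> dicriticals F" if "R \<in> D" for R using that D by blast
  have kR: "kF F \<subseteq> R" if "R \<in> D" for R using dic[OF that] by (simp add: dicriticals_def)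
  have "\<exists>u. u \<noteq> 0 \<and> dval R1 u > 0 \<and> dval R u < 0 \<and>
      (\<forall>S. valuation_ring S \<and> kF F \<subseteq> S \<and> S \<noteq> R1 \<and> S \<noteq> R \<longrightarrow> u \<in> S \<and> inverse u \<in> S)" if R: "R \<in> D'" for R
    unfolding dval_def
    by (rule unit_with_two_places) (use R R1 place_of dic kR in \<open>auto simp: D'_def\<close>)
  then obtain u where u: "\<And>R. R \<in> D' \<Longrightarrow> u R \<noteq> 0" "\<And>R. R \<in> D' \<Longrightarrow> dval R (u R) < 0"
    "\<And>R S. R \<in> D' \<Longrightarrow> valuation_ring S \<Longrightarrow> kF F \<subseteq> S \<Longrightarrow> S \<noteq> R1 \<Longrightarrow> S \<noteq> R \<Longrightarrow> u R \<in> S \<and> inverse (u R) \<in> S"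
    by metis
  define I where "I = \<Lambda> <+> D'"
  define el where "el i = (case i of Inl l \<Rightarrow> to_fract (F - kconst l) | Inr R \<Rightarrow> u R)" for i
  have finI: "finite I" using finite_\<Lambda> D by (simp add: I_def D'_def)
  have "card D' = card D - 1" using R1 D by (simp add: D'_def)
  moreover have "card D > 0" using D by (simp add: card_gt_0_iff)
  moreover have "card I = card \<Lambda> + card D'" unfolding I_def using finite_\<Lambda> D by (intro card_Plus) (auto simp: D'_def)
  ultimately have "card \<B> < card I" using gt by linarith
  from homogeneous_system_nontrivial[OF finite_\<B> finI this, of "\<lambda>p i. padic_ord (rep p) (el i)"]
  obtain c where c: "\<exists>i\<in>I. c i \<noteq> 0" "\<forall>p\<in>\<B>. (\<Sum>i\<in>I. padic_ord (rep p) (el i) * c i) = 0" by blast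
  have el0: "el i \<noteq> 0" if "i \<in> I" for i
    using that u(1) F_minus_nonzero by (auto simp: I_def el_def simp del: to_fract_diff)
  define w where "w = (\<Prod>i\<in>I. el i powi c i)"
  have w0: "w \<noteq> 0" using el0 finI by (auto simp: w_def power_int_eq_0_iff)
  have vw: "v w = (\<Sum>i\<in>I. v (el i) * c i)" if "log_hom v" for v
  proof -
    have "v w = (\<Sum>i\<in>I. v (el i powi c i))" unfolding w_def
      by (rule log_hom_prod[OF that]) (use el0 in \<open>auto simp: power_int_eq_0_iff\<close>)
    also have "\<dots> = (\<Sum>i\<in>I. v (el i) * c i)"
      by (intro sum.cong refl) (simp add: log_hom_powi[OF that el0])
    finally show ?thesis .
  qed
  have ord: "\<exists>l. l \<notin> \<Lambda> \<and> P dvd F - kconst l" if P: "prime_elem P" "padic_ord P w \<noteq> 0" for P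
  proof (cases "\<exists>l. P dvd F - kconst l")
    case True
    then obtain l where l: "P dvd F - kconst l" by blast
    show ?thesis
    proof (cases "l \<in> \<Lambda>")
      case lL: True
      have p: "gen_by P \<in> comps l" unfolding minimal_primes_over_eq[OF F_minus_nonzero] using P(1) l by blast
      then have "padic_ord (rep (gen_by P)) w = 0"
        using c(2) lL vw[OF log_hom_padic[OF rep(1)[OF p F_minus_nonzero]]] by (auto simp: \<B>_def)
      then have "padic_ord P w = 0"
        using padic_ord_cong[OF P(1) rep(1)[OF p F_minus_nonzero] _ w0] rep(2)[OF p F_minus_nonzero] by simp
      then show ?thesis using P(2) by simp
    qed (use l in blast)
  next
    \<comment> \<open>\<open>P\<close> divides no fibre, so its ring contains \<open>k(F)\<close>
      and is not a dicritical. The fibres and all \<open>u R\<close> are units there.\<close>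
    case False
    then have nP: "\<And>l. \<not> P dvd F - kconst l" by blast
    note nv = nonvertical_padic_ring[OF P(1) nP] and vP = valuation_ring_padic[OF P(1)]
    have "padic_ord P (el i) = 0" if i: "i \<in> I" for i
    proof (cases i)
      case (Inl l)
      then show ?thesis using nP[of l] bi_mult_pos_iff[OF P(1) F_minus_nonzero, of l]
        by (simp add: el_def padic_ord_fibre[OF P(1)] del: to_fract_diff)
    next
      case (Inr R)
      then have R: "R \<in> D'" using i by (auto simp: I_def)
      then have "padic_ring P \<noteq> R1" "padic_ring P \<noteq> R" using nv(2) dic R1 by (auto simp: D'_def)
      from u(3)[OF R vP nv(1) this] have "u R \<in> padic_ring P" "inverse (u R) \<in> padic_ring P" by auto
      then have "padic_ord P (u R) \<ge> 0" "padic_ord P (inverse (u R)) \<ge> 0"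
        using u(1)[OF R] by (auto simp: padic_ring_def)
      then have "padic_ord P (u R) = 0" using log_hom_inverse[OF log_hom_padic[OF P(1)] u(1)[OF R]] by simp
      then show ?thesis using Inr by (simp add: el_def)
    qed
    then have "padic_ord P w = 0" unfolding vw[OF log_hom_padic[OF P(1)]] by simp
    then show ?thesis using P(2) by simp
  qed
  \<comment> \<open>Among the factors of \<open>w\<close> only \<open>u R\<close> has nonzero order
    at \<open>R\<close>: fibres are units of \<open>k(F)\<close>, and the other \<open>u S\<close>
    have their zero at \<open>R1\<close> and their pole at \<open>S\<close>.\<close>
  have cR: "c (Inr R) = 0" if R: "R \<in> D'" for R
  proof -
    have RD: "R \<in> D" "R \<noteq> R1" using R by (auto simp: D'_def)
    have "dval R (el i) * c i = (if i = Inr R then dval R (u R) * c i else 0)" if i: "i \<in> I" for i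
    proof (cases i)
      case (Inl l)
      then show ?thesis using dval_fibre[OF dic[OF RD(1)]] by (simp add: el_def del: to_fract_diff)
    next
      case (Inr S)
      then have S: "S \<in> D'" using i by (auto simp: I_def)
      have "dval R (u S) = 0" if "S \<noteq> R"
      proof -
        have "u S \<in> R \<and> inverse (u S) \<in> R"
          using u(3)[OF S _ kR[OF RD(1)] RD(2)] that dic[OF RD(1)] by (auto simp: dicriticals_def)
        then show ?thesis using dval_unit[OF dic[OF RD(1)] u(1)[OF S]] by blast
      qed
      then show ?thesis using Inr by (auto simp: el_def)
    qed
    then have "(\<Sum>i\<in>I. dval R (el i) * c i) = (\<Sum>i\<in>I. if i = Inr R then dval R (u R) * c i else 0)"
      by (rule sum.cong[OF refl])
    also have "Inr R \<in> I" using R by (auto simp: I_def)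
    then have "(\<Sum>i\<in>I. if i = Inr R then dval R (u R) * c i else 0) = dval R (u R) * c (Inr R)"
      using finI by simp
    finally have "dval R w = dval R (u R) * c (Inr R)" unfolding vw[OF log_hom_dval] .
    moreover have "dval R w = 0"
      by (rule dval_eq_0_if_supported_on_irreducible_fibres[OF dic[OF RD(1)] w0 ord])
    ultimately show ?thesis using u(2)[OF R] by simp
  qed
  \<comment> \<open>With the exponents of the \<open>u R\<close> gone, the order along one component
    of the fibre over \<open>l\<close> isolates the exponent of that fibre.\<close>
  have cL: "c (Inl l) = 0" if l: "l \<in> \<Lambda>" for l
  proof -
    obtain p where p: "p \<in> comps l" using n_comp_pos[of l] unfolding n_comp_def by (metis card.empty ex_in_conv less_numeral_extra(3))
    note r = rep[OF p F_minus_nonzero]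
    have "padic_ord (rep p) (el i) * c i =
        (if i = Inl l then int (bi_mult (rep p) (F - kconst l)) * c i else 0)" if i: "i \<in> I" for i
    proof (cases i)
      case (Inl m)
      have "bi_mult (rep p) (F - kconst m) = 0" if "m \<noteq> l"
        using prime_dvd_fibre_unique[OF r(1) _ r(3), of m] that bi_mult_pos_iff[OF r(1) F_minus_nonzero] by blast
      then show ?thesis using Inl by (auto simp: el_def padic_ord_fibre[OF r(1)] simp del: to_fract_diff)
    next
      case (Inr R)
      then have "c i = 0" using cR i by (auto simp: I_def)
      then show ?thesis using Inr by simp
    qed
    then have "(\<Sum>i\<in>I. padic_ord (rep p) (el i) * c i) =
        (\<Sum>i\<in>I. if i = Inl l then int (bi_mult (rep p) (F - kconst l)) * c i else 0)"
      by (rule sum.cong[OF refl])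
    also have "Inl l \<in> I" using l by (auto simp: I_def)
    then have "(\<Sum>i\<in>I. if i = Inl l then int (bi_mult (rep p) (F - kconst l)) * c i else 0) =
        int (bi_mult (rep p) (F - kconst l)) * c (Inl l)"
      using finI by simp
    finally have "int (bi_mult (rep p) (F - kconst l)) * c (Inl l) = 0"
      using c(2) p l by (auto simp: \<B>_def)
    moreover have "bi_mult (rep p) (F - kconst l) > 0" using bi_mult_pos_iff[OF r(1) F_minus_nonzero] r(3) by blast
    ultimately show ?thesis by simp
  qed
  show False using c(1) cR cL by (auto simp: I_def)
qed

lemma finite_dicriticals: "finite (dicriticals F)"
proof (rule ccontr)
  assume "infinite (dicriticals F)"
  then obtain D where D: "D \<subseteq> dicriticals F" "finite D" "card D = card \<B> + 2"
    using infinite_arbitrarily_large by blast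
  then have "D \<noteq> {}" by auto
  then show False using card_dicriticals_le[OF D(1,2)] D(3) by simp
qed

lemma loc_A_mult: "x \<in> loc_A F \<Longrightarrow> y \<in> loc_A F \<Longrightarrow> x * y \<in> loc_A F"
proof -
  assume "x \<in> loc_A F" "y \<in> loc_A F"
  then obtain a s b t where *: "x = to_fract a / to_fract (Fev s)" "Fev s \<noteq> 0"
    "y = to_fract b / to_fract (Fev t)" "Fev t \<noteq> 0" unfolding loc_A_def by blast
  then have "x * y = to_fract (a * b) / to_fract (Fev (s * t))" "Fev (s * t) \<noteq> 0"
    by (simp_all add: Fev.hom_mult)
  then show ?thesis unfolding loc_A_def by blast
qed

lemma loc_A_1: "1 \<in> loc_A F"
  unfolding loc_A_def by (intro CollectI exI[of _ 1]) (simp add: Fev.hom_1)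

lemma loc_A_powi:
  assumes P: "P dvd F - kconst l" "P \<noteq> 0"
  shows "to_fract P powi n \<in> loc_A F"
proof -
  have 1: "to_fract P \<in> loc_A F"
    unfolding loc_A_def by (intro CollectI exI[of _ P] exI[of _ 1]) (simp add: Fev.hom_1)
  obtain q where q: "F - kconst l = P * q" using P(1) by (elim dvdE)
  have nz: "Fev [:-l, 1:] \<noteq> 0" unfolding Fev_linear by (rule F_minus_nonzero)
  have "q \<noteq> 0" using q F_minus_nonzero[of l] by auto
  then have "inverse (to_fract P) = to_fract q / to_fract (Fev [:-l, 1:])"
    unfolding Fev_linear q using P(2) by (simp add: field_simps)
  then have 2: "inverse (to_fract P) \<in> loc_A F" unfolding loc_A_def using nz by blast
  have pw: "x ^ m \<in> loc_A F" if "x \<in> loc_A F" for x m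
    using that by (induction m) (auto intro: loc_A_1 loc_A_mult)
  show ?thesis using pw[OF 1] pw[OF 2] by (auto simp: power_int_def)
qed

lemma loc_A_prod: "(\<And>i. i \<in> I \<Longrightarrow> f i \<in> loc_A F) \<Longrightarrow> prod f I \<in> loc_A F"
  by (induction I rule: infinite_finite_induct) (auto intro: loc_A_1 loc_A_mult)

lemma unit_without_poles:
  assumes w: "w \<in> loc_A F" "\<And>R. R \<in> dicriticals F \<Longrightarrow> w \<in> R"
  shows "\<exists>g s. s \<noteq> 0 \<and> w = to_fract (Fev g) / to_fract (Fev s)"
proof -
  obtain a s where as: "w = to_fract a / to_fract (Fev s)" "Fev s \<noteq> 0" using w(1) unfolding loc_A_def by blast
  have "to_fract a \<in> R" if R: "valuation_ring R" "kF F \<subseteq> R" for R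
  proof -
    have "w \<in> R" using R w unfolding dicriticals_def by blast
    moreover have "to_fract (Fev s) \<in> R" using Fev_in_kF[of 1 s] R(2) by (auto simp: Fev.hom_1)
    ultimately have "w * to_fract (Fev s) \<in> R" using is_subring_mult[OF valuation_ring_is_subring[OF R(1)]] by blast
    then show ?thesis using as by simp
  qed
  then obtain g where "a = Fev g" using in_all_valuation_rings_imp_in_kF by blast
  moreover have "s \<noteq> 0" using as(2) Fev.hom_0 by auto
  ultimately show ?thesis using as(1) by blast
qed

text \<open>If the components that remain after removing one from each reducible fibre outnumber the
  dicriticals other than \<open>R1\<close>, a nontrivial product of them has order 0 there. It or
  its inverse has no pole at \<open>R1\<close> either, hence lies in \<open>k(F)\<close>, and this
  is impossible while a component of each fibre is missing.\<close>

lemma card_dicriticals_ge: "card \<B> + 1 \<le> card \<Lambda> + card (dicriticals F)"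
proof (rule ccontr)
  assume gt: "\<not> card \<B> + 1 \<le> card \<Lambda> + card (dicriticals F)"
  let ?D = "dicriticals F"
  obtain R1 where R1: "R1 \<in> ?D" using dicriticals_nonempty by blast
  have "\<exists>p. p \<in> comps l" for l
    using n_comp_pos[of l] unfolding n_comp_def by (metis card.empty ex_in_conv less_numeral_extra(3))
  then obtain q where q: "\<And>l. q l \<in> comps l" by metis
  have q_inj: "inj_on q \<Lambda>"
  proof (rule inj_onI, rule ccontr)
    fix l m assume "q l = q m" "l \<noteq> m"
    then show False using q[of l] q[of m] comps_disjoint[of l m] by auto
  qed
  \<comment> \<open>One component of each reducible fibre is left out because
    \<open>F - kconst l\<close>, an element of \<open>k(F)\<close>, is a product of the components
    up to a constant.\<close>
  define I where "I = \<B> - q ` \<Lambda>"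
  have finI: "finite I" using finite_\<B> by (simp add: I_def)
  have "q ` \<Lambda> \<subseteq> \<B>" using q by (auto simp: \<B>_def)
  then have "card I = card \<B> - card \<Lambda>" "card \<Lambda> \<le> card \<B>"
    using card_Diff_subset[OF finite_imageI[OF finite_\<Lambda>], of q \<B>] card_mono[OF finite_\<B>, of "q ` \<Lambda>"]
    unfolding I_def card_image[OF q_inj] by simp_all
  moreover have "card (?D - {R1}) = card ?D - 1" "card ?D > 0"
    using R1 finite_dicriticals card_Diff_singleton[OF R1] card_gt_0_iff[of ?D] by blast+
  ultimately have "card (?D - {R1}) < card I" using gt by linarith
  from homogeneous_system_nontrivial[OF finite_Diff[OF finite_dicriticals] finI this, of "\<lambda>R p. dval R (to_fract (rep p))"]
  obtain c where c: "\<exists>p\<in>I. c p \<noteq> 0" "\<forall>R\<in>?D - {R1}. (\<Sum>p\<in>I. dval R (to_fract (rep p)) * c p) = 0" by blast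
  have fib: "\<exists>l\<in>\<Lambda>. p \<in> comps l" if "p \<in> I" for p using that by (auto simp: I_def \<B>_def)
  have rep0: "to_fract (rep p) \<noteq> 0" if "p \<in> I" for p
  proof -
    obtain l where "p \<in> comps l" using fib[OF \<open>p \<in> I\<close>] by blast
    then have "prime_elem (rep p)" using rep(1) F_minus_nonzero by blast
    then show ?thesis by auto
  qed
  have no_pole: "\<forall>p\<in>I. c p = 0"
    if R: "\<forall>R\<in>?D. (\<Sum>p\<in>I. dval R (to_fract (rep p)) * c p) \<ge> 0" for c
  proof -
    define w where "w = (\<Prod>p\<in>I. to_fract (rep p) powi c p)"
    have w0: "w \<noteq> 0" using rep0 finI by (auto simp: w_def power_int_eq_0_iff)
    have vw: "v w = (\<Sum>p\<in>I. v (to_fract (rep p)) * c p)" if "log_hom v" for v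
    proof -
      have "v w = (\<Sum>p\<in>I. v (to_fract (rep p) powi c p))" unfolding w_def
        by (rule log_hom_prod[OF that]) (use rep0 in \<open>auto simp: power_int_eq_0_iff\<close>)
      also have "\<dots> = (\<Sum>p\<in>I. v (to_fract (rep p)) * c p)"
        by (intro sum.cong refl) (simp add: log_hom_powi[OF that rep0])
      finally show ?thesis .
    qed
    have "w \<in> loc_A F" unfolding w_def
    proof (rule loc_A_prod)
      fix p assume "p \<in> I"
      then obtain l where l: "p \<in> comps l" using fib by blast
      show "to_fract (rep p) powi c p \<in> loc_A F"
        using loc_A_powi[OF rep(3)[OF l F_minus_nonzero]] rep(1)[OF l F_minus_nonzero] by auto
    qed
    moreover have "w \<in> S" if "S \<in> ?D" for S
      using R that mem_dicritical_iff[OF that w0] vw[OF log_hom_dval, of S] by simp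
    ultimately obtain g s where gs: "s \<noteq> 0" "w = to_fract (Fev g) / to_fract (Fev s)"
      using unit_without_poles by blast
    have g0: "g \<noteq> 0" using gs(2) w0 Fev.hom_0 by auto
    have F0: "Fev g \<noteq> 0" "Fev s \<noteq> 0" using g0 gs(1) Fev_inj by blast+
    have ord1: "padic_ord (rep p) w = (int (order l g) - int (order l s)) * int (bi_mult (rep p) (F - kconst l))"
      if p: "p \<in> comps l" for p l
    proof -
      note r = rep[OF p F_minus_nonzero]
      show ?thesis unfolding gs(2)
        using additive_order.fract_ord_fract[OF additive_order_bi_mult[OF r(1)] F0]
          bi_mult_Fev[OF r(1,3) g0] bi_mult_Fev[OF r(1,3) gs(1)] by (simp add: algebra_simps)
    qed
    have ord2: "padic_ord (rep p) w = (if p \<in> I then c p else 0)" if p: "p \<in> comps l" for p l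
    proof -
      note r = rep[OF p F_minus_nonzero]
      have "padic_ord (rep p) (to_fract (rep p')) * c p' = (if p' = p then c p' else 0)" if p': "p' \<in> I" for p'
      proof -
        obtain l' where l': "p' \<in> comps l'" using fib[OF p'] by blast
        note r' = rep[OF l' F_minus_nonzero]
        have nz: "rep p' \<noteq> 0" using r'(1) by auto
        show ?thesis
        proof (cases "p' = p")
          case True
          have "padic_ord (rep p) (to_fract (rep p)) = 1"
            using padic_ord_to_fract[OF r(1), of "rep p"] bi_mult_self[OF r(1)] nz True by simp
          then show ?thesis using True by simp
        next
          case False
          have "\<not> rep p dvd rep p'"
            using prime_elem_dvd_imp_gen_by_eq[OF r(1) r'(1)] r(2) r'(2) False by auto
          then have "padic_ord (rep p) (to_fract (rep p')) = 0"
            using padic_ord_to_fract[OF r(1) nz] bi_mult_pos_iff[OF r(1) nz] by simp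
          then show ?thesis using False by simp
        qed
      qed
      then have "(\<Sum>p'\<in>I. padic_ord (rep p) (to_fract (rep p')) * c p') = (\<Sum>p'\<in>I. if p' = p then c p' else 0)"
        by (rule sum.cong[OF refl])
      then show ?thesis unfolding vw[OF log_hom_padic[OF r(1)]] using finI by (simp add: sum.delta)
    qed
    \<comment> \<open>As \<open>w\<close> is a quotient of polynomials in \<open>F\<close>, its
      orders along the components of one fibre are the multiplicities times a common integer. The
      omitted component \<open>q l\<close> has order 0, so this integer is 0.\<close>
    show ?thesis
    proof
      fix p assume p: "p \<in> I"
      then obtain l where l: "l \<in> \<Lambda>" "p \<in> comps l" using fib by blast
      have "q l \<notin> I" using l(1) by (simp add: I_def)
      then have "(int (order l g) - int (order l s)) * int (bi_mult (rep (q l)) (F - kconst l)) = 0"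
        using ord1[OF q, of l] ord2[OF q, of l] by simp
      moreover have "bi_mult (rep (q l)) (F - kconst l) > 0"
        using rep[OF q F_minus_nonzero, of l] bi_mult_pos_iff F_minus_nonzero by blast
      ultimately have "int (order l g) - int (order l s) = 0" by simp
      then show "c p = 0" using ord1[OF l(2)] ord2[OF l(2)] p by simp
    qed
  qed
  show False
  \<comment> \<open>No condition was imposed at \<open>R1\<close>; if the order there is negative,
    the inverse product, with exponents \<open>- c p\<close>, has no poles.\<close>
  proof (cases "(\<Sum>p\<in>I. dval R1 (to_fract (rep p)) * c p) \<ge> 0")
    case True
    have "(\<Sum>p\<in>I. dval R (to_fract (rep p)) * c p) \<ge> 0" if "R \<in> ?D" for R
      using True c(2) that by (cases "R = R1") simp_all
    then show False using no_pole[of c] c(1) by blast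
  next
    case False
    have "(\<Sum>p\<in>I. dval R (to_fract (rep p)) * - c p) \<ge> 0" if "R \<in> ?D" for R
      using False c(2) that by (cases "R = R1") (simp_all add: sum_negf)
    then have "\<forall>p\<in>I. - c p = 0" using no_pole[of "\<lambda>p. - c p"] by blast
    then show False using c(1) by simp
  qed
qed

theorem card_dicriticals:
  "finite {l. n_comp F l \<noteq> 1} \<and>
    int (card (dicriticals F)) - 1 = (\<Sum>l\<in>{l. n_comp F l \<noteq> 1}. int (n_comp F l) - 1)"
proof -
  have "card \<Lambda> + card (dicriticals F) = card \<B> + 1"
    using card_dicriticals_le[OF subset_refl finite_dicriticals dicriticals_nonempty] card_dicriticals_ge by simp
  then have "int (card (dicriticals F)) - 1 = int (card \<B>) - int (card \<Lambda>)" by linarith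
  also have "\<dots> = (\<Sum>l\<in>\<Lambda>. int (n_comp F l) - 1)"
    unfolding card_\<B> by (simp add: sum_subtractf)
  finally show ?thesis using finite_\<Lambda> unfolding \<Lambda>_def by blast
qed

end

theorem mainTheorem4:
  fixes F :: "'k::alg_closed_field poly poly"
  assumes "generally_rational F"
  shows "finite {l. n_comp F l \<noteq> 1} \<and>
         int (card (dicriticals F)) - 1 = (\<Sum>l\<in>{l. n_comp F l \<noteq> 1}. int (n_comp F l) - 1)"
proof -
  have \<kappa>: "type_ring_hom (\<lambda>p :: 'k poly. to_ac (to_fract p))" by standard auto
  obtain \<psi> :: "'k poly poly \<Rightarrow> 'k poly fract alg_closure poly fract" where \<psi>: "type_ring_hom \<psi>"
    "\<forall>G. \<psi> G = 0 \<longrightarrow> G = 0" "\<forall>a. \<psi> (kconst a) = fconst (to_ac (to_fract [:a:]))"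
    "\<psi> F = fconst (to_ac (to_fract [:0, 1:]))" "\<exists>G. \<psi> G \<notin> range fconst"
    using generic_parametrization[OF \<kappa> _ assms] by auto
  interpret generic_fibration F \<psi>
    using assms \<psi> by (intro generic_fibration.intro) auto
  show ?thesis by (rule card_dicriticals)
qed

end
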